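(* There is a deterministic algorithm with the following guarantee. Its input consists of positive integers $n,d,m$, black-box (evaluation) access to a polynomial $f\in\mathbb{Z}[x_1,\dots,x_n]$ with $f=\sum_{\mathbf{v}\in\Gamma}a_{\mathbf{v}}Y_{\mathbf{v}}$, where $\Gamma\subseteq\mathbb{N}^n$ is finite, each $a_{\mathbf{v}}\in\mathbb{Z}\setminus\{0\}$, and with the promise that $\deg(f)\le d$ and $|\Gamma|\le m$; and access to an oracle that, given $\mathbf{v}$ and a point $\mathbf{a}\in\mathbb{N}^n$, returns $Y_{\mathbf{v}}(\mathbf{a})$. The algorithm outputs the expansion of $f$ in the Schubert basis, i.e. the set $\Gamma$ and the coefficients $(a_{\mathbf{v}})_{\mathbf{v}\in\Gamma}$, and runs in time polynomial in $n$, $d$, $m$ and $\log\big(\sum_{\mathbf{v}\in\Gamma}|a_{\mathbf{v}}|\big)$ (oracle calls counted at unit cost).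
   Context: Codes: elements $\mathbf{v}=(v_1,\dots,v_n)\in\mathbb{N}^n$; a code is identified with its extension by trailing zeros $(v_1,\dots,v_n,0,\dots,0)\in\mathbb{N}^M$, $M\ge n$. A code is dominant if $v_1\ge v_2\ge\dots\ge v_n$. For $i\ge1$ the divided difference operator is $\partial_i f=\frac{f-f^{\chi_i}}{x_i-x_{i+1}}$, where $f^{\chi_i}$ is $f$ with $x_i$ and $x_{i+1}$ exchanged. Schubert polynomials $Y_{\mathbf{v}}$ are defined recursively: (1) if $\mathbf{v}$ is dominant, $Y_{\mathbf{v}}=x_1^{v_1}\cdots x_n^{v_n}$; (2) if $v_i>v_{i+1}$, then $Y_{\mathbf{v}'}=\partial_iY_{\mathbf{v}}$ where $\mathbf{v}'=(v_1,\dots,v_{i-1},v_{i+1},v_i-1,v_{i+2},\dots)$. This defines $Y_{\mathbf{v}}$ for every code; for $\mathbf{v}\in\mathbb{N}^n$, $Y_{\mathbf{v}}\in\mathbb{Z}[x_1,\dots,x_n]$ is homogeneous of degree $|\mathbf{v}|=\sum_i v_i$, and $\{Y_{\mathbf{v}}:\mathbf{v}\in\mathbb{N}^n\}$ is a $\mathbb{Z}$-basis of $\mathbb{Z}[x_1,\dots,x_n]$. *)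

theory Defs
  imports
    Complex_Main
    "HOL-Library.Poly_Mapping"
    "HOL-Library.Log_Nat"
    "HOL-Combinatorics.Transposition"
begin

section \<open>Polynomials\<close>

text \<open>
  Integer polynomials in countably many variables, as finitely supported maps from exponent
  vectors to coefficients. Indices start at 0: the mathematical variable $x_{i+1}$ has index i.
\<close>

type_synonym expo = "nat \<Rightarrow>\<^sub>0 nat"
type_synonym zpoly = "expo \<Rightarrow>\<^sub>0 int"

definition monomial :: "expo \<Rightarrow> zpoly" where
  "monomial e = Poly_Mapping.single e 1"

definition var :: "nat \<Rightarrow> zpoly" where
  "var i = monomial (Poly_Mapping.single i 1)"

definition zpolys :: "nat \<Rightarrow> zpoly set" where
  "zpolys n = {p. \<forall>e \<in> Poly_Mapping.keys p. Poly_Mapping.keys e \<subseteq> {..<n}}"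

text \<open>The zero polynomial gets degree 0.\<close>

definition total_degree :: "zpoly \<Rightarrow> nat" where
  "total_degree p =
     Max (insert 0 ((\<lambda>e. \<Sum>i\<in>Poly_Mapping.keys e. Poly_Mapping.lookup e i) ` Poly_Mapping.keys p))"

definition eval_poly :: "zpoly \<Rightarrow> (nat \<Rightarrow> int) \<Rightarrow> int" where
  "eval_poly p x =
     (\<Sum>e\<in>Poly_Mapping.keys p. Poly_Mapping.lookup p e *
        (\<Prod>i\<in>Poly_Mapping.keys e. x i ^ Poly_Mapping.lookup e i))"

text \<open>Variables beyond the length of the list are evaluated at 0.\<close>

definition eval_list :: "zpoly \<Rightarrow> int list \<Rightarrow> int" where
  "eval_list p xs = eval_poly p (\<lambda>i. if i < length xs then xs ! i else 0)"


section \<open>Schubert polynomials\<close>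

text \<open>
  The polynomial with the variables of index \<open>i\<close> and \<open>Suc i\<close> exchanged; the inner
  \<open>map_key\<close> permutes the entries of an exponent vector.
\<close>

definition swap_vars :: "nat \<Rightarrow> zpoly \<Rightarrow> zpoly" where
  "swap_vars i p = Poly_Mapping.map_key (Poly_Mapping.map_key (transpose i (Suc i))) p"

text \<open>The quotient is exact and unique, since \<open>zpoly\<close> is an integral domain.\<close>

definition divided_difference :: "nat \<Rightarrow> zpoly \<Rightarrow> zpoly" where
  "divided_difference i p = (THE q. q * (var i - var (Suc i)) = p - swap_vars i p)"

text \<open>
  A code is a finitely supported sequence, which is exactly a finite sequence up to trailing
  zeros. It has the same type as an exponent vector.
\<close>

type_synonym code = "nat \<Rightarrow>\<^sub>0 nat"

definition dominant :: "code \<Rightarrow> bool" where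
  "dominant v \<longleftrightarrow> antimono (Poly_Mapping.lookup v)"

definition code_step :: "nat \<Rightarrow> code \<Rightarrow> code" where
  "code_step i v =
     Poly_Mapping.update i (Poly_Mapping.lookup v (Suc i))
       (Poly_Mapping.update (Suc i) (Poly_Mapping.lookup v i - 1) v)"

inductive is_schubert :: "code \<Rightarrow> zpoly \<Rightarrow> bool" where
  dominant: "dominant v \<Longrightarrow> is_schubert v (monomial v)"
| step: "is_schubert v p \<Longrightarrow> Poly_Mapping.lookup v i > Poly_Mapping.lookup v (Suc i) \<Longrightarrow>
    is_schubert (code_step i v) (divided_difference i p)"

definition schubert :: "code \<Rightarrow> zpoly" where
  "schubert v = (THE p. is_schubert v p)"

abbreviation schubert_list :: "nat list \<Rightarrow> zpoly" where
  "schubert_list v \<equiv> schubert (Poly_Mapping.nth v)"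


section \<open>Algorithms with oracles and their running time\<close>

text \<open>
  Algorithms are programs of a While language over finitely many registers that hold integers of
  arbitrary size or finite nested lists of such. The time measure is a bit cost: evaluating any
  node of an expression costs one plus the size (in bits) of its value, so each primitive
  operation is charged for its complete operands and its complete result. All primitives are
  computable in polynomial time in these sizes, hence this time is polynomially related to the
  running time of an oracle Turing machine.
\<close>

datatype val = Num int | Lst "val list"

text \<open>\<open>floorlog 2 k\<close> is the length of the binary representation of \<open>k\<close>.\<close>

fun val_size :: "val \<Rightarrow> nat" where
  "val_size (Num i) = 1 + floorlog 2 (nat \<bar>i\<bar>)"
| "val_size (Lst vs) = 1 + sum_list (map val_size vs)"

fun as_int :: "val \<Rightarrow> int" where
  "as_int (Num i) = i"
| "as_int (Lst vs) = 0"

fun as_list :: "val \<Rightarrow> val list" where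
  "as_list (Num i) = []"
| "as_list (Lst vs) = vs"

definition val_of_bool :: "bool \<Rightarrow> val" where
  "val_of_bool b = Num (if b then 1 else 0)"

datatype expr =
    Const val
  | Reg string
  | Add expr expr
  | Sub expr expr
  | Mul expr expr
  | Div expr expr
  | Mod expr expr
  | Less expr expr
  | Equal expr expr
  | Prepend expr expr
  | Head expr
  | Tail expr

type_synonym state = "string \<Rightarrow> val"

text \<open>
  Ill-typed operands are coerced; \<open>div\<close> and \<open>mod\<close> are floor division and its remainder.
\<close>

fun eval :: "expr \<Rightarrow> state \<Rightarrow> val" where
  "eval (Const v) s = v"
| "eval (Reg x) s = s x"
| "eval (Add a b) s = Num (as_int (eval a s) + as_int (eval b s))"
| "eval (Sub a b) s = Num (as_int (eval a s) - as_int (eval b s))"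
| "eval (Mul a b) s = Num (as_int (eval a s) * as_int (eval b s))"
| "eval (Div a b) s = Num (as_int (eval a s) div as_int (eval b s))"
| "eval (Mod a b) s = Num (as_int (eval a s) mod as_int (eval b s))"
| "eval (Less a b) s = val_of_bool (as_int (eval a s) < as_int (eval b s))"
| "eval (Equal a b) s = val_of_bool (eval a s = eval b s)"
| "eval (Prepend a b) s = Lst (eval a s # as_list (eval b s))"
| "eval (Head a) s = (case as_list (eval a s) of [] \<Rightarrow> Num 0 | v # vs \<Rightarrow> v)"
| "eval (Tail a) s = Lst (tl (as_list (eval a s)))"

fun cost :: "expr \<Rightarrow> state \<Rightarrow> nat" where
  "cost (Const v) s = 1 + val_size v"
| "cost (Reg x) s = 1 + val_size (s x)"
| "cost (Add a b) s = 1 + val_size (eval (Add a b) s) + cost a s + cost b s"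
| "cost (Sub a b) s = 1 + val_size (eval (Sub a b) s) + cost a s + cost b s"
| "cost (Mul a b) s = 1 + val_size (eval (Mul a b) s) + cost a s + cost b s"
| "cost (Div a b) s = 1 + val_size (eval (Div a b) s) + cost a s + cost b s"
| "cost (Mod a b) s = 1 + val_size (eval (Mod a b) s) + cost a s + cost b s"
| "cost (Less a b) s = 1 + val_size (eval (Less a b) s) + cost a s + cost b s"
| "cost (Equal a b) s = 1 + val_size (eval (Equal a b) s) + cost a s + cost b s"
| "cost (Prepend a b) s = 1 + val_size (eval (Prepend a b) s) + cost a s + cost b s"
| "cost (Head a) s = 1 + val_size (eval (Head a) s) + cost a s"
| "cost (Tail a) s = 1 + val_size (eval (Tail a) s) + cost a s"

datatype com =
    Skip
  | Assign string expr
  | Comp com com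
  | Cond expr com com
  | While expr com
  | QueryPoly string expr
  | QuerySchubert string expr expr

definition val_of_ints :: "int list \<Rightarrow> val" where
  "val_of_ints xs = Lst (map Num xs)"

definition val_of_nats :: "nat list \<Rightarrow> val" where
  "val_of_nats xs = val_of_ints (map int xs)"

text \<open>
  Big-step semantics: \<open>exec n F Y c s t s'\<close> means that \<open>c\<close>, started in \<open>s\<close>, halts in \<open>s'\<close> after time
  \<open>t\<close>. \<open>F\<close> answers queries at points of $Z^n$, and \<open>Y\<close> answers queries consisting of a code in
  $N^n$ and a point of $N^n$. A query that is not of this form has no transition, so the program
  does not halt. The time for a query is one plus the cost of building its arguments; the answer
  is not charged until it is used.
\<close>

inductive exec ::
  "nat \<Rightarrow> (int list \<Rightarrow> int) \<Rightarrow> (nat list \<Rightarrow> nat list \<Rightarrow> int) \<Rightarrow> com \<Rightarrow> state \<Rightarrow> nat \<Rightarrow> state \<Rightarrow> bool"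
  for n :: nat and F :: "int list \<Rightarrow> int" and Y :: "nat list \<Rightarrow> nat list \<Rightarrow> int"
where
  Skip: "exec n F Y Skip s 1 s"
| Assign: "exec n F Y (Assign x e) s (1 + cost e s) (s(x := eval e s))"
| Comp: "exec n F Y c1 s t1 s1 \<Longrightarrow> exec n F Y c2 s1 t2 s2 \<Longrightarrow>
    exec n F Y (Comp c1 c2) s (1 + t1 + t2) s2"
| CondTrue: "eval b s \<noteq> Num 0 \<Longrightarrow> exec n F Y c1 s t s' \<Longrightarrow>
    exec n F Y (Cond b c1 c2) s (1 + cost b s + t) s'"
| CondFalse: "eval b s = Num 0 \<Longrightarrow> exec n F Y c2 s t s' \<Longrightarrow>
    exec n F Y (Cond b c1 c2) s (1 + cost b s + t) s'"
| WhileTrue: "eval b s \<noteq> Num 0 \<Longrightarrow> exec n F Y c s t1 s1 \<Longrightarrow> exec n F Y (While b c) s1 t2 s2 \<Longrightarrow>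
    exec n F Y (While b c) s (1 + cost b s + t1 + t2) s2"
| WhileFalse: "eval b s = Num 0 \<Longrightarrow> exec n F Y (While b c) s (1 + cost b s) s"
| QueryPoly: "eval e s = val_of_ints xs \<Longrightarrow> length xs = n \<Longrightarrow>
    exec n F Y (QueryPoly x e) s (1 + cost e s) (s(x := Num (F xs)))"
| QuerySchubert: "eval e1 s = val_of_nats v \<Longrightarrow> length v = n \<Longrightarrow>
    eval e2 s = val_of_nats xs \<Longrightarrow> length xs = n \<Longrightarrow>
    exec n F Y (QuerySchubert x e1 e2) s (1 + cost e1 s + cost e2 s) (s(x := Num (Y v xs)))"

inductive_cases exec_SkipE: "exec n F Y Skip s t s'"
inductive_cases exec_AssignE: "exec n F Y (Assign x e) s t s'"
inductive_cases exec_CompE: "exec n F Y (Comp c1 c2) s t s'"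
inductive_cases exec_CondE: "exec n F Y (Cond b c1 c2) s t s'"
inductive_cases exec_WhileE: "exec n F Y (While b c) s t s'"
inductive_cases exec_QueryPolyE: "exec n F Y (QueryPoly x e) s t s'"
inductive_cases exec_QuerySchubertE: "exec n F Y (QuerySchubert x e1 e2) s t s'"

lemma val_of_ints_inject [simp]: "val_of_ints xs = val_of_ints ys \<longleftrightarrow> xs = ys"
  by (simp add: val_of_ints_def inj_def)

lemma val_of_nats_inject [simp]: "val_of_nats xs = val_of_nats ys \<longleftrightarrow> xs = ys"
  by (simp add: val_of_nats_def inj_def)

lemma exec_deterministic:
  "exec n F Y c s t s' \<Longrightarrow> exec n F Y c s u s'' \<Longrightarrow> t = u \<and> s' = s''"
proof (induction arbitrary: u s'' rule: exec.induct)
  case (Skip s)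
  from Skip.prems show ?case by (rule exec_SkipE) simp
next
  case (Assign x e s)
  from Assign.prems show ?case by (rule exec_AssignE) simp
next
  case (Comp c1 s t1 s1 c2 t2 s2)
  from Comp.prems obtain t1' s1' t2' where u: "u = 1 + t1' + t2'"
    and 1: "exec n F Y c1 s t1' s1'" and 2: "exec n F Y c2 s1' t2' s''"
    by (rule exec_CompE) simp
  from Comp.IH(1)[OF 1] 2 have "exec n F Y c2 s1 t2' s''" by simp
  from Comp.IH(1)[OF 1] Comp.IH(2)[OF this] u show ?case by simp
next
  case (CondTrue b s c1 t s' c2)
  from CondTrue.prems CondTrue.hyps(1) obtain t' where u: "u = 1 + cost b s + t'"
    and 1: "exec n F Y c1 s t' s''"
    by (auto elim: exec_CondE)
  from CondTrue.IH[OF 1] u show ?case by simp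
next
  case (CondFalse b s c2 t s' c1)
  from CondFalse.prems CondFalse.hyps(1) obtain t' where u: "u = 1 + cost b s + t'"
    and 1: "exec n F Y c2 s t' s''"
    by (auto elim: exec_CondE)
  from CondFalse.IH[OF 1] u show ?case by simp
next
  case (WhileTrue b s c t1 s1 t2 s2)
  from WhileTrue.prems WhileTrue.hyps(1) obtain t1' s1' t2' where u: "u = 1 + cost b s + t1' + t2'"
    and 1: "exec n F Y c s t1' s1'" and 2: "exec n F Y (While b c) s1' t2' s''"
    by (auto elim: exec_WhileE)
  from WhileTrue.IH(1)[OF 1] 2 have "exec n F Y (While b c) s1 t2' s''" by simp
  from WhileTrue.IH(1)[OF 1] WhileTrue.IH(2)[OF this] u show ?case by simp
next
  case (WhileFalse b s c)
  from WhileFalse.prems show ?case by (rule exec_WhileE) (simp_all add: WhileFalse.hyps)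
next
  case (QueryPoly e s xs x)
  from QueryPoly.prems QueryPoly.hyps(1) show ?case by (elim exec_QueryPolyE) simp
next
  case (QuerySchubert e1 s v e2 xs x)
  from QuerySchubert.prems QuerySchubert.hyps(1,3) show ?case by (elim exec_QuerySchubertE) simp
qed

definition input_state :: "nat \<Rightarrow> nat \<Rightarrow> nat \<Rightarrow> state" where
  "input_state n d m =
     (\<lambda>_. Num 0)(''n'' := Num (int n), ''d'' := Num (int d), ''m'' := Num (int m))"

definition val_of_expansion :: "(nat list \<times> int) list \<Rightarrow> val" where
  "val_of_expansion ps = Lst (map (\<lambda>(v, c). Lst [val_of_nats v, Num c]) ps)"

text \<open>
  The expansion is a set, so the program may list its terms in any order, each exactly once.
\<close>

definition outputs_expansion :: "state \<Rightarrow> nat list set \<Rightarrow> (nat list \<Rightarrow> int) \<Rightarrow> bool" where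
  "outputs_expansion s \<Gamma> a \<longleftrightarrow>
     (\<exists>ps. s ''out'' = val_of_expansion ps \<and> distinct ps \<and> set ps = (\<lambda>v. (v, a v)) ` \<Gamma>)"

end

theory Submission
  imports Defs
begin

text \<open>
  Schubert polynomials are well defined because codes can be raised, by inverting the steps of the
  definition, to strictly decreasing codes, and any two ways of doing so are related by the
  commutation and braid relations of the divided differences. Clearing a code entry by entry yields
  a composition of divided differences that takes its Schubert polynomial to 1, kills all others of
  the same degree, and takes a monomial to a nonzero polynomial only if the tails of its exponent
  vector dominate those of the code. Hence, for increasing weights \<open>c\<close>, the unique monomial of
  $Y_v$ of maximal weight is $x^v$, with coefficient 1.

  Let $p_1, \dots, p_n$ be pairwise coprime. For a modulus \<open>q\<close> put $c_i = iq + ((d+1)^i \bmod q)$,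
  and evaluate the polynomial at $x_i = p_i^k j^{c_i}$. For \<open>E\<close> from $dnq$ downwards, the \<open>E\<close>-th finite
  difference in \<open>j\<close> of the part of weight at most \<open>E\<close> equals, up to a known factor, the power sum
  $\sum a_v b_v^k$ over the codes of weight exactly \<open>E\<close>, with $b_v = \prod p_i^{v_i}$. Since at most \<open>m\<close>
  terms occur, the power sums for $k = 0, \dots, m$ vanish only if there is no such code, and form a
  geometric sequence only if there is exactly one; then $b_v$, \<open>v\<close> and $a_v$ can be read off, and the term
  is subtracted. Otherwise \<open>q\<close> is discarded. The weights of all codes are distinct unless \<open>q\<close> divides
  one of at most $m^2$ nonzero differences of numbers below $(d+1)^n$, and as the least common
  multiple of $1, \dots, Q$ is at least $2^{Q-1}$, some $q \le dnm^2 + 2$ succeeds.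
\<close>

text \<open>A Schubert polynomial can have exponentially many monomials, so \<open>f\<close> is
  never expanded into monomials. Only leading monomials are read off, and the oracle supplies the
  value of each term already found so that the whole term can be subtracted. The weights
  \<open>(d+1)^i\<close> would give every code its own level, but would need exponentially many
  levels. Reduction modulo \<open>q\<close> keeps the levels few at the price of possible
  collisions, and the summand \<open>i*q\<close> restores the strict increase on which leading
  monomials depend. A collision need not be predicted, since the samples reveal it: \<open>j\<close>
  isolates a level, while \<open>k\<close> counts and identifies the codes inside it. A modulus that
  passes at every level gives a correct answer, even if it was not known in advance to separate the
  codes, and a separating modulus always passes. So the search over \<open>q\<close> is
  deterministic. The number \<open>m + 1\<close> of power sums has one sum for each possible code of
  a level and one for the ratio of the sequence. All points have entries in the natural numbers, as
  the oracle demands.\<close>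

abbreviation lookup :: "('a \<Rightarrow>\<^sub>0 'b::zero) \<Rightarrow> 'a \<Rightarrow> 'b" where "lookup \<equiv> Poly_Mapping.lookup"
abbreviation keys :: "('a \<Rightarrow>\<^sub>0 'b::zero) \<Rightarrow> 'a set" where "keys \<equiv> Poly_Mapping.keys"

section \<open>Divided differences\<close>

definition swap_expo :: "nat \<Rightarrow> expo \<Rightarrow> expo" where
  "swap_expo i e = Poly_Mapping.map_key (transpose i (Suc i)) e"

lemma lookup_swap_expo: "lookup (swap_expo i e) k = lookup e (transpose i (Suc i) k)"
  unfolding swap_expo_def by (simp add: map_key.rep_eq)

lemma swap_expo_swap_expo [simp]: "swap_expo i (swap_expo i e) = e"
  by (rule poly_mapping_eqI) (simp add: lookup_swap_expo)

lemma inj_swap_expo: "inj (swap_expo i)"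
  by (metis swap_expo_swap_expo injI)

lemma swap_expo_add: "swap_expo i (e + e') = swap_expo i e + swap_expo i e'"
  by (rule poly_mapping_eqI) (simp add: lookup_swap_expo lookup_add)

lemma lookup_swap_vars: "lookup (swap_vars i p) e = lookup p (swap_expo i e)"
proof -
  have "Poly_Mapping.map_key (transpose i (Suc i)) = swap_expo i"
    by (auto simp: swap_expo_def)
  then show ?thesis unfolding swap_vars_def
    using inj_swap_expo[of i] by (simp add: map_key.rep_eq)
qed

lemma swap_vars_single: "swap_vars i (Poly_Mapping.single e c) = Poly_Mapping.single (swap_expo i e) c"
  by (rule poly_mapping_eqI) (auto simp: lookup_swap_vars lookup_single when_def)

lemma swap_vars_monomial [simp]: "swap_vars i (monomial e) = monomial (swap_expo i e)"
  by (simp add: monomial_def swap_vars_single)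

lemma swap_vars_0 [simp]: "swap_vars i 0 = 0"
  by (rule poly_mapping_eqI) (simp add: lookup_swap_vars)

lemma swap_vars_diff: "swap_vars i (p - q) = swap_vars i p - swap_vars i q"
  by (rule poly_mapping_eqI) (simp add: lookup_swap_vars lookup_minus)

lemma swap_vars_swap_vars [simp]: "swap_vars i (swap_vars i p) = p"
  by (rule poly_mapping_eqI) (simp add: lookup_swap_vars)

text \<open>Integer polynomials are the free abelian group on exponent vectors, so an additive
  identity need only be checked on monomials and carried through differences.\<close>

lemma zpoly_induct [case_names zero monomial diff]:
  assumes "P 0" "\<And>e. P (monomial e)" "\<And>p q. P p \<Longrightarrow> P q \<Longrightarrow> P (p - q)"
  shows "P (p :: zpoly)"
proof (rule frag_induction[of p UNIV])
  show "P (frag_of e)" for e using assms(2) by (simp add: monomial_def)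
qed (use assms in auto)

lemma monomial_add: "monomial (e + e') = monomial e * monomial e'"
  by (simp add: monomial_def mult_single)

lemma monomial_0 [simp]: "monomial 0 = 1"
  by (simp add: monomial_def)

lemma swap_vars_mult: "swap_vars i (p * q) = swap_vars i p * swap_vars i q"
proof (induction p rule: zpoly_induct)
  case (monomial e)
  show ?case
    by (induction q rule: zpoly_induct)
       (simp_all add: monomial_add[symmetric] swap_expo_add right_diff_distrib swap_vars_diff)
qed (simp_all add: left_diff_distrib swap_vars_diff)

lemma swap_expo_single: "swap_expo i (Poly_Mapping.single k c) = Poly_Mapping.single (transpose i (Suc i) k) c"
  by (rule poly_mapping_eqI) (auto simp: lookup_swap_expo lookup_single when_def transpose_def)

lemma swap_vars_var: "swap_vars i (var k) = var (transpose i (Suc i) k)"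
  by (simp add: var_def swap_expo_single)

lemma swap_vars_var1 [simp]: "swap_vars i (var i) = var (Suc i)"
  and swap_vars_var2 [simp]: "swap_vars i (var (Suc i)) = var i"
  and swap_vars_var_other: "k \<noteq> i \<Longrightarrow> k \<noteq> Suc i \<Longrightarrow> swap_vars i (var k) = var k"
  by (simp_all add: swap_vars_var)

lemma swap_vars_commute:
  assumes "Suc i < j"
  shows "swap_vars i (swap_vars j p) = swap_vars j (swap_vars i p)"
proof (rule poly_mapping_eqI)
  fix e
  have "swap_expo j (swap_expo i e) = swap_expo i (swap_expo j e)"
    using assms by (intro poly_mapping_eqI) (auto simp: lookup_swap_expo transpose_def)
  then show "lookup (swap_vars i (swap_vars j p)) e = lookup (swap_vars j (swap_vars i p)) e"
    by (simp add: lookup_swap_vars)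
qed

lemma swap_vars_braid:
  "swap_vars i (swap_vars (Suc i) (swap_vars i p)) = swap_vars (Suc i) (swap_vars i (swap_vars (Suc i) p))"
proof (rule poly_mapping_eqI)
  fix e
  have "swap_expo i (swap_expo (Suc i) (swap_expo i e)) = swap_expo (Suc i) (swap_expo i (swap_expo (Suc i) e))"
    by (intro poly_mapping_eqI) (auto simp: lookup_swap_expo transpose_def)
  then show "lookup (swap_vars i (swap_vars (Suc i) (swap_vars i p))) e
     = lookup (swap_vars (Suc i) (swap_vars i (swap_vars (Suc i) p))) e"
    by (simp add: lookup_swap_vars)
qed

text \<open>Makes the denominators \<open>var i - var (Suc i)\<close> nonzero, so that they can be
  cancelled.\<close>

lemma var_eq_iff [simp]: "var i = var j \<longleftrightarrow> i = j"
proof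
  assume "var i = var j"
  then have "lookup (var i) (Poly_Mapping.single i 1) = lookup (var j) (Poly_Mapping.single i 1)" by simp
  then have "Poly_Mapping.single j (1::nat) = Poly_Mapping.single i 1"
    by (auto simp: var_def monomial_def lookup_single when_def split: if_splits)
  then have "lookup (Poly_Mapping.single j (1::nat)) i = lookup (Poly_Mapping.single i (1::nat)) i"
    by (simp only:)
  then show "i = j" by (simp add: lookup_single when_def split: if_splits)
qed simp

definition set_pair :: "nat \<Rightarrow> nat \<Rightarrow> nat \<Rightarrow> expo \<Rightarrow> expo" where
  "set_pair i x y e = Poly_Mapping.update i x (Poly_Mapping.update (Suc i) y e)"

lemma lookup_set_pair:
  "lookup (set_pair i x y e) k = (if k = i then x else if k = Suc i then y else lookup e k)"
  by (simp add: set_pair_def lookup_update)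

text \<open>The geometric sum that is the quotient of \<open>x^a y^b - x^b y^a\<close> by
  \<open>x - y\<close>, with the remaining variables as a common factor.\<close>

definition dd_monomial :: "nat \<Rightarrow> expo \<Rightarrow> zpoly" where
  "dd_monomial i e = (let a = lookup e i; b = lookup e (Suc i) in
     if b \<le> a then \<Sum>t<a-b. monomial (set_pair i (a - 1 - t) (b + t) e)
     else - (\<Sum>t<b-a. monomial (set_pair i (b - 1 - t) (a + t) e)))"

lemma dd_monomial_mult:
  "dd_monomial i e * (var i - var (Suc i)) = monomial e - monomial (swap_expo i e)"
proof -
  let ?a = "lookup e i" and ?b = "lookup e (Suc i)"
  have tele: "(\<Sum>t<a-b. monomial (set_pair i (a - 1 - t) (b + t) e)) * (var i - var (Suc i))
     = monomial (set_pair i a b e) - monomial (set_pair i b a e)" if "b \<le> a" for a b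
  proof -
    define g where "g t = monomial (set_pair i (a - t) (b + t) e)" for t
    have step: "monomial (set_pair i (a - 1 - t) (b + t) e) * (var i - var (Suc i)) = g t - g (Suc t)"
      if t: "t < a - b" for t
    proof -
      have 1: "set_pair i (a - 1 - t) (b + t) e + Poly_Mapping.single i 1 = set_pair i (a - t) (b + t) e"
        using t by (intro poly_mapping_eqI) (auto simp: lookup_set_pair lookup_add lookup_single when_def)
      have 2: "set_pair i (a - 1 - t) (b + t) e + Poly_Mapping.single (Suc i) 1 = set_pair i (a - Suc t) (b + Suc t) e"
        using t by (intro poly_mapping_eqI) (auto simp: lookup_set_pair lookup_add lookup_single when_def)
      show ?thesis unfolding g_def right_diff_distrib var_def monomial_add[symmetric] 1 2 ..
    qed
    have "(\<Sum>t<a-b. monomial (set_pair i (a - 1 - t) (b + t) e)) * (var i - var (Suc i)) = (\<Sum>t<a-b. g t - g (Suc t))"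
      unfolding sum_distrib_right by (intro sum.cong refl step) auto
    also have "\<dots> = g 0 - g (a - b)" by (rule sum_lessThan_telescope')
    finally show ?thesis using that by (simp add: g_def)
  qed
  have e1: "set_pair i ?a ?b e = e"
    by (intro poly_mapping_eqI) (auto simp: lookup_set_pair)
  have e2: "set_pair i ?b ?a e = swap_expo i e"
    by (intro poly_mapping_eqI) (auto simp: lookup_set_pair lookup_swap_expo transpose_def)
  show ?thesis
  proof (cases "?b \<le> ?a")
    case True
    then show ?thesis using tele[OF True] by (simp add: dd_monomial_def Let_def e1 e2)
  next
    case False
    then show ?thesis using tele[of ?a ?b] by (simp add: dd_monomial_def Let_def e1 e2)
  qed
qed

lemma divided_difference_unique:
  assumes "q * (var i - var (Suc i)) = p - swap_vars i p"
  shows "divided_difference i p = q"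
  unfolding divided_difference_def
proof (rule the_equality)
  show "q * (var i - var (Suc i)) = p - swap_vars i p" by (rule assms)
next
  fix q' assume "q' * (var i - var (Suc i)) = p - swap_vars i p"
  with assms show "q' = q" by (metis mult_right_cancel right_minus_eq var_eq_iff n_not_Suc_n)
qed

text \<open>The additive extension from monomials exhibits a quotient for every polynomial, which
  makes the description operator in the definition meaningful.\<close>

lemma divided_difference_eq_frag_extend: "divided_difference i p = frag_extend (dd_monomial i) p"
proof (rule divided_difference_unique, induction p rule: zpoly_induct)
  case (monomial e)
  have "frag_extend (dd_monomial i) (monomial e) = dd_monomial i e"
    by (simp add: monomial_def)
  then show ?case by (simp add: dd_monomial_mult)
qed (simp_all add: frag_extend_diff left_diff_distrib swap_vars_diff)

lemma divided_difference_mult: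
  "divided_difference i p * (var i - var (Suc i)) = p - swap_vars i p"
proof (induction p rule: zpoly_induct)
  case (monomial e)
  have "frag_extend (dd_monomial i) (monomial e) = dd_monomial i e"
    by (simp add: monomial_def)
  then show ?case by (simp add: dd_monomial_mult divided_difference_eq_frag_extend)
qed (simp_all add: divided_difference_eq_frag_extend frag_extend_diff left_diff_distrib swap_vars_diff)

lemma divided_difference_eq_iff:
  "divided_difference i p = q \<longleftrightarrow> q * (var i - var (Suc i)) = p - swap_vars i p"
  using divided_difference_unique divided_difference_mult by metis

lemma divided_difference_0 [simp]: "divided_difference i 0 = 0"
  by (simp add: divided_difference_eq_iff)

lemma divided_difference_monomial: "divided_difference i (monomial e) = dd_monomial i e"
  by (simp add: divided_difference_eq_iff dd_monomial_mult)

lemma divided_difference_eq_0: "swap_vars i p = p \<Longrightarrow> divided_difference i p = 0"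
  by (simp add: divided_difference_eq_iff)

text \<open>The swap negates both the numerator and the denominator. It follows that a divided
  difference applied twice vanishes.\<close>

lemma swap_vars_divided_difference: "swap_vars i (divided_difference i p) = divided_difference i p"
proof -
  let ?q = "divided_difference i p" and ?x = "var i - var (Suc i)"
  have "swap_vars i (?q * ?x) = swap_vars i (p - swap_vars i p)" by (simp add: divided_difference_mult)
  then have "swap_vars i ?q * (- ?x) = - (?q * ?x)"
    unfolding swap_vars_mult by (simp add: swap_vars_diff divided_difference_mult)
  then have "swap_vars i ?q * ?x = ?q * ?x" by (simp add: algebra_simps)
  then show ?thesis by (simp del: mult_eq_0_iff)
qed

lemma divided_difference_twice [simp]: "divided_difference i (divided_difference i p) = 0"
  by (simp add: divided_difference_eq_0 swap_vars_divided_difference)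

text \<open>Each denominator is fixed by the other swap, so both orders have the same denominator,
  and their numerators agree because the swaps commute.\<close>

lemma divided_difference_commute:
  assumes "Suc i < j"
  shows "divided_difference i (divided_difference j p) = divided_difference j (divided_difference i p)"
proof -
  have key: "divided_difference i (divided_difference j p) * (var i - var (Suc i)) * (var j - var (Suc j))
      = p - swap_vars i p - (swap_vars j p - swap_vars i (swap_vars j p))"
    if sy: "swap_vars i (var j - var (Suc j)) = (var j - var (Suc j))" for i j
  proof -
    have "divided_difference i (divided_difference j p) * (var i - var (Suc i)) * (var j - var (Suc j))
      = divided_difference j p * (var j - var (Suc j))
        - swap_vars i (divided_difference j p) * swap_vars i (var j - var (Suc j))"
      unfolding divided_difference_mult[of i] sy by (simp only: left_diff_distrib)
    also have "\<dots> = (p - swap_vars j p) - swap_vars i (p - swap_vars j p)"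
      unfolding swap_vars_mult[symmetric] divided_difference_mult ..
    finally show ?thesis by (simp add: swap_vars_diff algebra_simps)
  qed
  let ?x = "var i - var (Suc i)" and ?y = "var j - var (Suc j)"
  have sy: "swap_vars i ?y = ?y" and sx: "swap_vars j ?x = ?x"
    using assms by (simp_all add: swap_vars_diff swap_vars_var_other)
  have "divided_difference i (divided_difference j p) * ?x * ?y
      = divided_difference j (divided_difference i p) * ?y * ?x"
    unfolding key[OF sy] key[OF sx] swap_vars_commute[OF assms, of p] by simp
  then have "divided_difference i (divided_difference j p) * (?x * ?y)
      = divided_difference j (divided_difference i p) * (?x * ?y)"
    by (simp only: mult.assoc mult.commute[of ?y ?x])
  moreover have "?x * ?y \<noteq> 0" by simp
  ultimately show ?thesis by (metis mult_right_cancel)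
qed

text \<open>
  Up to the Vandermonde factor, a threefold divided difference is the alternating sum over the six
  permutations of the variables, which is symmetric in the two reflections \<open>s\<close> and \<open>t\<close>.
\<close>

lemma threefold_difference:
  fixes s t D D' :: "'a::idom \<Rightarrow> 'a"
  assumes hom: "\<And>p q. s (p * q) = s p * s q" "\<And>p q. t (p * q) = t p * t q"
      "\<And>p q. s (p - q) = s p - s q" "\<And>p q. t (p - q) = t p - t q"
    and invol: "\<And>p. s (s p) = p"
    and D: "\<And>p. D p * x = p - s p" "\<And>p. D' p * y = p - t p"
    and refl: "s x = - x" "s y = x + y" "s (x + y) = y" "t x = x + y"
    and "x \<noteq> 0"
  shows "D (D' (D p)) * (x * y * (x + y)) = p - s p - t p + t (s p) + s (t p) - s (t (s p))"
proof -
  define P Q R where "P = D p" and "Q = D' P" and "R = D Q"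
  have P: "P * x = p - s p" and Q: "Q * y = P - t P" and R: "R * x = Q - s Q"
    unfolding P_def Q_def R_def by (rule D)+
  have tP: "t P * (x + y) = t p - t (s p)"
    using arg_cong[OF P, of t] by (simp add: hom refl)
  have Q': "Q * y * x * (x + y) = (p - s p) * (x + y) - (t p - t (s p)) * x"
    unfolding Q left_diff_distrib P[symmetric] tP[symmetric] by (simp add: algebra_simps)
  have sQ': "s Q * (x + y) * (- x) * y = (s p - p) * y - (s (t p) - s (t (s p))) * (- x)"
    using arg_cong[OF Q', of s] by (simp add: hom refl invol)
  have "(R * (x * y * (x + y))) * x = R * x * y * x * (x + y)" by (simp add: algebra_simps)
  also have "\<dots> = Q * y * x * (x + y) + s Q * (x + y) * (- x) * y"
    unfolding R by (simp add: algebra_simps)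
  also have "\<dots> = (p - s p - t p + t (s p) + s (t p) - s (t (s p))) * x"
    unfolding Q' sQ' by (simp add: algebra_simps)
  finally show ?thesis using \<open>x \<noteq> 0\<close> by (simp add: R_def Q_def P_def)
qed

text \<open>Both sides have the same multiple by the Vandermonde factor: their numerators differ
  only in the last term, where the braid relation of the swaps applies.\<close>

lemma divided_difference_braid:
  "divided_difference i (divided_difference (Suc i) (divided_difference i p))
   = divided_difference (Suc i) (divided_difference i (divided_difference (Suc i) p))"
proof -
  let ?j = "Suc i"
  let ?x = "var i - var ?j" and ?y = "var ?j - var (Suc ?j)"
  have "divided_difference i (divided_difference ?j (divided_difference i p)) * (?x * ?y * (?x + ?y))
      = p - swap_vars i p - swap_vars ?j p + swap_vars ?j (swap_vars i p) + swap_vars i (swap_vars ?j p)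
        - swap_vars i (swap_vars ?j (swap_vars i p))"
    by (rule threefold_difference)
       (simp_all add: swap_vars_mult swap_vars_diff divided_difference_mult swap_vars_var_other)
  moreover have "divided_difference ?j (divided_difference i (divided_difference ?j p)) * (?y * ?x * (?y + ?x))
      = p - swap_vars ?j p - swap_vars i p + swap_vars i (swap_vars ?j p) + swap_vars ?j (swap_vars i p)
        - swap_vars ?j (swap_vars i (swap_vars ?j p))"
    by (rule threefold_difference)
       (simp_all add: swap_vars_mult swap_vars_diff divided_difference_mult swap_vars_var_other)
  ultimately have "divided_difference i (divided_difference ?j (divided_difference i p)) * (?x * ?y * (?x + ?y))
      = divided_difference ?j (divided_difference i (divided_difference ?j p)) * (?x * ?y * (?x + ?y))"
    using swap_vars_braid[of i p] by (simp only: mult.commute[of ?y ?x] add.commute[of ?y ?x] diff_diff_add) (simp add: algebra_simps)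
  moreover have "?x * ?y * (?x + ?y) \<noteq> 0" by simp
  ultimately show ?thesis by (metis mult_right_cancel)
qed

section \<open>Schubert polynomials\<close>

definition up_step :: "nat \<Rightarrow> code \<Rightarrow> code" where
  "up_step i v = set_pair i (lookup v (Suc i) + 1) (lookup v i) v"

lemma code_step_eq: "code_step i v = set_pair i (lookup v (Suc i)) (lookup v i - 1) v"
  by (simp add: code_step_def set_pair_def)

lemma lookup_up_step:
  "lookup (up_step i v) k = (if k = i then lookup v (Suc i) + 1 else if k = Suc i then lookup v i else lookup v k)"
  by (simp add: up_step_def lookup_set_pair)

lemma lookup_code_step:
  "lookup (code_step i v) k = (if k = i then lookup v (Suc i) else if k = Suc i then lookup v i - 1 else lookup v k)"
  by (simp add: code_step_eq lookup_set_pair)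

lemma code_step_up_step [simp]: "code_step i (up_step i v) = v"
  by (intro poly_mapping_eqI) (simp add: lookup_up_step lookup_code_step)

lemma up_step_code_step: "lookup v (Suc i) < lookup v i \<Longrightarrow> up_step i (code_step i v) = v"
  by (intro poly_mapping_eqI) (simp add: lookup_up_step lookup_code_step)

lemma keys_subset_iff: "keys (v :: code) \<subseteq> {..<M} \<longleftrightarrow> (\<forall>k\<ge>M. lookup v k = 0)"
proof
  assume M: "keys v \<subseteq> {..<M}"
  have "k \<notin> keys v" if "M \<le> k" for k using M that by auto
  then show "\<forall>k\<ge>M. lookup v k = 0" by (simp add: in_keys_iff)
next
  show "\<forall>k\<ge>M. lookup v k = 0 \<Longrightarrow> keys v \<subseteq> {..<M}" by (auto simp: in_keys_iff intro: leI)
qed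

lemma ex_keys_bound: "\<exists>M. keys (v :: code) \<subseteq> {..<M}"
  by (intro exI[of _ "Suc (Max (insert 0 (keys v)))"]) (auto simp: less_Suc_eq_le intro: Max_ge)

text \<open>A fixed window \<open>M\<close> makes raising terminate. Only strictly decreasing codes
  end a path, not all dominant ones, so the code itself decides whether to stop or to go on.\<close>

inductive schubert_path :: "nat \<Rightarrow> code \<Rightarrow> zpoly \<Rightarrow> bool" for M :: nat where
  base: "keys v \<subseteq> {..<M} \<Longrightarrow> (\<And>i. Suc i < M \<Longrightarrow> lookup v (Suc i) < lookup v i) \<Longrightarrow>
    schubert_path M v (monomial v)"
| up: "lookup v i \<le> lookup v (Suc i) \<Longrightarrow> Suc i < M \<Longrightarrow> schubert_path M (up_step i v) p \<Longrightarrow>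
    schubert_path M v (divided_difference i p)"

definition weight_sum :: "nat \<Rightarrow> code \<Rightarrow> nat" where
  "weight_sum M v = (\<Sum>i<M. lookup v i)"

lemma sum_split_pair:
  fixes g :: "nat \<Rightarrow> 'a::comm_monoid_add"
  assumes "Suc i < M"
  shows "(\<Sum>k<M. g k) = g i + (g (Suc i) + (\<Sum>k\<in>{..<M} - {i, Suc i}. g k))"
proof -
  have "(\<Sum>k<M. g k) = g i + (\<Sum>k\<in>{..<M} - {i}. g k)"
    using assms by (intro sum.remove) auto
  also have "(\<Sum>k\<in>{..<M} - {i}. g k) = g (Suc i) + (\<Sum>k\<in>{..<M} - {i} - {Suc i}. g k)"
    using assms by (intro sum.remove) auto
  also have "{..<M} - {i} - {Suc i} = {..<M} - {i, Suc i}" by auto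
  finally show ?thesis .
qed

lemma weight_sum_up_step: "Suc i < M \<Longrightarrow> weight_sum M (up_step i v) = Suc (weight_sum M v)"
  unfolding weight_sum_def
  by (subst (1 2) sum_split_pair[of i M]) (simp_all add: lookup_up_step)

text \<open>The bound \<open>v\<^sub>i + i \<le> K\<close> is invariant under up-steps, so that these terminate.\<close>

definition code_bounded :: "nat \<Rightarrow> nat \<Rightarrow> code \<Rightarrow> bool" where
  "code_bounded M K v \<longleftrightarrow> keys v \<subseteq> {..<M} \<and> (\<forall>i<M. lookup v i + i \<le> K)"

lemma code_bounded_up_step:
  assumes "code_bounded M K v" "lookup v i \<le> lookup v (Suc i)" "Suc i < M"
  shows "code_bounded M K (up_step i v)"
proof -
  have "lookup v (Suc i) + Suc i \<le> K" using assms by (auto simp: code_bounded_def)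
  then show ?thesis
    using assms unfolding code_bounded_def keys_subset_iff by (auto simp: lookup_up_step)
qed

lemma weight_sum_le: "code_bounded M K v \<Longrightarrow> weight_sum M v \<le> M * K"
  unfolding weight_sum_def code_bounded_def
  using sum_bounded_above[of "{..<M}" "lookup v" K] add_leD1 by fastforce

lemma ex_code_bounded: "keys v \<subseteq> {..<M} \<Longrightarrow> \<exists>K. code_bounded M K v"
  unfolding code_bounded_def
  by (intro exI[of _ "\<Sum>i<M. lookup v i + i"])
     (use member_le_sum[of _ "{..<M}" "\<lambda>i. lookup v i + i"] in auto)

lemma up_step_commute: "Suc i < j \<Longrightarrow> up_step i (up_step j v) = up_step j (up_step i v)"
  by (intro poly_mapping_eqI) (auto simp: lookup_up_step)

lemma up_step_braid:
  "up_step i (up_step (Suc i) (up_step i v)) = up_step (Suc i) (up_step i (up_step (Suc i) v))"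
  by (intro poly_mapping_eqI) (auto simp: lookup_up_step)

text \<open>An argument in the style of Newman's lemma. The slack
  \<open>M * K - weight_sum M v\<close> shrinks with every raise, and two raises at
  \<open>i < j\<close> can be joined: at distance more than one by performing the other raise, at
  distance one by three raises on either side. The relations of the divided differences make the two
  results equal.\<close>

lemma ex1_schubert_path:
  "code_bounded M K v \<Longrightarrow> \<exists>!p. schubert_path M v p"
proof (induction "M * K - weight_sum M v" arbitrary: v rule: less_induct)
  case less
  note cb = less.prems
  have step: "code_bounded M K (up_step i v')"
    "M * K - weight_sum M (up_step i v') < M * K - weight_sum M v'"
    if "code_bounded M K v'" "lookup v' i \<le> lookup v' (Suc i)" "Suc i < M" for v' i
    using code_bounded_up_step[OF that] weight_sum_up_step[OF that(3), of v']
      weight_sum_le[OF code_bounded_up_step[OF that]] by auto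
  have IH: "\<exists>!p. schubert_path M (up_step i v) p" if "lookup v i \<le> lookup v (Suc i)" "Suc i < M" for i
    using less.hyps step cb that by blast
  show ?case
  proof (cases "\<exists>i. Suc i < M \<and> lookup v i \<le> lookup v (Suc i)")
    case False
    then have dec: "lookup v (Suc i) < lookup v i" if "Suc i < M" for i
      using that by (meson not_le)
    have "schubert_path M v (monomial v)"
      using cb dec by (intro base) (auto simp: code_bounded_def)
    moreover have "p = monomial v" if "schubert_path M v p" for p
      using that by cases (use dec in \<open>auto simp: not_le[symmetric]\<close>)
    ultimately show ?thesis by blast
  next
    case True
    have confl: "divided_difference i p = divided_difference j q"
      if i: "lookup v i \<le> lookup v (Suc i)" "Suc i < M" and j: "lookup v j \<le> lookup v (Suc j)" "Suc j < M"
        and p: "schubert_path M (up_step i v) p" and q: "schubert_path M (up_step j v) q" and ij: "i < j"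
      for i j p q
    proof (cases "Suc i = j")
      case False
      then have far: "Suc i < j" using ij by simp
      have ci: "code_bounded M K (up_step i v)" "code_bounded M K (up_step j v)" using step cb i j by blast+
      have aj: "lookup (up_step i v) j \<le> lookup (up_step i v) (Suc j)"
        and ai: "lookup (up_step j v) i \<le> lookup (up_step j v) (Suc i)"
        using far i j by (simp_all add: lookup_up_step)
      obtain r where r: "schubert_path M (up_step j (up_step i v)) r"
        using less.hyps[of "up_step j (up_step i v)"] step[OF ci(1) aj j(2)] step[OF cb i] by auto
      have "schubert_path M (up_step i v) (divided_difference j r)" by (rule up[OF aj j(2) r])
      then have 1: "p = divided_difference j r" using IH[OF i] p by blast
      have "schubert_path M (up_step j v) (divided_difference i r)"
        using up[OF ai i(2)] r up_step_commute[OF far] by metis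
      then have 2: "q = divided_difference i r" using IH[OF j] q by blast
      show ?thesis unfolding 1 2 by (rule divided_difference_commute[OF far])
    next
      case True
      define v1 where "v1 = up_step i v"
      define v2 where "v2 = up_step (Suc i) v1"
      define w1 where "w1 = up_step (Suc i) v"
      define w2 where "w2 = up_step i w1"
      have eq: "up_step (Suc i) w2 = up_step i v2"
        by (simp add: w2_def w1_def v2_def v1_def up_step_braid)
      note j = j[folded True]
      \<comment> \<open>The chain
        \<open>lookup v i \<le> lookup v (i+1) \<le> lookup v (i+2)\<close> keeps every raise on
        both routes legal.\<close>
      have a1: "lookup v1 (Suc i) \<le> lookup v1 (Suc (Suc i))" and a2: "lookup v2 i \<le> lookup v2 (Suc i)"
        and b1: "lookup w1 i \<le> lookup w1 (Suc i)" and b2: "lookup w2 (Suc i) \<le> lookup w2 (Suc (Suc i))"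
        using i j by (simp_all add: v1_def v2_def w1_def w2_def lookup_up_step)
      have c1: "code_bounded M K v1" "code_bounded M K w1" using step cb i j by (simp_all add: v1_def w1_def)
      then have c2: "code_bounded M K v2" "code_bounded M K w2" using step a1 b1 i j by (simp_all add: v2_def w2_def)
      have "M * K - weight_sum M (up_step i v2) < M * K - weight_sum M v"
        using step(2)[OF cb i] step(2)[OF c1(1) a1 j(2)] step(2)[OF c2(1) a2 i(2)]
        by (simp add: v1_def v2_def)
      then obtain r where r: "schubert_path M (up_step i v2) r"
        using less.hyps step(1)[OF c2(1) a2 i(2)] by blast
      have "schubert_path M v1 (divided_difference (Suc i) (divided_difference i r))"
        using up[OF a1 j(2)] up[OF a2 i(2) r] by (simp add: v2_def)
      then have 1: "p = divided_difference (Suc i) (divided_difference i r)"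
        using IH[OF i] p by (auto simp: v1_def)
      have "schubert_path M w1 (divided_difference i (divided_difference (Suc i) r))"
        using up[OF b1 i(2)] up[OF b2 j(2)] r by (simp add: w2_def eq[unfolded w2_def])
      then have 2: "q = divided_difference i (divided_difference (Suc i) r)"
        using IH[OF j] q by (auto simp: w1_def True)
      show ?thesis unfolding 1 2 True[symmetric] by (rule divided_difference_braid)
    qed
    obtain i where i: "Suc i < M" "lookup v i \<le> lookup v (Suc i)" using True by blast
    obtain p where p: "schubert_path M (up_step i v) p" using IH[OF i(2,1)] by blast
    have "schubert_path M v (divided_difference i p)" by (rule up[OF i(2,1) p])
    moreover have "p' = divided_difference i p" if "schubert_path M v p'" for p'
      using that
    proof cases
      case base
      then show ?thesis using i by (meson not_le)
    next
      case (up j q)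
      show ?thesis
      proof (cases i j rule: linorder_cases)
        case less
        then show ?thesis using confl[OF i(2,1) up(2,3) p up(4)] up(1) by simp
      next
        case equal
        then show ?thesis using up p IH[OF i(2,1)] by blast
      next
        case greater
        then show ?thesis using confl[OF up(2,3) i(2,1) up(4) p] up(1) by simp
      qed
    qed
    ultimately show ?thesis by blast
  qed
qed

lemma schubert_path_unique:
  "schubert_path M v p \<Longrightarrow> schubert_path M v q \<Longrightarrow> keys v \<subseteq> {..<M} \<Longrightarrow> p = q"
  using ex1_schubert_path ex_code_bounded by blast

lemma dominant_iff: "dominant v \<longleftrightarrow> (\<forall>k. lookup v (Suc k) \<le> lookup v k)"
  by (simp add: dominant_def antimono_iff_le_Suc)

text \<open>Reduces the base case of the definition to strictly decreasing codes. At the first place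
  where strictness fails, two entries equal some \<open>a\<close>. The preceding entry is larger, so
  the raised code is still dominant, and the divided difference takes its factor
  \<open>x_i^(a+1) x_(i+1)^a\<close> back to \<open>x_i^a x_(i+1)^a\<close>.\<close>

lemma schubert_path_dominant:
  "code_bounded M K v \<Longrightarrow> dominant v \<Longrightarrow> schubert_path M v (monomial v)"
proof (induction "M * K - weight_sum M v" arbitrary: v rule: less_induct)
  case less
  note cb = less.prems(1) and dom = less.prems(2)[unfolded dominant_iff, rule_format]
  show ?case
  proof (cases "\<exists>i. Suc i < M \<and> lookup v i \<le> lookup v (Suc i)")
    case False
    then show ?thesis
      using cb by (intro base) (auto simp: code_bounded_def not_le)
  next
    case True
    define i where "i = (LEAST i. Suc i < M \<and> lookup v i \<le> lookup v (Suc i))"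
    have i: "Suc i < M" "lookup v i \<le> lookup v (Suc i)"
      using LeastI_ex[OF True] by (simp_all add: i_def)
    have eq: "lookup v (Suc i) = lookup v i" using i(2) dom[of i] by simp
    have below: "lookup v (Suc k) < lookup v k" if "Suc k = i" for k
    proof (rule ccontr)
      assume "\<not> ?thesis"
      then have "i \<le> k" unfolding i_def using that i by (intro Least_le) auto
      then show False using that by simp
    qed
    have dom': "dominant (up_step i v)"
      unfolding dominant_iff
      using dom below eq dom[of "Suc i"] by (auto simp: lookup_up_step Suc_le_eq)
    have cb': "code_bounded M K (up_step i v)" by (rule code_bounded_up_step[OF cb i(2,1)])
    have "schubert_path M (up_step i v) (monomial (up_step i v))"
      using weight_sum_le[OF cb'] weight_sum_up_step[OF i(1), of v] cb' dom'
      by (intro less.hyps) auto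
    then have *: "schubert_path M v (divided_difference i (monomial (up_step i v)))"
      by (rule up[OF i(2,1)])
    have "set_pair i (lookup v i) (lookup v i) (up_step i v) = v"
      by (intro poly_mapping_eqI) (auto simp: lookup_up_step lookup_set_pair eq)
    then have "divided_difference i (monomial (up_step i v)) = monomial v"
      by (simp add: divided_difference_monomial dd_monomial_def lookup_up_step eq)
    with * show ?thesis by simp
  qed
qed

text \<open>A derivation touches finitely many positions, so it gives a path in every large window.
  Two derivations of one code then share a window, in which paths are unique.\<close>

lemma schubert_path_large:
  "is_schubert v p \<Longrightarrow> \<exists>M0. keys v \<subseteq> {..<M0} \<and> (\<forall>M\<ge>M0. schubert_path M v p)"
proof (induction rule: is_schubert.induct)
  case (dominant v)
  obtain M0 where M0: "keys v \<subseteq> {..<M0}"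
    using ex_keys_bound by blast
  have "schubert_path M v (monomial v)" if "M \<ge> M0" for M
  proof -
    have "keys v \<subseteq> {..<M}" using M0 that by auto
    then show ?thesis using ex_code_bounded schubert_path_dominant dominant by blast
  qed
  then show ?case using M0 by blast
next
  case (step v p i)
  then obtain M0 where M0: "keys v \<subseteq> {..<M0}" "\<forall>M\<ge>M0. schubert_path M v p" by blast
  have "schubert_path M (code_step i v) (divided_difference i p)" if "M \<ge> max M0 (i + 2)" for M
    using M0(2) that step.hyps by (intro up) (auto simp: lookup_code_step up_step_code_step)
  moreover have "keys (code_step i v) \<subseteq> {..<max M0 (i + 2)}"
    using M0(1) unfolding keys_subset_iff by (auto simp: lookup_code_step)
  ultimately show ?case by blast
qed

lemma is_schubert_unique: "is_schubert v p \<Longrightarrow> is_schubert v q \<Longrightarrow> p = q"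
  using schubert_path_large[of v p] schubert_path_large[of v q] schubert_path_unique
  by (metis nat_le_linear)

lemma is_schubert_path: "schubert_path M v p \<Longrightarrow> is_schubert v p"
proof (induction rule: schubert_path.induct)
  case (base v)
  have "lookup v (Suc k) \<le> lookup v k" for k
    using base(1) base(2)[of k] unfolding keys_subset_iff by (cases "Suc k < M") (auto simp: not_less)
  then show ?case by (intro is_schubert.dominant) (simp add: dominant_iff)
next
  case (up v i p)
  have "is_schubert (code_step i (up_step i v)) (divided_difference i p)"
    by (rule is_schubert.step[OF up.IH]) (use up.hyps in \<open>simp add: lookup_up_step\<close>)
  then show ?case by simp
qed

lemma schubert_eqI: "is_schubert v p \<Longrightarrow> schubert v = p"
  unfolding schubert_def using is_schubert_unique by blast

lemma schubert_path_schubert: "keys v \<subseteq> {..<M} \<Longrightarrow> schubert_path M v (schubert v)"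
  using ex1_schubert_path ex_code_bounded is_schubert_path schubert_eqI by metis

lemma is_schubert_schubert: "is_schubert v (schubert v)"
proof -
  obtain M0 where M0: "keys v \<subseteq> {..<M0}"
    using ex_keys_bound by blast
  then show ?thesis using schubert_path_schubert is_schubert_path by blast
qed

lemma schubert_dominant: "dominant v \<Longrightarrow> schubert v = monomial v"
  by (intro schubert_eqI is_schubert.dominant)

lemma schubert_0 [simp]: "schubert 0 = 1"
  using schubert_dominant[of 0] by (simp add: dominant_iff)

lemma divided_difference_schubert_descent:
  "lookup v (Suc i) < lookup v i \<Longrightarrow> divided_difference i (schubert v) = schubert (code_step i v)"
  by (intro schubert_eqI[symmetric] is_schubert.step is_schubert_schubert)

text \<open>At an ascent the polynomial is itself a divided difference, that of the raised code, and
  the same operator applied twice is zero.\<close>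

lemma divided_difference_schubert_ascent:
  assumes "lookup v i \<le> lookup v (Suc i)"
  shows "divided_difference i (schubert v) = 0"
proof -
  have "schubert v = divided_difference i (schubert (up_step i v))"
    using divided_difference_schubert_descent[of "up_step i v" i] assms by (simp add: lookup_up_step)
  then show ?thesis by simp
qed

lemma keys_divided_difference:
  assumes "e' \<in> keys (divided_difference i p)"
  obtains e where "e \<in> keys p" "\<And>k. k \<noteq> i \<Longrightarrow> k \<noteq> Suc i \<Longrightarrow> lookup e' k = lookup e k"
    "Suc (lookup e' i + lookup e' (Suc i)) = lookup e i + lookup e (Suc i)"
proof -
  obtain e where e: "e \<in> keys p" "e' \<in> keys (dd_monomial i e)"
    using assms keys_frag_extend[of "dd_monomial i" p] unfolding divided_difference_eq_frag_extend by blast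
  have "\<exists>x y. e' = set_pair i x y e \<and> Suc (x + y) = lookup e i + lookup e (Suc i)"
  proof (cases "lookup e (Suc i) \<le> lookup e i")
    case True
    then obtain t where "t < lookup e i - lookup e (Suc i)"
      "e' = set_pair i (lookup e i - 1 - t) (lookup e (Suc i) + t) e"
      using e(2) keys_sum[of "\<lambda>t. monomial (set_pair i (lookup e i - 1 - t) (lookup e (Suc i) + t) e)" "{..<lookup e i - lookup e (Suc i)}"]
      by (auto simp: dd_monomial_def Let_def monomial_def)
    then show ?thesis by (intro exI conjI) auto
  next
    case False
    then obtain t where "t < lookup e (Suc i) - lookup e i"
      "e' = set_pair i (lookup e (Suc i) - 1 - t) (lookup e i + t) e"
      using e(2) keys_sum[of "\<lambda>t. monomial (set_pair i (lookup e (Suc i) - 1 - t) (lookup e i + t) e)" "{..<lookup e (Suc i) - lookup e i}"]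
      by (auto simp: dd_monomial_def Let_def monomial_def)
    then show ?thesis by (intro exI conjI) auto
  qed
  then show ?thesis using that[OF e(1)] by (auto simp: lookup_set_pair)
qed

section \<open>Homogeneity and size of the coefficients\<close>

definition homogeneous :: "nat \<Rightarrow> nat \<Rightarrow> zpoly \<Rightarrow> bool" where
  "homogeneous M D p \<longleftrightarrow> (\<forall>e\<in>keys p. keys e \<subseteq> {..<M} \<and> weight_sum M e = D)"

lemma homogeneous_divided_difference:
  assumes "homogeneous M (Suc D) p" "Suc i < M"
  shows "homogeneous M D (divided_difference i p)"
  unfolding homogeneous_def
proof
  fix e' assume "e' \<in> keys (divided_difference i p)"
  then obtain e where e: "e \<in> keys p" "\<And>k. k \<noteq> i \<Longrightarrow> k \<noteq> Suc i \<Longrightarrow> lookup e' k = lookup e k"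
    "Suc (lookup e' i + lookup e' (Suc i)) = lookup e i + lookup e (Suc i)"
    by (rule keys_divided_difference) blast
  have h: "keys e \<subseteq> {..<M}" "weight_sum M e = Suc D" using assms(1) e(1) by (auto simp: homogeneous_def)
  have "(\<Sum>k\<in>{..<M} - {i, Suc i}. lookup e' k) = (\<Sum>k\<in>{..<M} - {i, Suc i}. lookup e k)"
    by (intro sum.cong) (auto simp: e(2))
  then have "Suc (weight_sum M e') = weight_sum M e"
    unfolding weight_sum_def sum_split_pair[OF assms(2)] using e(3) by simp
  moreover have "keys e' \<subseteq> {..<M}"
    unfolding keys_subset_iff
  proof (intro allI impI)
    fix k assume "M \<le> k"
    then have "k \<noteq> i" "k \<noteq> Suc i" using assms(2) by auto
    then show "lookup e' k = 0" using h(1) \<open>M \<le> k\<close> e(2) by (simp add: keys_subset_iff)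
  qed
  ultimately show "keys e' \<subseteq> {..<M} \<and> weight_sum M e' = D" using h by simp
qed

lemma homogeneous_schubert_path: "schubert_path M v p \<Longrightarrow> homogeneous M (weight_sum M v) p"
proof (induction rule: schubert_path.induct)
  case (base v)
  then show ?case by (simp add: homogeneous_def monomial_def)
next
  case (up v i p)
  then show ?case by (intro homogeneous_divided_difference) (simp_all add: weight_sum_up_step)
qed

lemma homogeneous_schubert: "keys v \<subseteq> {..<M} \<Longrightarrow> homogeneous M (weight_sum M v) (schubert v)"
  by (intro homogeneous_schubert_path schubert_path_schubert)

text \<open>Together with the degree, this norm bounds the values at sample points, and with them
  the bit lengths in the program.\<close>

definition norm1 :: "zpoly \<Rightarrow> int" where
  "norm1 p = (\<Sum>e\<in>keys p. \<bar>lookup p e\<bar>)"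

lemma norm1_superset: "finite A \<Longrightarrow> keys p \<subseteq> A \<Longrightarrow> norm1 p = (\<Sum>e\<in>A. \<bar>lookup p e\<bar>)"
  unfolding norm1_def by (intro sum.mono_neutral_left) (auto simp: in_keys_iff)

lemma norm1_0 [simp]: "norm1 0 = 0"
  by (simp add: norm1_def)

lemma norm1_nonneg: "0 \<le> norm1 p"
  by (simp add: norm1_def sum_nonneg)

lemma norm1_monomial [simp]: "norm1 (monomial e) = 1"
  by (simp add: norm1_def monomial_def)

lemma norm1_uminus [simp]: "norm1 (- p) = norm1 p"
  by (simp add: norm1_def)

lemma norm1_add: "norm1 (p + q) \<le> norm1 p + norm1 q"
proof -
  let ?A = "keys p \<union> keys q"
  have k: "keys (p + q) \<subseteq> ?A" by (rule keys_add)
  have "norm1 (p + q) = (\<Sum>e\<in>?A. \<bar>lookup p e + lookup q e\<bar>)"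
    using norm1_superset[OF _ k] by (simp add: lookup_add)
  also have "\<dots> \<le> (\<Sum>e\<in>?A. \<bar>lookup p e\<bar> + \<bar>lookup q e\<bar>)" by (intro sum_mono) simp
  also have "\<dots> = norm1 p + norm1 q"
    by (simp add: sum.distrib norm1_superset[of ?A p] norm1_superset[of ?A q])
  finally show ?thesis .
qed

lemma norm1_sum: "norm1 (\<Sum>i\<in>I. g i) \<le> (\<Sum>i\<in>I. norm1 (g i))"
proof (induction I rule: infinite_finite_induct)
  case (insert x F)
  then show ?case using norm1_add[of "g x" "sum g F"] by simp
qed auto

lemma norm1_frag_cmul: "norm1 (frag_cmul c p) = \<bar>c\<bar> * norm1 p"
proof -
  have "norm1 (frag_cmul c p) = (\<Sum>e\<in>keys p. \<bar>c * lookup p e\<bar>)"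
    using norm1_superset[OF finite_keys keys_cmul] by simp
  then show ?thesis by (simp add: norm1_def sum_distrib_left abs_mult)
qed

lemma norm1_dd_monomial: "norm1 (dd_monomial i e) \<le> int (lookup e i + lookup e (Suc i))"
proof -
  have "norm1 (\<Sum>t<k. monomial (g t)) \<le> int N" if "k \<le> N" for k N and g :: "nat \<Rightarrow> expo"
    using norm1_sum[of "\<lambda>t. monomial (g t)" "{..<k}"] that by simp
  then have "norm1 (\<Sum>t<a - b. monomial (g t)) \<le> int (lookup e i + lookup e (Suc i))"
    if "a \<in> {lookup e i, lookup e (Suc i)}" for a b and g :: "nat \<Rightarrow> expo"
    using that by (metis diff_le_self insertE le_add1 le_add2 order_trans singletonD)
  then show ?thesis
    unfolding dd_monomial_def Let_def by simp
qed

lemma norm1_divided_difference: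
  assumes "homogeneous M D p" "Suc i < M"
  shows "norm1 (divided_difference i p) \<le> int D * norm1 p"
proof -
  have "norm1 (divided_difference i p) \<le> (\<Sum>e\<in>keys p. \<bar>lookup p e\<bar> * norm1 (dd_monomial i e))"
    unfolding divided_difference_eq_frag_extend frag_extend_def norm1_frag_cmul[symmetric] by (rule norm1_sum)
  also have "\<dots> \<le> (\<Sum>e\<in>keys p. \<bar>lookup p e\<bar> * int D)"
  proof (intro sum_mono mult_left_mono)
    fix e assume "e \<in> keys p"
    then have "weight_sum M e = D" using assms(1) by (auto simp: homogeneous_def)
    then have "lookup e i + lookup e (Suc i) \<le> D"
      using sum_split_pair[OF assms(2), of "lookup e"] by (simp add: weight_sum_def)
    then show "norm1 (dd_monomial i e) \<le> int D" using norm1_dd_monomial[of i e] by linarith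
  qed simp
  also have "\<dots> = int D * norm1 p" by (simp add: norm1_def sum_distrib_left mult.commute)
  finally show ?thesis .
qed

text \<open>Each divided difference costs at most a factor equal to the degree, which never exceeds
  \<open>M * K\<close>. The exponent bounds the number of raises still possible.\<close>

lemma norm1_schubert_path:
  "schubert_path M v p \<Longrightarrow> code_bounded M K v \<Longrightarrow> norm1 p \<le> int (M * K) ^ (M * K - weight_sum M v)"
proof (induction rule: schubert_path.induct)
  case (base v)
  have "(1::int) \<le> int (M * K) ^ (M * K - weight_sum M v)"
  \<comment> \<open>For \<open>M * K = 0\<close> the exponent vanishes too, and
    \<open>0 ^ 0 = 1\<close>.\<close>
  proof (cases "M * K = 0")
    case False
    then have "1 \<le> int (M * K)" by linarith
    then show ?thesis by (rule one_le_power)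
  qed auto
  then show ?case by simp
next
  case (up v i p)
  have cb: "code_bounded M K (up_step i v)" using up by (intro code_bounded_up_step)
  have ws: "weight_sum M (up_step i v) = Suc (weight_sum M v)" using up by (simp add: weight_sum_up_step)
  have le: "weight_sum M (up_step i v) \<le> M * K" by (rule weight_sum_le[OF cb])
  have "norm1 (divided_difference i p) \<le> int (weight_sum M (up_step i v)) * norm1 p"
    by (rule norm1_divided_difference[OF homogeneous_schubert_path[OF up.hyps(3)] up.hyps(2)])
  also have "\<dots> \<le> int (M * K) * int (M * K) ^ (M * K - weight_sum M (up_step i v))"
    using le up.IH[OF cb] by (intro mult_mono) (auto simp: norm1_nonneg simp del: of_nat_mult)
  also have "\<dots> = int (M * K) ^ (M * K - weight_sum M v)"
    using ws le by (metis Suc_diff_Suc Suc_le_lessD power_Suc)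
  finally show ?case .
qed

lemma norm1_schubert:
  "code_bounded M K v \<Longrightarrow> norm1 (schubert v) \<le> int (M * K) ^ (M * K - weight_sum M v)"
  by (intro norm1_schubert_path schubert_path_schubert) (auto simp: code_bounded_def)

section \<open>Leading monomials\<close>

lemma divided_difference_diff:
  "divided_difference i (p - q) = divided_difference i p - divided_difference i q"
  by (simp add: divided_difference_eq_frag_extend frag_extend_diff)

section \<open>Words of divided differences\<close>

abbreviation divided_differences :: "nat list \<Rightarrow> zpoly \<Rightarrow> zpoly" where
  "divided_differences \<equiv> fold divided_difference"

lemma divided_differences_0 [simp]: "divided_differences ws 0 = 0"
  by (induction ws) simp_all

lemma divided_differences_diff:
  "divided_differences ws (p - q) = divided_differences ws p - divided_differences ws q"
  by (induction ws arbitrary: p q) (simp_all add: divided_difference_diff)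

lemma divided_differences_eq_frag_extend:
  "divided_differences ws p = frag_extend (\<lambda>e. divided_differences ws (monomial e)) p"
proof (induction p rule: zpoly_induct)
  case (monomial e)
  then show ?case by (simp add: monomial_def)
qed (simp_all add: divided_differences_diff frag_extend_diff)

lemma divided_differences_sum:
  "finite I \<Longrightarrow> divided_differences ws (\<Sum>t\<in>I. g t) = (\<Sum>t\<in>I. divided_differences ws (g t))"
  unfolding divided_differences_eq_frag_extend[of ws "sum g I"] divided_differences_eq_frag_extend[of ws "g _"]
  by (simp add: frag_extend_sum)

text \<open>
  Reading the blocks from the last index downwards, the operators of this word take the code \<open>u\<close>
  to the zero code, clearing its last nonzero entry first.
\<close>

fun code_word :: "nat \<Rightarrow> code \<Rightarrow> nat list" where
  "code_word 0 u = []"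
| "code_word (Suc k) u = [k..<k + lookup u k] @ code_word k u"

lemma length_code_word: "length (code_word M u) = weight_sum M u"
  by (induction M) (simp_all add: weight_sum_def)

lemma code_word_split:
  "\<exists>ws. code_word (k + j) u = ws @ code_word k u \<and> (\<forall>i\<in>set ws. k \<le> i) \<and>
     length ws = (\<Sum>i\<in>{k..<k + j}. lookup u i)"
proof (induction j)
  case (Suc j)
  then obtain ws where ws: "code_word (k + j) u = ws @ code_word k u" "\<forall>i\<in>set ws. k \<le> i"
     "length ws = (\<Sum>i\<in>{k..<k + j}. lookup u i)" by blast
  then show ?case
    by (intro exI[of _ "[k+j..<k+j+lookup u (k+j)] @ ws"]) auto
qed auto

lemma keys_divided_differences:
  assumes "e' \<in> keys (divided_differences ws p)" "\<And>i. i \<in> set ws \<Longrightarrow> k \<le> i \<and> Suc i < M"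
  shows "\<exists>e\<in>keys p. (\<forall>i<k. lookup e' i = lookup e i) \<and> weight_sum M e' + length ws = weight_sum M e"
  using assms
proof (induction ws arbitrary: p)
  case (Cons j ws)
  then obtain e1 where e1: "e1 \<in> keys (divided_difference j p)" "\<forall>i<k. lookup e' i = lookup e1 i"
    "weight_sum M e' + length ws = weight_sum M e1" by fastforce
  obtain e where e: "e \<in> keys p" "\<And>k. k \<noteq> j \<Longrightarrow> k \<noteq> Suc j \<Longrightarrow> lookup e1 k = lookup e k"
    "Suc (lookup e1 j + lookup e1 (Suc j)) = lookup e j + lookup e (Suc j)"
    by (rule keys_divided_difference[OF e1(1)]) blast
  have j: "k \<le> j" "Suc j < M" using Cons.prems(2)[of j] by auto
  have "(\<Sum>k\<in>{..<M} - {j, Suc j}. lookup e1 k) = (\<Sum>k\<in>{..<M} - {j, Suc j}. lookup e k)"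
    by (intro sum.cong) (auto simp: e(2))
  then have "Suc (weight_sum M e1) = weight_sum M e"
    unfolding weight_sum_def sum_split_pair[OF j(2)] using e(3) by simp
  then show ?case using e1 e j by (intro bexI[of _ e]) auto
qed auto

lemma weight_sum_ge_prefix: "k \<le> M \<Longrightarrow> (\<Sum>i<k. lookup e i) \<le> weight_sum M e"
  unfolding weight_sum_def by (intro sum_mono2) auto

lemma ex_bound_list: "\<exists>M. M0 \<le> M \<and> (\<forall>i\<in>set ws. Suc i < M)" for ws :: "nat list"
  by (intro exI[of _ "M0 + Suc (Suc (Max (insert 0 (set ws))))"])
     (auto simp: less_Suc_eq_le intro!: trans_le_add2)

lemma weight_sum_eq:
  assumes "keys e \<subseteq> {..<M}" "M \<le> M'"
  shows "weight_sum M' e = weight_sum M e"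
  unfolding weight_sum_def using assms
  by (intro sum.mono_neutral_right) (auto simp: keys_subset_iff)

text \<open>The blocks for the entries from \<open>k\<close> on use operators of index at least
  \<open>k\<close>. These leave the exponents before \<open>k\<close> alone and lower the degree by
  one each, so the tail of \<open>e\<close> must pay for all of them.\<close>

lemma code_word_monomial_nonzero:
  assumes nz: "divided_differences (code_word M u) (monomial e) \<noteq> 0" and e: "keys e \<subseteq> {..<M}" and "k \<le> M"
  shows "(\<Sum>i\<in>{k..<M}. lookup u i) \<le> (\<Sum>i\<in>{k..<M}. lookup e i)"
proof -
  obtain ws where ws: "code_word M u = ws @ code_word k u" "\<forall>i\<in>set ws. k \<le> i"
     "length ws = (\<Sum>i\<in>{k..<M}. lookup u i)"
    using code_word_split[of k "M - k" u] \<open>k \<le> M\<close> by auto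
  \<comment> \<open>Blocks may reach past position \<open>M\<close>, so degrees are counted in a
    larger window.\<close>
  obtain M' where M': "M \<le> M'" "\<forall>i\<in>set ws. Suc i < M'" using ex_bound_list by blast
  have "divided_differences ws (monomial e) \<noteq> 0"
    using nz ws(1) by auto
  then obtain e' where e': "e' \<in> keys (divided_differences ws (monomial e))"
    by (meson ex_in_conv keys_eq_empty)
  have "(\<forall>i<k. lookup e' i = lookup e i) \<and> weight_sum M' e' + length ws = weight_sum M' e"
    using keys_divided_differences[OF e', of k M'] ws(2) M'(2) by (auto simp: monomial_def)
  moreover have "(\<Sum>i<k. lookup e' i) \<le> weight_sum M' e'" using \<open>k \<le> M\<close> M' by (intro weight_sum_ge_prefix) auto
  ultimately have "(\<Sum>i<k. lookup e i) + length ws \<le> weight_sum M' e" by simp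
  also have "weight_sum M' e = weight_sum M e" by (rule weight_sum_eq[OF e M'(1)])
  also have "\<dots> = (\<Sum>i<k. lookup e i) + (\<Sum>i\<in>{k..<M}. lookup e i)"
    unfolding weight_sum_def lessThan_atLeast0 using \<open>k \<le> M\<close> by (simp add: sum.atLeastLessThan_concat)
  finally show ?thesis using ws(3) by simp
qed

text \<open>For the exponent \<open>Suc m\<close>, the first operator yields summands with
  \<open>x_k^(m-t) x_(k+1)^t\<close> for \<open>t \<le> m\<close>. The other \<open>m\<close>
  operators act only beyond \<open>k\<close> and each takes one from the degree there, so all
  summands but \<open>t = m\<close> vanish.\<close>

lemma divided_differences_block:
  "lookup e k = m \<Longrightarrow> (\<And>i. k < i \<Longrightarrow> lookup e i = 0) \<Longrightarrow>
   divided_differences [k..<k + m] (monomial e) = monomial (Poly_Mapping.update k 0 e)"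
proof (induction m arbitrary: k e)
  case 0
  then have "Poly_Mapping.update k 0 e = e" by (intro poly_mapping_eqI) (auto simp: lookup_update)
  then show ?case by simp
next
  case (Suc m)
  define e1 where "e1 t = set_pair k (m - t) t e" for t
  let ?w = "[Suc k..<Suc k + m]"
  have van: "divided_differences ?w (monomial (e1 t)) = 0" if t: "t < m" for t
  proof (rule ccontr)
    assume "\<not> ?thesis"
    then obtain e' where e': "e' \<in> keys (divided_differences ?w (monomial (e1 t)))"
      by (meson ex_in_conv keys_eq_empty)
    define M where "M = Suc (Suc (Suc (k + m)))"
    have *: "(\<forall>i<Suc k. lookup e' i = lookup (e1 t) i)" "weight_sum M e' + m = weight_sum M (e1 t)"
    proof -
      have "Suc k \<le> i \<and> Suc i < M" if "i \<in> set ?w" for i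
        using that by (simp add: M_def del: upt_Suc)
      from keys_divided_differences[OF e' this]
      show "(\<forall>i<Suc k. lookup e' i = lookup (e1 t) i)" "weight_sum M e' + m = weight_sum M (e1 t)"
        by (simp_all add: monomial_def del: upt_Suc)
    qed
    have "weight_sum M (e1 t) = (\<Sum>i<Suc (Suc k). lookup (e1 t) i)"
      unfolding weight_sum_def using Suc.prems
      by (intro sum.mono_neutral_right) (auto simp: M_def e1_def lookup_set_pair)
    then have "weight_sum M (e1 t) = (\<Sum>i<Suc k. lookup (e1 t) i) + t"
      by (simp add: e1_def lookup_set_pair)
    also have "(\<Sum>i<Suc k. lookup (e1 t) i) = (\<Sum>i<Suc k. lookup e' i)"
      using *(1) by (intro sum.cong) auto
    also have "\<dots> \<le> weight_sum M e'" by (rule weight_sum_ge_prefix) (simp add: M_def)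
    finally show False using *(2) t by simp
  qed
  have e1m: "Poly_Mapping.update (Suc k) 0 (e1 m) = Poly_Mapping.update k 0 e"
    using Suc.prems(2)[of "Suc k"] by (intro poly_mapping_eqI) (auto simp: e1_def lookup_update lookup_set_pair)
  have "divided_differences [k..<k + Suc m] (monomial e)
      = divided_differences ?w (\<Sum>t<Suc m. monomial (e1 t))"
    using Suc.prems by (simp add: upt_conv_Cons divided_difference_monomial dd_monomial_def e1_def del: upt_Suc)
  also have "\<dots> = (\<Sum>t<Suc m. divided_differences ?w (monomial (e1 t)))"
    by (rule divided_differences_sum) simp
  also have "\<dots> = divided_differences ?w (monomial (e1 m))" using van by simp
  also have "\<dots> = monomial (Poly_Mapping.update k 0 e)"
    unfolding e1m[symmetric] using Suc.prems by (intro Suc.IH) (auto simp: e1_def lookup_set_pair)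
  finally show ?case .
qed

lemma divided_differences_code_word:
  "keys e \<subseteq> {..<M} \<Longrightarrow> divided_differences (code_word M u) (monomial e) = 1"
  if "\<And>i. i < M \<Longrightarrow> lookup u i = lookup e i"
  using that
proof (induction M arbitrary: e)
  case 0
  then have "e = 0" by (intro poly_mapping_eqI) (auto simp: keys_subset_iff)
  then show ?case by simp
next
  case (Suc M)
  have "divided_differences [M..<M + lookup u M] (monomial e) = monomial (Poly_Mapping.update M 0 e)"
    using Suc.prems by (intro divided_differences_block) (auto simp: keys_subset_iff)
  moreover have "divided_differences (code_word M u) (monomial (Poly_Mapping.update M 0 e)) = 1"
    using Suc.prems by (intro Suc.IH) (auto simp: keys_subset_iff lookup_update)
  ultimately show ?case by simp
qed

lemma fold_up_step_block:
  "(\<And>i. k \<le> i \<Longrightarrow> lookup v i = 0) \<Longrightarrow> fold up_step (rev [k..<k + m]) v = Poly_Mapping.update k m v"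
proof (induction m arbitrary: k)
  case 0
  then have "Poly_Mapping.update k 0 v = v" by (intro poly_mapping_eqI) (auto simp: lookup_update)
  then show ?case by simp
next
  case (Suc m)
  have "rev [k..<k + Suc m] = rev [Suc k..<Suc k + m] @ [k]"
    by (simp add: upt_conv_Cons del: upt_Suc)
  then have "fold up_step (rev [k..<k + Suc m]) v = up_step k (Poly_Mapping.update (Suc k) m v)"
    using Suc.IH[of "Suc k"] Suc.prems by simp
  also have "\<dots> = Poly_Mapping.update k (Suc m) v"
    using Suc.prems by (intro poly_mapping_eqI) (auto simp: lookup_up_step lookup_update)
  finally show ?case .
qed

text \<open>Undoing the word by raises from the zero code rebuilds \<open>u\<close>. Hence a word
  determines the only code that it can take to the zero code.\<close>

lemma lookup_fold_up_step_code_word: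
  "lookup (fold up_step (rev (code_word M u)) 0) i = (if i < M then lookup u i else 0)"
proof (induction M arbitrary: i)
  case (Suc M)
  have "fold up_step (rev (code_word (Suc M) u)) 0
      = Poly_Mapping.update M (lookup u M) (fold up_step (rev (code_word M u)) 0)"
    using Suc.IH by (simp add: fold_up_step_block)
  then show ?case using Suc.IH by (auto simp: lookup_update)
qed simp

text \<open>An ascent anywhere would give zero, so every operator meets a descent. It is then a code
  step, which a raise undoes.\<close>

lemma divided_differences_schubert:
  assumes "\<And>i. i \<in> set ws \<Longrightarrow> Suc i < M" "divided_differences ws (schubert v) \<noteq> 0" "keys v \<subseteq> {..<M}"
  shows "\<exists>v'. divided_differences ws (schubert v) = schubert v' \<and> v = fold up_step (rev ws) v' \<and>
     weight_sum M v' + length ws = weight_sum M v \<and> keys v' \<subseteq> {..<M}"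
  using assms
proof (induction ws arbitrary: v)
  case (Cons j ws)
  have desc: "lookup v (Suc j) < lookup v j"
    using Cons.prems(2) divided_difference_schubert_ascent[of v j] by (cases "lookup v j \<le> lookup v (Suc j)") auto
  note dd = divided_difference_schubert_descent[OF desc]
  have "keys (code_step j v) \<subseteq> {..<M}"
    using Cons.prems(1)[of j] Cons.prems(3) unfolding keys_subset_iff by (auto simp: lookup_code_step)
  then obtain v' where v': "divided_differences ws (schubert (code_step j v)) = schubert v'"
    "code_step j v = fold up_step (rev ws) v'"
    "weight_sum M v' + length ws = weight_sum M (code_step j v)" "keys v' \<subseteq> {..<M}"
    using Cons.IH[of "code_step j v"] Cons.prems dd by auto
  have v: "v = up_step j (code_step j v)" using up_step_code_step[OF desc] by simp
  have "weight_sum M v = Suc (weight_sum M (code_step j v))"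
    using weight_sum_up_step[of j M "code_step j v"] v Cons.prems(1)[of j] by simp
  then show ?case using v' v dd by (intro exI[of _ v']) auto
qed auto

lemma weight_sum_eq_0: "keys v \<subseteq> {..<M} \<Longrightarrow> weight_sum M v = 0 \<Longrightarrow> v = 0"
proof (intro poly_mapping_eqI)
  fix i assume "keys v \<subseteq> {..<M}" "weight_sum M v = 0"
  then show "lookup v i = lookup 0 i"
    by (cases "i < M") (auto simp: weight_sum_def keys_subset_iff)
qed

text \<open>Induction on the degree: a nonzero code has a descent because its entries are eventually
  zero, and the divided difference there is a Schubert polynomial of smaller degree.\<close>

lemma schubert_nonzero: "schubert v \<noteq> 0"
proof -
  have "\<exists>M. keys v \<subseteq> {..<M} \<and> weight_sum M v = s \<Longrightarrow> schubert v \<noteq> 0" for s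
  proof (induction s arbitrary: v)
    case 0
    then have "v = 0" using weight_sum_eq_0 by blast
    then show ?case by simp
  next
    case (Suc s)
    then obtain M where M: "keys v \<subseteq> {..<M}" "weight_sum M v = Suc s" by blast
    have "\<exists>i. lookup v (Suc i) < lookup v i"
    proof (rule ccontr)
      assume "\<not> ?thesis"
      then have "mono (lookup v)" by (intro mono_iff_le_Suc[THEN iffD2]) (simp add: not_less)
      then have "lookup v i \<le> lookup v (i + M)" for i by (rule monoD) simp
      then have "lookup v i = 0" for i using M(1) by (simp add: keys_subset_iff)
      then show False using M(2) by (simp add: weight_sum_def)
    qed
    then obtain i where i: "lookup v (Suc i) < lookup v i" by blast
    define M' where "M' = M + i + 2"
    have "Suc (weight_sum M' (code_step i v)) = weight_sum M' v"
      using weight_sum_up_step[of i M' "code_step i v"] up_step_code_step[OF i] by (simp add: M'_def)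
    also have "\<dots> = weight_sum M v" by (rule weight_sum_eq[OF M(1)]) (simp add: M'_def)
    finally have "weight_sum M' (code_step i v) = s" using M(2) by simp
    moreover have "keys (code_step i v) \<subseteq> {..<M'}"
      using M(1) unfolding keys_subset_iff M'_def by (auto simp: lookup_code_step)
    ultimately have "schubert (code_step i v) \<noteq> 0" using Suc.IH by blast
    then show ?case using divided_difference_schubert_descent[OF i] by auto
  qed
  then show ?thesis using ex_keys_bound by blast
qed

text \<open>Summation by parts expresses an increasing weight through sums over tails.\<close>

lemma weighted_sum_less:
  fixes c x y :: "nat \<Rightarrow> nat"
  assumes c: "\<And>i. Suc i < M \<Longrightarrow> c i < c (Suc i)"
    and total: "(\<Sum>i<M. x i) = (\<Sum>i<M. y i)"
    and tails: "\<And>k. k \<le> M \<Longrightarrow> (\<Sum>i\<in>{k..<M}. x i) \<le> (\<Sum>i\<in>{k..<M}. y i)"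
    and ne: "i < M" "x i \<noteq> y i"
  shows "(\<Sum>i<M. c i * x i) < (\<Sum>i<M. c i * y i)"
proof -
  define \<delta> where "\<delta> k = (if k = 0 then c 0 else c k - c (k - 1))" for k
  have c_eq: "c i = (\<Sum>k\<le>i. \<delta> k)" if "i < M" for i
    using that
  proof (induction i)
    case (Suc i)
    then show ?case using c[of i] by (simp add: \<delta>_def)
  qed (simp add: \<delta>_def)
  have parts: "(\<Sum>i<M. c i * z i) = (\<Sum>k<M. \<delta> k * (\<Sum>i\<in>{k..<M}. z i))" for z :: "nat \<Rightarrow> nat"
  proof -
    have "(\<Sum>i<M. c i * z i) = (\<Sum>i<M. \<Sum>k<M. if k \<le> i then \<delta> k * z i else 0)"
    proof (intro sum.cong refl)
      fix i assume "i \<in> {..<M}"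
      then have "c i * z i = (\<Sum>k\<le>i. \<delta> k * z i)" by (simp add: c_eq sum_distrib_right)
      also have "\<dots> = (\<Sum>k\<in>{..<M} \<inter> {k. k \<le> i}. \<delta> k * z i)"
        using \<open>i \<in> {..<M}\<close> by (intro sum.cong) auto
      finally show "c i * z i = (\<Sum>k<M. if k \<le> i then \<delta> k * z i else 0)"
        by (simp add: sum.inter_restrict)
    qed
    also have "\<dots> = (\<Sum>k<M. \<Sum>i<M. if k \<le> i then \<delta> k * z i else 0)" by (rule sum.swap)
    also have "\<dots> = (\<Sum>k<M. \<delta> k * (\<Sum>i\<in>{k..<M}. z i))"
    proof (intro sum.cong refl)
      fix k assume "k \<in> {..<M}"
      have "(\<Sum>i<M. if k \<le> i then \<delta> k * z i else 0) = (\<Sum>i\<in>{..<M} \<inter> {i. k \<le> i}. \<delta> k * z i)"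
        by (simp add: sum.inter_restrict)
      also have "{..<M} \<inter> {i. k \<le> i} = {k..<M}" by auto
      finally show "(\<Sum>i<M. if k \<le> i then \<delta> k * z i else 0) = \<delta> k * (\<Sum>i\<in>{k..<M}. z i)"
        by (simp add: sum_distrib_left)
    qed
    finally show ?thesis .
  qed
  \<comment> \<open>\<open>\<delta> 0 = c 0\<close> may be zero, so strictness is needed at a tail
    starting after 0. The tail at 0 is the total, which agrees on both sides.\<close>
  have "\<exists>k. 0 < k \<and> k < M \<and> (\<Sum>i\<in>{k..<M}. x i) \<noteq> (\<Sum>i\<in>{k..<M}. y i)"
  proof (rule ccontr)
    assume neg: "\<not> ?thesis"
    have eq: "(\<Sum>i\<in>{k..<M}. x i) = (\<Sum>i\<in>{k..<M}. y i)" for k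
    proof (cases "0 < k \<and> k < M")
      case False
      then consider "k = 0" | "M \<le> k" by linarith
      then show ?thesis using total by cases (simp_all add: lessThan_atLeast0)
    qed (use neg in blast)
    from eq[of i] eq[of "Suc i"] ne show False by (simp add: sum.atLeast_Suc_lessThan)
  qed
  then obtain k where k: "0 < k" "k < M" "(\<Sum>i\<in>{k..<M}. x i) < (\<Sum>i\<in>{k..<M}. y i)"
    using tails by (metis le_neq_implies_less less_imp_le)
  have "0 < \<delta> k" using k c[of "k - 1"] by (simp add: \<delta>_def)
  show ?thesis unfolding parts
  proof (rule sum_strict_mono_ex1)
    show "\<exists>k\<in>{..<M}. \<delta> k * (\<Sum>i\<in>{k..<M}. x i) < \<delta> k * (\<Sum>i\<in>{k..<M}. y i)"
      using k \<open>0 < \<delta> k\<close> by (intro bexI[of _ k]) auto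
  qed (use tails in auto)
qed

section \<open>The leading monomial for increasing weights\<close>

definition expo_weight :: "nat \<Rightarrow> (nat \<Rightarrow> nat) \<Rightarrow> expo \<Rightarrow> nat" where
  "expo_weight M c e = (\<Sum>i<M. c i * lookup e i)"

text \<open>The word is that of a monomial \<open>e0\<close> of maximal weight, not that of
  \<open>v\<close>. It kills all other monomials, whose tails would otherwise force a larger weight,
  and so leaves the coefficient of \<open>e0\<close>. On the other side it yields a Schubert
  polynomial of degree 0, which is 1. Thus the coefficient is 1, and undoing the word gives
  \<open>v = e0\<close>.\<close>

lemma schubert_leading:
  assumes v: "keys v \<subseteq> {..<M}" and c: "\<And>i. Suc i < M \<Longrightarrow> c i < c (Suc i)"
  shows lookup_schubert_self: "lookup (schubert v) v = 1"
    and expo_weight_less: "e \<in> keys (schubert v) \<Longrightarrow> e \<noteq> v \<Longrightarrow> expo_weight M c e < expo_weight M c v"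
proof -
  let ?p = "schubert v"
  let ?wt = "expo_weight M c"
  have hom: "keys e \<subseteq> {..<M}" "weight_sum M e = weight_sum M v" if "e \<in> keys ?p" for e
    using homogeneous_schubert[OF v] that by (auto simp: homogeneous_def)
  have max: "e0 = v \<and> lookup ?p e0 = 1" if e0: "e0 \<in> keys ?p" and mx: "\<And>e. e \<in> keys ?p \<Longrightarrow> ?wt e \<le> ?wt e0" for e0
  proof -
    let ?w = "code_word M e0"
    have van: "divided_differences ?w (monomial e) = 0" if e: "e \<in> keys ?p" "e \<noteq> e0" for e
    proof (rule ccontr)
      assume nz: "\<not> ?thesis"
      obtain i where i: "lookup e0 i \<noteq> lookup e i" using e(2) poly_mapping_eqI by metis
      then have "i < M" using hom(1)[OF e(1)] hom(1)[OF e0] by (metis keys_subset_iff not_le)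
      then have "?wt e0 < ?wt e" unfolding expo_weight_def
        using i hom(2)[OF e(1)] hom(2)[OF e0] c code_word_monomial_nonzero[OF nz hom(1)[OF e(1)]]
        by (intro weighted_sum_less[where x = "lookup e0" and y = "lookup e"]) (auto simp: weight_sum_def)
      then show False using mx[OF e(1)] by simp
    qed
    have "divided_differences ?w ?p = frag_extend (\<lambda>e. divided_differences ?w (monomial e)) ?p"
      by (rule divided_differences_eq_frag_extend)
    also have "\<dots> = frag_cmul (lookup ?p e0) (divided_differences ?w (monomial e0))"
      unfolding frag_extend_def using e0 van by (subst sum.remove[of _ e0]) auto
    also have "\<dots> = frag_cmul (lookup ?p e0) 1"
      by (subst divided_differences_code_word) (use hom(1)[OF e0] in auto)
    finally have eq: "divided_differences ?w ?p = frag_cmul (lookup ?p e0) 1" .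
    obtain M' where M': "M \<le> M'" "\<forall>i\<in>set ?w. Suc i < M'" using ex_bound_list by blast
    have "divided_differences ?w ?p \<noteq> 0" unfolding eq using e0 by (simp add: in_keys_iff)
    moreover have "keys v \<subseteq> {..<M'}" using v M'(1) by auto
    ultimately obtain v' where v': "divided_differences ?w ?p = schubert v'" "v = fold up_step (rev ?w) v'"
      "weight_sum M' v' + length ?w = weight_sum M' v" "keys v' \<subseteq> {..<M'}"
      using divided_differences_schubert[of ?w M' v] M'(2) by blast
    have "length ?w = weight_sum M' v"
      using hom(2)[OF e0] by (simp add: length_code_word weight_sum_eq[OF v M'(1)])
    then have "v' = 0" using v'(3) by (intro weight_sum_eq_0[OF v'(4)]) simp
    then have "v = e0"
      using hom(1)[OF e0] unfolding v'(2)
      by (intro poly_mapping_eqI) (auto simp: lookup_fold_up_step_code_word keys_subset_iff)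
    moreover have "frag_cmul (lookup ?p e0) (1::zpoly) = 1" using eq v'(1) \<open>v' = 0\<close> by simp
    then have "lookup (frag_cmul (lookup ?p e0) (1::zpoly)) 0 = lookup (1::zpoly) 0" by simp
    then have "lookup ?p e0 = 1" by simp
    ultimately show ?thesis by simp
  qed
  have "keys ?p \<noteq> {}" using schubert_nonzero by simp
  then obtain e0 where e0: "e0 \<in> keys ?p" "\<And>e. e \<in> keys ?p \<Longrightarrow> ?wt e \<le> ?wt e0"
  proof -
    have "Max (?wt ` keys ?p) \<in> ?wt ` keys ?p" using \<open>keys ?p \<noteq> {}\<close> by (intro Max_in) auto
    then obtain e0 where "e0 \<in> keys ?p" "?wt e0 = Max (?wt ` keys ?p)" by auto
    then show ?thesis using that[of e0] by simp
  qed
  note v_max = max[OF e0]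
  then have ve: "e0 = v" and one: "lookup ?p e0 = 1" by auto
  show "lookup ?p v = 1" using one unfolding ve .
  show "?wt e < ?wt v" if "e \<in> keys ?p" "e \<noteq> v"
  proof (rule ccontr)
    assume "\<not> ?wt e < ?wt v"
    \<comment> \<open>Such an \<open>e\<close> would also have maximal weight, so \<open>max\<close>
      would apply to it.\<close>
    then have "?wt e' \<le> ?wt e" if "e' \<in> keys ?p" for e'
      using e0(2)[OF that] unfolding ve by linarith
    then have "e = v" using max[OF \<open>e \<in> keys ?p\<close>] by blast
    then show False using that by simp
  qed
qed

section \<open>Power sums, separating weights and bases\<close>

definition alternating_sum :: "nat \<Rightarrow> nat \<Rightarrow> int" where
  "alternating_sum E w = (\<Sum>j\<le>E. (-1) ^ j * int (E choose j) * int j ^ w)"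

text \<open>Up to sign this is the \<open>E\<close>-th finite difference of a power at 0. One factor
  \<open>j\<close> is absorbed into the binomial coefficient, which lowers \<open>E\<close>; after
  expanding \<open>(j + 1) ^ w'\<close> only the exponent \<open>E\<close> survives.\<close>

lemma alternating_sum_eq:
  "w \<le> E \<Longrightarrow> alternating_sum E w = (if w = E then (-1) ^ E * fact E else 0)"
proof (induction E arbitrary: w)
  case 0
  then show ?case by (simp add: alternating_sum_def)
next
  case (Suc E)
  show ?case
  proof (cases w)
    case 0
    then show ?thesis
      using choose_alternating_sum[of "Suc E", where 'a = int] by (simp add: alternating_sum_def)
  next
    case w: (Suc w')
    have "alternating_sum (Suc E) w
        = (\<Sum>j\<le>E. (-1) ^ Suc j * int (Suc E choose Suc j) * int (Suc j) ^ w)"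
      unfolding alternating_sum_def by (subst sum.atMost_Suc_shift) (simp add: w)
    also have "\<dots> = (\<Sum>j\<le>E. - int (Suc E) * ((-1) ^ j * int (E choose j) * (int j + 1) ^ w'))"
    proof (intro sum.cong refl)
      fix j
      have absorb: "int (Suc j) * int (Suc E choose Suc j) = int (Suc E) * int (E choose j)"
        by (metis Suc_times_binomial_eq mult.commute of_nat_mult)
      have gen: "(-1) ^ Suc j * C * x ^ Suc w' = - ((-1) ^ j * (x * C) * x ^ w')" for C x :: int
        by (simp add: algebra_simps)
      have gen': "- (p * (e * c) * q) = - e * (p * c * q)" for p e c q :: int
        by (simp add: algebra_simps)
      have Sj: "int (Suc j) = int j + 1" by simp
      show "(-1) ^ Suc j * int (Suc E choose Suc j) * int (Suc j) ^ w
         = - int (Suc E) * ((-1) ^ j * int (E choose j) * (int j + 1) ^ w')"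
        unfolding w gen absorb gen' by (simp only: Sj)
    qed
    also have "\<dots> = - int (Suc E) * (\<Sum>j\<le>E. \<Sum>r\<le>w'. int (w' choose r) * ((-1) ^ j * int (E choose j) * int j ^ r))"
      unfolding sum_distrib_left[symmetric] binomial_ring
      by (simp add: sum_distrib_left sum_distrib_right mult_ac)
    also have "(\<Sum>j\<le>E. \<Sum>r\<le>w'. int (w' choose r) * ((-1) ^ j * int (E choose j) * int j ^ r))
        = (\<Sum>r\<le>w'. int (w' choose r) * alternating_sum E r)"
      unfolding alternating_sum_def sum_distrib_left by (rule sum.swap)
    also have "\<dots> = (\<Sum>r\<le>w'. if r = E then (-1) ^ E * fact E else 0)"
      using Suc.prems w by (intro sum.cong refl) (auto simp: Suc.IH)
    also have "\<dots> = (if w' = E then (-1) ^ E * fact E else 0)"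
      using Suc.prems w by (auto simp: sum.delta')
    also have "- int (Suc E) * \<dots> = (if w = Suc E then (-1) ^ Suc E * fact (Suc E) else 0)"
      using w by (auto simp: algebra_simps)
    finally show ?thesis .
  qed
qed

section \<open>Power sums over few nodes\<close>

lemma power_sums_zero:
  fixes \<alpha> :: "'a::field \<Rightarrow> 'a"
  assumes "finite X" "\<And>k. k < card X \<Longrightarrow> (\<Sum>x\<in>X. \<alpha> x * x ^ k) = 0" "x \<in> X"
  shows "\<alpha> x = 0"
  using assms
proof (induction X arbitrary: \<alpha> x rule: finite_induct)
  case (insert y X)
  \<comment> \<open>Subtracting \<open>y\<close> times each power sum from the next one removes the
    node \<open>y\<close> and multiplies the other coefficients by the nonzero
    \<open>z - y\<close>.\<close>
  have "\<alpha> z * (z - y) = 0" if "z \<in> X" for z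
  proof (rule insert.IH[of "\<lambda>z. \<alpha> z * (z - y)", OF _ that])
    fix k assume k: "k < card X"
    have "(\<Sum>x\<in>X. \<alpha> x * (x - y) * x ^ k) = (\<Sum>x\<in>insert y X. \<alpha> x * (x - y) * x ^ k)"
      using insert.hyps by simp
    also have "\<dots> = (\<Sum>x\<in>insert y X. \<alpha> x * x ^ Suc k) - y * (\<Sum>x\<in>insert y X. \<alpha> x * x ^ k)"
      unfolding sum_distrib_left sum_subtractf[symmetric] by (intro sum.cong) (auto simp: algebra_simps)
    also have "\<dots> = 0" using insert.prems(1)[of k] insert.prems(1)[of "Suc k"] insert.hyps k by simp
    finally show "(\<Sum>x\<in>X. \<alpha> x * (x - y) * x ^ k) = 0" .
  qed
  then have X: "\<alpha> z = 0" if "z \<in> X" for z using that insert.hyps by auto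
  then have "\<alpha> y = 0" using insert.prems(1)[of 0] insert.hyps by simp
  then show ?case using X insert.prems(2) by auto
qed auto

lemma power_sums_zero_int:
  fixes a b :: "'b \<Rightarrow> int"
  assumes "finite S" "inj_on b S" "card S \<le> m" "\<And>k. k \<le> m \<Longrightarrow> (\<Sum>v\<in>S. a v * b v ^ k) = 0" "v \<in> S"
  shows "a v = 0"
proof -
  let ?b = "\<lambda>v. rat_of_int (b v)"
  have inj: "inj_on ?b S" using assms(2) by (auto simp: inj_on_def)
  define \<alpha> where "\<alpha> x = rat_of_int (a (the_inv_into S ?b x))" for x
  have "\<alpha> (?b v) = 0"
  proof (rule power_sums_zero[where \<alpha> = \<alpha> and X = "?b ` S"])
    fix k assume "k < card (?b ` S)"
    then have k: "k \<le> m" using assms(3) card_image_le[OF assms(1), of ?b] by linarith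
    have "(\<Sum>x\<in>?b ` S. \<alpha> x * x ^ k)
      = (\<Sum>v\<in>S. rat_of_int (a v) * ?b v ^ k)"
      by (subst sum.reindex[OF inj]) (simp add: \<alpha>_def the_inv_into_f_f[OF inj])
    also have "\<dots> = rat_of_int (\<Sum>v\<in>S. a v * b v ^ k)" by simp
    finally show "(\<Sum>x\<in>?b ` S. \<alpha> x * x ^ k) = 0"
      using assms(4)[OF k] by simp
  qed (use assms in auto)
  then show ?thesis by (simp add: \<alpha>_def the_inv_into_f_f[OF inj assms(5)])
qed

text \<open>
  If the power sums form a geometric sequence, then subtracting this sequence from the sum leaves
  at most \<open>m + 1\<close> nodes, so all coefficients outside the ratio of the sequence vanish.
\<close>

lemma geometric_power_sums:
  fixes a b :: "'b \<Rightarrow> int" and S :: "'b set"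
  defines "T \<equiv> \<lambda>k. \<Sum>v\<in>S. a v * b v ^ k"
  assumes "finite S" "inj_on b S" "card S \<le> m" "\<And>v. v \<in> S \<Longrightarrow> a v \<noteq> 0"
    and T0: "T 0 \<noteq> 0" and geo: "\<And>k. k < m \<Longrightarrow> T (Suc k) * T 0 = T k * T 1"
  shows "\<exists>v. S = {v}"
proof -
  define \<rho> where "\<rho> = rat_of_int (T 1) / rat_of_int (T 0)"
  have T: "rat_of_int (T k) = rat_of_int (T 0) * \<rho> ^ k" if "k \<le> m" for k
    using that
  proof (induction k)
    case (Suc k)
    have "rat_of_int (T (Suc k)) * rat_of_int (T 0) = rat_of_int (T k) * rat_of_int (T 1)"
      using geo[of k] Suc.prems by (simp flip: of_int_mult)
    then show ?case using Suc T0 by (simp add: \<rho>_def field_simps)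
  qed simp
  let ?b = "\<lambda>v. rat_of_int (b v)"
  have inj: "inj_on ?b S" using assms(3) by (auto simp: inj_on_def)
  \<comment> \<open>The ratio joins the nodes, so \<open>X\<close> can have \<open>m + 1\<close>
    elements. This is why the power sums up to \<open>k = m\<close> are taken.\<close>
  define X where "X = insert \<rho> (?b ` S)"
  define \<alpha> where "\<alpha> x = (if x \<in> ?b ` S then rat_of_int (a (the_inv_into S ?b x)) else 0)
    - (if x = \<rho> then rat_of_int (T 0) else 0)" for x
  have finX: "finite X" and cardX: "card X \<le> Suc m"
    using assms card_image_le[OF assms(2), of ?b] by (auto simp: X_def card_insert_if)
  have "\<alpha> x = 0" if "x \<in> X" for x
  proof (rule power_sums_zero[OF finX _ that])
    fix k assume "k < card X"
    then have k: "k \<le> m" using cardX by simp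
    have "(\<Sum>x\<in>X. \<alpha> x * x ^ k)
      = (\<Sum>x\<in>X. if x \<in> ?b ` S then rat_of_int (a (the_inv_into S ?b x)) * x ^ k else 0)
        - (\<Sum>x\<in>X. if x = \<rho> then rat_of_int (T 0) * x ^ k else 0)"
      unfolding \<alpha>_def sum_subtractf[symmetric] by (intro sum.cong) (auto simp: algebra_simps)
    also have "(\<Sum>x\<in>X. if x = \<rho> then rat_of_int (T 0) * x ^ k else 0) = rat_of_int (T 0) * \<rho> ^ k"
      using finX by (simp add: X_def)
    also have "(\<Sum>x\<in>X. if x \<in> ?b ` S then rat_of_int (a (the_inv_into S ?b x)) * x ^ k else 0)
      = (\<Sum>x\<in>?b ` S. rat_of_int (a (the_inv_into S ?b x)) * x ^ k)"
      using finX by (intro sum.mono_neutral_cong_right) (auto simp: X_def)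
    also have "\<dots> = (\<Sum>v\<in>S. rat_of_int (a v) * ?b v ^ k)"
      by (subst sum.reindex[OF inj]) (simp add: the_inv_into_f_f[OF inj])
    also have "\<dots> = rat_of_int (T k)" by (simp add: T_def)
    finally show "(\<Sum>x\<in>X. \<alpha> x * x ^ k) = 0" using T[OF k] by simp
  qed
  then have \<alpha>0: "\<alpha> (?b v) = 0" if "v \<in> S" for v
    using that by (simp add: X_def)
  have "?b v = \<rho>" if v: "v \<in> S" for v
  proof (rule ccontr)
    assume "?b v \<noteq> \<rho>"
    then have "\<alpha> (?b v) = rat_of_int (a v)"
      using v by (simp add: \<alpha>_def the_inv_into_f_f[OF inj v])
    then show False using \<alpha>0[OF v] assms(5)[OF v] by simp
  qed
  then have "v = w" if "v \<in> S" "w \<in> S" for v w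
    using that inj by (metis inj_onD)
  moreover have "S \<noteq> {}" using T0 by (auto simp: T_def)
  ultimately show ?thesis by blast
qed

text \<open>The reciprocals of the entries \<open>n * (n - 1 choose k)\<close> form Leibniz's harmonic triangle.\<close>

lemma leibniz_triangle_dvd:
  assumes "\<And>q. 1 \<le> q \<Longrightarrow> q \<le> Q \<Longrightarrow> q dvd L" "k < n" "n \<le> Q"
  shows "n * (n - 1 choose k) dvd (L::nat)"
  using assms(2,3)
proof (induction k arbitrary: n)
  case 0
  then show ?case using assms(1)[of n] by simp
next
  case (Suc k)
  then obtain n' where n: "n = Suc n'" and k: "k < n'" by (cases n) auto
  define X where "X = (n' choose k)"
  have X: "X > 0" using k by (simp add: X_def)
  define a b c where "a = (n' - k) * X" and "b = Suc n' * X" and "c = n * (n - 1 choose Suc k)"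
  have "n' * (n' - 1 choose k) dvd L" "Suc n' * (n' choose k) dvd L"
    using Suc.IH[of n'] Suc.IH[of "Suc n'"] Suc.prems n k by simp_all
  then have "a dvd L" "b dvd L"
    using binomial_absorb_comp[of n' k] by (simp_all add: a_def b_def X_def)
  then obtain s t where s: "L = a * s" and t: "L = b * t" by (metis dvdE)
  have c: "Suc k * c = Suc n' * ((n' - k) * X)"
  proof -
    have "Suc k * (n' choose Suc k) = (n' - k) * X"
      unfolding X_def binomial_absorb_comp by (rule binomial_absorption)
    then show ?thesis unfolding c_def n by (simp only: mult.left_commute[of "Suc k"] diff_Suc_1)
  qed
  \<comment> \<open>This is \<open>1/c = 1/a - 1/b\<close> with denominators cleared. Therefore
    \<open>L / c = s - t\<close> is an integer.\<close>
  have ab: "int a * int b = int c * (int b - int a)"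
  proof -
    have "int b - int a = int (Suc k) * int X"
      using k by (simp add: a_def b_def of_nat_diff algebra_simps)
    then have "int c * (int b - int a) = int (Suc k * c) * int X" by (simp add: algebra_simps)
    also have "\<dots> = int a * int b" unfolding c a_def b_def by (simp only: of_nat_mult mult_ac)
    finally show ?thesis ..
  qed
  have "int c * (int s - int t) * (int a * int b) = int c * (int (a * s) * int b - int (b * t) * int a)"
    by (simp add: algebra_simps)
  also have "\<dots> = int L * (int a * int b)"
    unfolding s[symmetric] t[symmetric] ab by (simp add: algebra_simps)
  finally have "int c * (int s - int t) * (int a * int b) = int L * (int a * int b)" .
  moreover have "int a * int b \<noteq> 0" using k X by (simp add: a_def b_def del: mult_Suc)
  ultimately have "int c * (int s - int t) = int L" by simp
  then have "int c dvd int L" by (metis dvd_triv_left)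
  then have "c dvd L" by (simp only: int_dvd_int_iff)
  then show ?case by (simp only: c_def)
qed

text \<open>\<open>L\<close> is at least each of the \<open>Q\<close> entries of a row of the
  triangle, hence at least their average; they add up to \<open>Q * 2 ^ (Q - 1)\<close>.\<close>

lemma common_multiple_ge:
  assumes "\<And>q. 1 \<le> q \<Longrightarrow> q \<le> Q \<Longrightarrow> q dvd L" "0 < (L::nat)" "0 < Q"
  shows "2 ^ (Q - 1) \<le> L"
proof -
  have "Q * 2 ^ (Q - 1) = (\<Sum>k\<le>Q - 1. Q * (Q - 1 choose k))"
    by (simp add: choose_row_sum sum_distrib_left[symmetric])
  also have "\<dots> \<le> (\<Sum>k\<le>Q - 1. L)"
  proof (intro sum_mono dvd_imp_le \<open>0 < L\<close>)
    fix k assume "k \<in> {..Q - 1}"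
    then have "k < Q" using assms(3) by auto
    then show "Q * (Q - 1 choose k) dvd L" by (intro leibniz_triangle_dvd[OF assms(1)]) auto
  qed
  also have "\<dots> = Q * L" using assms(3) by simp
  finally show ?thesis using assms(3) by simp
qed

section \<open>Separating codes by small weights\<close>

definition digit_value :: "nat \<Rightarrow> nat \<Rightarrow> nat list \<Rightarrow> nat" where
  "digit_value N n v = (\<Sum>i<n. N ^ i * v ! i)"

lemma digit_value_less:
  assumes "\<And>i. i < n \<Longrightarrow> v ! i < N"
  shows "digit_value N n v < N ^ n"
  using assms
proof (induction n)
  case (Suc n)
  have "digit_value N (Suc n) v < N ^ n + N ^ n * v ! n"
    using Suc by (simp add: digit_value_def)
  also have "\<dots> = N ^ n * Suc (v ! n)" by simp
  also have "\<dots> \<le> N ^ n * N" using Suc.prems[of n] by (intro mult_left_mono) auto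
  finally show ?case by (simp add: mult.commute)
qed (simp add: digit_value_def)

lemma digit_value_inj:
  assumes "\<And>i. i < n \<Longrightarrow> v ! i < N" "\<And>i. i < n \<Longrightarrow> w ! i < N"
    and "digit_value N n v = digit_value N n w" "i < n"
  shows "v ! i = w ! i"
  using assms
proof (induction n)
  case (Suc n)
  have lt: "digit_value N n v < N ^ n" "digit_value N n w < N ^ n"
    using Suc.prems by (auto intro!: digit_value_less)
  have eq: "digit_value N n v + N ^ n * v ! n = digit_value N n w + N ^ n * w ! n"
    using Suc.prems(3) by (simp add: digit_value_def)
  have "(x + N ^ n * y) div N ^ n = y" if "x < N ^ n" for x y
  proof -
    have "N ^ n \<noteq> 0" using that by linarith
    then show ?thesis using that by simp
  qed
  then have "v ! n = w ! n" using eq lt by metis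
  with eq have "digit_value N n v = digit_value N n w" by simp
  then show ?case using Suc \<open>v ! n = w ! n\<close> by (cases "i = n") auto
qed simp

text \<open>The remainder is below \<open>q\<close>, so the summand \<open>i * q\<close> makes the
  weights strictly increasing. Modulo \<open>q\<close> they are the powers of \<open>N\<close>, so
  codes of equal weight have base-\<open>N\<close> values congruent modulo \<open>q\<close>.\<close>

definition weight :: "nat \<Rightarrow> nat \<Rightarrow> nat \<Rightarrow> nat" where
  "weight N q i = i * q + N ^ i mod q"

definition code_weight :: "nat \<Rightarrow> nat \<Rightarrow> nat \<Rightarrow> nat list \<Rightarrow> nat" where
  "code_weight N q n v = (\<Sum>i<n. weight N q i * v ! i)"

lemma weight_strict_mono: "0 < q \<Longrightarrow> weight N q i < weight N q (Suc i)"
proof -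
  assume "0 < q"
  then have "N ^ i mod q < q" by simp
  then show ?thesis unfolding weight_def by simp
qed

lemma weight_less: "0 < q \<Longrightarrow> i < n \<Longrightarrow> weight N q i < n * q"
proof -
  assume "0 < q" "i < n"
  then have "weight N q i < Suc i * q" by (simp add: weight_def)
  also have "\<dots> \<le> n * q" using \<open>i < n\<close> by (intro mult_right_mono) auto
  finally show ?thesis .
qed

lemma code_weight_mod: "code_weight N q n v mod q = digit_value N n v mod q"
proof -
  have "code_weight N q n v mod q = (\<Sum>i<n. weight N q i * v ! i mod q) mod q"
    unfolding code_weight_def by (rule mod_sum_eq[symmetric])
  also have "(\<Sum>i<n. weight N q i * v ! i mod q) = (\<Sum>i<n. N ^ i * v ! i mod q)"
  proof (intro sum.cong refl)
    fix i
    have "weight N q i mod q = N ^ i mod q" by (simp add: weight_def)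
    then show "weight N q i * v ! i mod q = N ^ i * v ! i mod q" by (rule mod_mult_cong) simp
  qed
  finally show ?thesis unfolding digit_value_def by (simp add: mod_sum_eq)
qed

lemma ex_separating_modulus:
  assumes "finite \<Gamma>" "card \<Gamma> \<le> m" "\<And>v. v \<in> \<Gamma> \<Longrightarrow> length v = n" "\<And>v i. v \<in> \<Gamma> \<Longrightarrow> i < n \<Longrightarrow> v ! i \<le> d"
  shows "\<exists>q. 1 \<le> q \<and> q \<le> d * n * m * m + 2 \<and> inj_on (code_weight (d + 1) q n) \<Gamma>"
proof (rule ccontr)
  assume neg: "\<not> ?thesis"
  \<comment> \<open>The least value with \<open>2 ^ (Q - 1)\<close> above
    \<open>2 ^ (d * n * m * m)\<close>, the bound derived below for the product
    \<open>L\<close>.\<close>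
  define Q where "Q = d * n * m * m + 2"
  let ?X = "\<lambda>v. int (digit_value (d + 1) n v)"
  define I where "I = {(v, w). v \<in> \<Gamma> \<and> w \<in> \<Gamma> \<and> v \<noteq> w}"
  have I: "finite I" "I \<subseteq> \<Gamma> \<times> \<Gamma>" using assms(1) by (auto simp: I_def intro: finite_subset[of _ "\<Gamma> \<times> \<Gamma>"])
  have cardI: "card I \<le> m * m"
    using card_mono[OF _ I(2)] assms(1,2) mult_le_mono[OF assms(2) assms(2)] by (simp add: card_cartesian_product)
  define L where "L = (\<Prod>(v, w)\<in>I. nat \<bar>?X v - ?X w\<bar>)"
  have digits: "v ! i < d + 1" if "v \<in> \<Gamma>" "i < n" for v i using assms(4)[OF that] by simp
  have "0 < L" unfolding L_def
  proof (intro prod_pos, clarify)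
    fix v w assume "(v, w) \<in> I"
    then have vw: "v \<in> \<Gamma>" "w \<in> \<Gamma>" "v \<noteq> w" by (auto simp: I_def)
    have "?X v \<noteq> ?X w"
    proof
      assume "?X v = ?X w"
      then have "v = w"
        using digit_value_inj[of n v "d + 1" w] digits vw assms(3) by (intro nth_equalityI) auto
      then show False using vw by simp
    qed
    then show "0 < nat \<bar>?X v - ?X w\<bar>" by simp
  qed
  have dvd: "q dvd L" if "1 \<le> q" "q \<le> Q" for q
  proof -
    have "\<not> inj_on (code_weight (d + 1) q n) \<Gamma>" using neg that by (auto simp: Q_def)
    then obtain v w where vw: "v \<in> \<Gamma>" "w \<in> \<Gamma>" "v \<noteq> w" "code_weight (d + 1) q n v = code_weight (d + 1) q n w"
      by (auto simp: inj_on_def)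
    then have "digit_value (d + 1) n v mod q = digit_value (d + 1) n w mod q"
      by (metis code_weight_mod)
    then have "?X v mod int q = ?X w mod int q" by (metis zmod_int)
    then have "int q dvd ?X v - ?X w" by (simp add: mod_eq_dvd_iff)
    then have "q dvd nat \<bar>?X v - ?X w\<bar>" by (simp add: nat_abs_dvd_iff int_dvd_int_iff flip: int_dvd_int_iff)
    also have "\<dots> dvd L" unfolding L_def
      using dvd_prodI[OF I(1), of "(v, w)" "\<lambda>(v, w). nat \<bar>?X v - ?X w\<bar>"] vw by (simp add: I_def)
    finally show ?thesis .
  qed
  have "2 ^ (Q - 1) \<le> L" by (rule common_multiple_ge[OF dvd \<open>0 < L\<close>]) (simp_all add: Q_def)
  also have "L \<le> (\<Prod>(v, w)\<in>I. (d + 1) ^ n)" unfolding L_def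
  proof (intro prod_mono, clarify)
    fix v w assume "(v, w) \<in> I"
    then have "v \<in> \<Gamma>" "w \<in> \<Gamma>" by (auto simp: I_def)
    then have "digit_value (d + 1) n v < (d + 1) ^ n" "digit_value (d + 1) n w < (d + 1) ^ n"
      using digits by (auto intro!: digit_value_less)
    then show "0 \<le> nat \<bar>?X v - ?X w\<bar> \<and> nat \<bar>?X v - ?X w\<bar> \<le> (d + 1) ^ n" by linarith
  qed
  also have "\<dots> = ((d + 1) ^ n) ^ card I" by (simp add: case_prod_unfold)
  also have "\<dots> \<le> ((d + 1) ^ n) ^ (m * m)" using cardI by (intro power_increasing) auto
  also have "\<dots> \<le> ((2 ^ d) ^ n) ^ (m * m)"
    by (intro power_mono) (use less_exp[of d] in \<open>auto simp: Suc_le_eq\<close>)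
  also have "\<dots> = 2 ^ (d * n * m * m)" by (simp add: power_mult[symmetric] mult.assoc)
  finally have "Q - 1 \<le> d * n * m * m" by simp
  then show False by (simp add: Q_def)
qed

text \<open>The moduli of Goedel's beta function. They are coprime to \<open>n!\<close>, and two of
  them differ by \<open>(j - i) * n!\<close> with \<open>j - i\<close> a divisor of
  \<open>n!\<close>. So they are pairwise coprime without any search for primes.\<close>

definition base :: "nat \<Rightarrow> nat \<Rightarrow> nat" where
  "base n i = 1 + (i + 1) * fact n"

lemma base_ge_2: "2 \<le> base n i"
proof -
  have "1 * 1 \<le> (i + 1) * fact n" by (intro mult_le_mono) (simp_all add: fact_ge_1 del: One_nat_def)
  then show ?thesis unfolding base_def by linarith
qed

lemma coprime_base:
  assumes "i < j" "j < n"
  shows "coprime (base n i) (base n j)"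
proof (rule coprimeI)
  fix g assume g: "g dvd base n i" "g dvd base n j"
  have cop: "coprime g (fact n)"
  proof (rule coprimeI)
    fix h :: nat assume "h dvd g" "h dvd fact n"
    then have "h dvd 1 + (i + 1) * fact n" "h dvd (i + 1) * fact n"
      using g by (auto simp: base_def intro: dvd_trans)
    then have "h dvd 1" using dvd_add_left_iff by blast
    then show "is_unit h" by simp
  qed
  have "base n j - base n i = (j - i) * fact n"
    using assms by (simp add: base_def diff_mult_distrib)
  then have "g dvd (j - i) * fact n" using dvd_diff_nat[OF g(2,1)] by simp
  then have "g dvd j - i" using cop by (simp add: coprime_dvd_mult_left_iff)
  moreover have "j - i dvd fact n" using assms by (intro dvd_fact) auto
  ultimately have "g dvd fact n" by (rule dvd_trans)
  then show "is_unit g" using cop by (metis coprime_absorb_left)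
qed

definition node :: "nat \<Rightarrow> nat \<Rightarrow> nat list \<Rightarrow> nat" where
  "node n l v = (\<Prod>i<l. base n i ^ v ! i)"

lemma node_Suc: "node n (Suc l) v = node n l v * base n l ^ v ! l"
  by (simp add: node_def)

lemma coprime_base_node: "l < n \<Longrightarrow> coprime (base n l) (node n l v)"
  unfolding node_def by (intro prod_coprime_right coprime_power_right_iff[THEN iffD2] disjI1)
    (use coprime_base in \<open>auto simp: coprime_commute\<close>)

text \<open>The last base is coprime to the product of the others, so comparing divisibility by its
  powers determines the last exponent; then it is cancelled.\<close>

lemma node_inj:
  assumes "l \<le> n" "node n l v = node n l w" "i < l"
  shows "v ! i = w ! i"
  using assms
proof (induction l)
  case (Suc l)
  have le: "v ! l \<le> w ! l" if "node n (Suc l) v = node n (Suc l) w" for v w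
  proof -
    have "base n l ^ v ! l dvd node n l w * base n l ^ w ! l"
      using that by (metis node_Suc dvd_triv_right)
    moreover have "coprime (base n l ^ v ! l) (node n l w)"
      using coprime_base_node Suc.prems(1) by simp
    ultimately have "base n l ^ v ! l dvd base n l ^ w ! l"
      by (simp add: coprime_dvd_mult_right_iff)
    then show ?thesis using base_ge_2[of n l] by (metis power_dvd_imp_le Suc_1 Suc_le_lessD)
  qed
  have "v ! l = w ! l" using le[of v w] le[of w v] Suc.prems(2) by simp
  moreover have "node n l v = node n l w"
    using Suc.prems(2) base_ge_2[of n l] \<open>v ! l = w ! l\<close> by (simp add: node_Suc)
  ultimately show ?case using Suc by (cases "i = l") auto
qed simp

section \<open>Evaluation of Schubert polynomials\<close>

lemma of_int_times_zpoly: "of_int c * (p :: zpoly) = frag_cmul c p"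
proof (induction c rule: int_induct[where k = 0])
  case (step1 i)
  then show ?case by (simp add: distrib_right frag_cmul_distrib)
next
  case (step2 i)
  then show ?case by (simp add: left_diff_distrib frag_cmul_diff_distrib)
qed simp

lemma eval_poly_superset:
  assumes "finite A" "keys p \<subseteq> A"
  shows "eval_poly p x = (\<Sum>e\<in>A. lookup p e * (\<Prod>i\<in>keys e. x i ^ lookup e i))"
  unfolding eval_poly_def using assms by (intro sum.mono_neutral_left) (auto simp: in_keys_iff)

lemma eval_poly_0 [simp]: "eval_poly 0 x = 0"
  by (simp add: eval_poly_def)

lemma eval_poly_add: "eval_poly (p + q) x = eval_poly p x + eval_poly q x"
  using eval_poly_superset[of "keys p \<union> keys q" p x] eval_poly_superset[of "keys p \<union> keys q" q x]
    eval_poly_superset[of "keys p \<union> keys q" "p + q" x] keys_add[of p q]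
  by (simp add: lookup_add distrib_right sum.distrib)

lemma eval_poly_frag_cmul: "eval_poly (frag_cmul c p) x = c * eval_poly p x"
  using eval_poly_superset[of "keys p" p x] eval_poly_superset[of "keys p" "frag_cmul c p" x] keys_cmul[of c p]
  by (simp add: sum_distrib_left mult.assoc)

lemma eval_poly_sum: "eval_poly (\<Sum>v\<in>S. g v) x = (\<Sum>v\<in>S. eval_poly (g v) x)"
  by (induction S rule: infinite_finite_induct) (simp_all add: eval_poly_add)

lemma eval_list_linear_combination:
  "eval_list (\<Sum>v\<in>S. of_int (a v) * p v) x = (\<Sum>v\<in>S. a v * eval_list (p v) x)"
  unfolding eval_list_def of_int_times_zpoly by (simp add: eval_poly_sum eval_poly_frag_cmul)

lemma eval_list_eq:
  assumes "p \<in> zpolys n" "length x = n"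
  shows "eval_list p x = (\<Sum>e\<in>keys p. lookup p e * (\<Prod>i<n. x ! i ^ lookup e i))"
  unfolding eval_list_def eval_poly_def
proof (intro sum.cong refl arg_cong2[where f = times])
  fix e assume "e \<in> keys p"
  then have "keys e \<subseteq> {..<n}" using assms(1) by (auto simp: zpolys_def)
  then show "(\<Prod>i\<in>keys e. (if i < length x then x ! i else 0) ^ lookup e i) = (\<Prod>i<n. x ! i ^ lookup e i)"
  proof (intro prod.mono_neutral_cong_left)
    show "(if i < length x then x ! i else 0) ^ lookup e i = x ! i ^ lookup e i" if "i \<in> keys e" for i
      using that \<open>keys e \<subseteq> {..<n}\<close> assms(2) by auto
  qed (auto simp: in_keys_iff)
qed

lemma total_degree_ge: "e \<in> keys p \<Longrightarrow> (\<Sum>i\<in>keys e. lookup e i) \<le> total_degree p"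
  unfolding total_degree_def by (intro Max_ge) auto

lemma weight_sum_eq_sum_keys: "keys e \<subseteq> {..<n} \<Longrightarrow> weight_sum n e = (\<Sum>i\<in>keys e. lookup e i)"
  unfolding weight_sum_def by (intro sum.mono_neutral_right) (auto simp: in_keys_iff)

abbreviation code_of :: "nat list \<Rightarrow> code" where
  "code_of \<equiv> Poly_Mapping.nth"

lemma lookup_code_of: "lookup (code_of v) i = (if i < length v then v ! i else 0)"
  by (simp add: nth_default_def)

lemma keys_code_of: "keys (code_of v) \<subseteq> {..<length v}"
  unfolding keys_subset_iff by (simp add: lookup_code_of del: lookup_nth)

lemma code_of_inject: "length v = length w \<Longrightarrow> code_of v = code_of w \<longleftrightarrow> v = w"
proof
  assume len: "length v = length w" and eq: "code_of v = code_of w"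
  have "v ! i = w ! i" if "i < length v" for i
    using arg_cong[OF eq, of "\<lambda>e. lookup e i"] that len by (simp add: lookup_code_of del: lookup_nth)
  then show "v = w" using len by (intro nth_equalityI) auto
qed simp

lemma weight_sum_code_of: "length v = n \<Longrightarrow> weight_sum n (code_of v) = sum_list v"
  unfolding weight_sum_def by (simp add: lookup_code_of sum_list_sum_nth lessThan_atLeast0 del: lookup_nth)

lemma expo_weight_code_of:
  "length v = n \<Longrightarrow> expo_weight n (weight N q) (code_of v) = code_weight N q n v"
  unfolding expo_weight_def code_weight_def by (simp add: lookup_code_of del: lookup_nth)

lemma schubert_in_zpolys: "length v = n \<Longrightarrow> schubert_list v \<in> zpolys n"
  using homogeneous_schubert[OF keys_code_of[of v]] by (auto simp: zpolys_def homogeneous_def)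

definition sample_point :: "nat \<Rightarrow> nat \<Rightarrow> nat \<Rightarrow> nat \<Rightarrow> nat \<Rightarrow> nat list" where
  "sample_point n N q k j = map (\<lambda>i. base n i ^ k * j ^ weight N q i) [0..<n]"

lemma length_sample_point [simp]: "length (sample_point n N q k j) = n"
  by (simp add: sample_point_def)

lemma prod_sample_point:
  "(\<Prod>i<n. map int (sample_point n N q k j) ! i ^ lookup e i)
   = (\<Prod>i<n. int (base n i) ^ lookup e i) ^ k * int j ^ expo_weight n (weight N q) e"
proof -
  have "(\<Prod>i<n. map int (sample_point n N q k j) ! i ^ lookup e i)
      = (\<Prod>i<n. (int (base n i) ^ lookup e i) ^ k * int j ^ (weight N q i * lookup e i))"
    by (intro prod.cong refl) (simp add: sample_point_def power_mult_distrib flip: power_mult, simp add: mult.commute)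
  also have "\<dots> = (\<Prod>i<n. int (base n i) ^ lookup e i) ^ k * int j ^ expo_weight n (weight N q) e"
    unfolding prod.distrib expo_weight_def power_sum prod_power_distrib ..
  finally show ?thesis .
qed

text \<open>
  The alternating sum annihilates all powers of \<open>j\<close> below \<open>E\<close>, so that only the leading monomial
  of a Schubert polynomial of weight exactly \<open>E\<close> survives.
\<close>

lemma alternating_sum_schubert:
  assumes v: "length v = n" and q: "0 < q" and E: "code_weight N q n v \<le> E"
  shows "(\<Sum>j\<le>E. (-1) ^ j * int (E choose j) * eval_list (schubert_list v) (map int (sample_point n N q k j)))
    = (if code_weight N q n v = E then alternating_sum E E * int (node n n v) ^ k else 0)"
proof -
  let ?p = "schubert_list v" and ?wt = "expo_weight n (weight N q)"
  let ?b = "\<lambda>e. \<Prod>i<n. int (base n i) ^ lookup e i"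
  have kv: "keys (code_of v) \<subseteq> {..<n}" using keys_code_of[of v] v by simp
  have self: "lookup ?p (code_of v) = 1"
    by (rule lookup_schubert_self[OF kv, of "weight N q"]) (use weight_strict_mono q in blast)
  have less: "?wt e < code_weight N q n v" if "e \<in> keys ?p" "e \<noteq> code_of v" for e
    using expo_weight_less[OF kv, of "weight N q" e] weight_strict_mono q that expo_weight_code_of[OF v] by metis
  have "(\<Sum>j\<le>E. (-1) ^ j * int (E choose j) * eval_list ?p (map int (sample_point n N q k j)))
      = (\<Sum>j\<le>E. \<Sum>e\<in>keys ?p. lookup ?p e * ?b e ^ k * ((-1) ^ j * int (E choose j) * int j ^ ?wt e))"
    by (intro sum.cong refl)
       (simp only: eval_list_eq[OF schubert_in_zpolys[OF v]] length_map length_sample_point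
         prod_sample_point sum_distrib_left, simp only: mult_ac)
  also have "\<dots> = (\<Sum>e\<in>keys ?p. lookup ?p e * ?b e ^ k * alternating_sum E (?wt e))"
    unfolding alternating_sum_def by (subst sum.swap) (simp only: sum_distrib_left)
  also have "\<dots> = (\<Sum>e\<in>{code_of v}. lookup ?p e * ?b e ^ k * alternating_sum E (?wt e))"
  proof (rule sum.mono_neutral_right)
    show "\<forall>e\<in>keys ?p - {code_of v}. lookup ?p e * ?b e ^ k * alternating_sum E (?wt e) = 0"
    proof
      fix e assume "e \<in> keys ?p - {code_of v}"
      then have "?wt e < E" using less[of e] E by simp
      then show "lookup ?p e * ?b e ^ k * alternating_sum E (?wt e) = 0" by (simp add: alternating_sum_eq)
    qed
  qed (use self in \<open>auto simp: in_keys_iff simp del: lookup_nth\<close>)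
  also have "\<dots> = ?b (code_of v) ^ k * alternating_sum E (code_weight N q n v)"
    using self expo_weight_code_of[OF v] by simp
  also have "?b (code_of v) = int (node n n v)"
    unfolding node_def using v by (simp add: lookup_code_of del: lookup_nth)
  finally show ?thesis using E by (auto simp: alternating_sum_eq mult.commute)
qed

text \<open>The bound of \<open>norm1_schubert\<close> for \<open>K = n + d\<close>: entries are at
  most \<open>d\<close> and positions are below \<open>n\<close>. The exponent is weakened to the
  full \<open>n * (n + d)\<close>.\<close>

definition schubert_norm_bound :: "nat \<Rightarrow> nat \<Rightarrow> nat" where
  "schubert_norm_bound n d = (n * (n + d)) ^ (n * (n + d))"

lemma norm1_schubert_list:
  assumes "length v = n" "sum_list v \<le> d"
  shows "norm1 (schubert_list v) \<le> int (schubert_norm_bound n d)"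
proof (cases "n = 0")
  case True
  then have "schubert_list v = 1" using assms by simp
  then show ?thesis using True norm1_monomial[of 0] by (simp add: schubert_norm_bound_def)
next
  case False
  have cb: "code_bounded n (n + d) (code_of v)"
    unfolding code_bounded_def
  proof (intro conjI allI impI)
    fix i assume "i < n"
    then have "v ! i \<le> d" using assms elem_le_sum_list[of i v] by simp
    then show "lookup (code_of v) i + i \<le> n + d" using \<open>i < n\<close> by (simp add: lookup_code_of del: lookup_nth)
  qed (use keys_code_of[of v] assms in simp)
  have "norm1 (schubert_list v) \<le> int (n * (n + d)) ^ (n * (n + d) - weight_sum n (code_of v))"
    by (rule norm1_schubert[OF cb])
  also have "\<dots> \<le> int (n * (n + d)) ^ (n * (n + d))"
    using False by (intro power_increasing) (simp_all add: Suc_le_eq flip: of_nat_Suc of_nat_add of_nat_mult)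
  finally show ?thesis by (simp add: schubert_norm_bound_def)
qed

lemma schubert_value_bound:
  assumes v: "length v = n" "sum_list v \<le> d" and x: "length x = n" "\<And>i. i < n \<Longrightarrow> x ! i \<le> M" and "1 \<le> M"
  shows "\<bar>eval_list (schubert_list v) (map int x)\<bar> \<le> int (schubert_norm_bound n d * M ^ d)"
proof -
  let ?p = "schubert_list v"
  have "\<bar>eval_list ?p (map int x)\<bar> \<le> (\<Sum>e\<in>keys ?p. \<bar>lookup ?p e\<bar> * (\<Prod>i<n. int (x ! i) ^ lookup e i))"
    unfolding eval_list_eq[OF schubert_in_zpolys[OF v(1)], of "map int x", simplified length_map, OF x(1)]
    by (rule order_trans[OF sum_abs]) (use x(1) in \<open>auto intro!: sum_mono simp: abs_mult abs_of_nonneg[OF prod_nonneg]\<close>)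
  also have "\<dots> \<le> (\<Sum>e\<in>keys ?p. \<bar>lookup ?p e\<bar> * int M ^ d)"
  proof (intro sum_mono mult_left_mono)
    fix e assume "e \<in> keys ?p"
    then have "weight_sum n e = sum_list v"
      using homogeneous_schubert[OF keys_code_of[of v]] v(1) weight_sum_code_of[OF v(1)]
      by (auto simp: homogeneous_def)
    then have deg: "(\<Sum>i<n. lookup e i) \<le> d" using v(2) by (simp add: weight_sum_def)
    have "(\<Prod>i<n. int (x ! i) ^ lookup e i) \<le> (\<Prod>i<n. int M ^ lookup e i)"
      using x(2) by (intro prod_mono) (auto intro!: power_mono)
    also have "\<dots> = int M ^ (\<Sum>i<n. lookup e i)" by (simp add: power_sum)
    also have "\<dots> \<le> int M ^ d" using deg \<open>1 \<le> M\<close> by (intro power_increasing) auto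
    finally show "(\<Prod>i<n. int (x ! i) ^ lookup e i) \<le> int M ^ d" .
  qed simp
  also have "\<dots> = norm1 ?p * int M ^ d" by (simp add: norm1_def sum_distrib_right)
  also have "\<dots> \<le> int (schubert_norm_bound n d) * int M ^ d"
    using norm1_schubert_list[OF v] by (intro mult_right_mono) auto
  finally show ?thesis by simp
qed

section \<open>Sparse expansions and their weight levels\<close>

locale sparse_schubert =
  fixes n d m :: nat and f :: zpoly and \<Gamma> :: "nat list set" and a :: "nat list \<Rightarrow> int"
  assumes n_pos: "0 < n" and d_pos: "0 < d" and m_pos: "0 < m" and f_zpolys: "f \<in> zpolys n"
    and finite_\<Gamma>: "finite \<Gamma>" and length_\<Gamma>: "\<And>v. v \<in> \<Gamma> \<Longrightarrow> length v = n"
    and a_nonzero: "\<And>v. v \<in> \<Gamma> \<Longrightarrow> a v \<noteq> 0"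
    and f_eq: "f = (\<Sum>v\<in>\<Gamma>. of_int (a v) * schubert_list v)"
    and degree_f: "total_degree f \<le> d" and card_\<Gamma>: "card \<Gamma> \<le> m"
begin

abbreviation F :: "int list \<Rightarrow> int" where "F \<equiv> eval_list f"
abbreviation Y :: "nat list \<Rightarrow> nat list \<Rightarrow> int" where "Y \<equiv> \<lambda>v x. eval_list (schubert_list v) (map int x)"

lemma F_eq: "F x = (\<Sum>v\<in>\<Gamma>. a v * eval_list (schubert_list v) x)"
  unfolding f_eq by (rule eval_list_linear_combination)

text \<open>The promise bounds the degree of \<open>f\<close>, whose terms might cancel. Among the
  codes with the same entry sum as \<open>v\<close>, one of maximal weight has a leading monomial
  that no other term contains: other degrees are excluded by homogeneity, equal degrees by weight.
  That monomial survives in \<open>f\<close>.\<close>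

lemma sum_list_le_d:
  assumes "v \<in> \<Gamma>"
  shows "sum_list v \<le> d"
proof -
  define S where "S = {w \<in> \<Gamma>. sum_list w = sum_list v}"
  let ?wt = "\<lambda>w. expo_weight n (\<lambda>i. i) (code_of w)"
  have S: "finite S" "v \<in> S" using finite_\<Gamma> assms by (auto simp: S_def)
  then have "Max (?wt ` S) \<in> ?wt ` S" by (intro Max_in) auto
  then obtain u where u: "u \<in> S" "?wt u = Max (?wt ` S)" by auto
  have umax: "?wt w \<le> ?wt u" if "w \<in> S" for w using u(2) S(1) that by simp
  have u\<Gamma>: "u \<in> \<Gamma>" "length u = n" "sum_list u = sum_list v" using u(1) length_\<Gamma> by (auto simp: S_def)
  have ku: "keys (code_of u) \<subseteq> {..<n}" using keys_code_of[of u] u\<Gamma> by simp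
  have other: "lookup (schubert_list w) (code_of u) = 0" if w: "w \<in> \<Gamma>" "w \<noteq> u" for w
  proof (rule ccontr)
    assume "\<not> ?thesis"
    then have mem: "code_of u \<in> keys (schubert_list w)" by (simp only: in_keys_iff not_False_eq_True)
    have lw: "length w = n" and kw: "keys (code_of w) \<subseteq> {..<n}"
      using length_\<Gamma>[OF w(1)] keys_code_of[of w] by simp_all
    have "weight_sum n (code_of u) = weight_sum n (code_of w)"
      using homogeneous_schubert[OF kw] mem by (auto simp: homogeneous_def)
    then have "w \<in> S" using u\<Gamma> w(1) lw by (simp add: S_def weight_sum_code_of)
    moreover have "?wt u < ?wt w"
      using expo_weight_less[OF kw, of "\<lambda>i. i" "code_of u"] mem w(2) code_of_inject[of u w] u\<Gamma> lw by auto
    ultimately show False using umax by (simp add: not_le[symmetric])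
  qed
  have "lookup f (code_of u) = (\<Sum>w\<in>\<Gamma>. a w * lookup (schubert_list w) (code_of u))"
    unfolding f_eq of_int_times_zpoly lookup_sum by (simp del: lookup_nth)
  also have "\<dots> = a u * lookup (schubert_list u) (code_of u)"
    using other by (subst sum.remove[OF finite_\<Gamma> u\<Gamma>(1)]) simp
  also have "\<dots> = a u" using lookup_schubert_self[OF ku, of "\<lambda>i. i"] by simp
  finally have "code_of u \<in> keys f" using a_nonzero[OF u\<Gamma>(1)] by (simp only: in_keys_iff not_False_eq_True)
  then have "(\<Sum>i\<in>keys (code_of u). lookup (code_of u) i) \<le> total_degree f"
    by (rule total_degree_ge)
  also have "(\<Sum>i\<in>keys (code_of u). lookup (code_of u) i) = weight_sum n (code_of u)"
    by (rule weight_sum_eq_sum_keys[OF ku, symmetric])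
  finally show ?thesis using degree_f u\<Gamma> by (simp add: weight_sum_code_of)
qed

lemma nth_le_d: "v \<in> \<Gamma> \<Longrightarrow> i < n \<Longrightarrow> v ! i \<le> d"
  using sum_list_le_d[of v] elem_le_sum_list[of i v] length_\<Gamma>[of v] by simp

abbreviation (input) cw :: "nat \<Rightarrow> nat list \<Rightarrow> nat" where "cw q v \<equiv> code_weight (d + 1) q n v"

lemma cw_less:
  assumes "v \<in> \<Gamma>" "0 < q"
  shows "cw q v \<le> d * n * q"
proof -
  have "cw q v \<le> (\<Sum>i<n. (n * q) * v ! i)"
    unfolding code_weight_def using weight_less[OF assms(2)] by (intro sum_mono mult_right_mono) (auto simp: less_imp_le)
  also have "\<dots> = n * q * sum_list v"
    using length_\<Gamma>[OF assms(1)] by (simp add: sum_list_sum_nth lessThan_atLeast0 sum_distrib_left)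
  also have "\<dots> \<le> n * q * d" using sum_list_le_d[OF assms(1)] by simp
  finally show ?thesis by (simp add: mult_ac)
qed

definition coeff_sum :: nat where "coeff_sum = nat (\<Sum>v\<in>\<Gamma>. \<bar>a v\<bar>)"

definition residual :: "nat list set \<Rightarrow> nat list \<Rightarrow> int" where
  "residual S x = (\<Sum>v\<in>S. a v * Y v x)"

lemma F_residual: "F (map int x) = residual \<Gamma> x"
  by (simp add: F_eq residual_def)

lemma residual_bound:
  assumes "S \<subseteq> \<Gamma>" "length x = n" "\<And>i. i < n \<Longrightarrow> x ! i \<le> M" "1 \<le> M"
  shows "\<bar>residual S x\<bar> \<le> int (coeff_sum * (schubert_norm_bound n d * M ^ d))"
proof -
  have "\<bar>residual S x\<bar> \<le> (\<Sum>v\<in>S. \<bar>a v\<bar> * int (schubert_norm_bound n d * M ^ d))"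
    unfolding residual_def
  proof (rule order_trans[OF sum_abs], rule sum_mono)
    fix v assume "v \<in> S"
    then have "v \<in> \<Gamma>" using assms(1) by auto
    then have "\<bar>Y v x\<bar> \<le> int (schubert_norm_bound n d * M ^ d)"
      using schubert_value_bound[OF length_\<Gamma> sum_list_le_d assms(2-4)] by blast
    then show "\<bar>a v * Y v x\<bar> \<le> \<bar>a v\<bar> * int (schubert_norm_bound n d * M ^ d)"
      unfolding abs_mult by (rule mult_left_mono) simp
  qed
  also have "\<dots> = (\<Sum>v\<in>S. \<bar>a v\<bar>) * int (schubert_norm_bound n d * M ^ d)" by (rule sum_distrib_right[symmetric])
  also have "\<dots> \<le> int coeff_sum * int (schubert_norm_bound n d * M ^ d)"
    unfolding coeff_sum_def using assms(1) finite_\<Gamma>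
    by (intro mult_right_mono) (auto intro!: sum_mono2 simp: sum_nonneg)
  finally show ?thesis by simp
qed

lemma abs_a_le: "v \<in> \<Gamma> \<Longrightarrow> \<bar>a v\<bar> \<le> int coeff_sum"
  unfolding coeff_sum_def using finite_\<Gamma> member_le_sum[of v \<Gamma> "\<lambda>v. \<bar>a v\<bar>"] by (simp add: sum_nonneg)

definition level :: "nat \<Rightarrow> nat \<Rightarrow> nat list set" where
  "level q E = {v \<in> \<Gamma>. cw q v = E}"

definition power_sum_at :: "nat \<Rightarrow> nat \<Rightarrow> nat \<Rightarrow> int" where
  "power_sum_at q E k = (\<Sum>v\<in>level q E. a v * int (node n n v) ^ k)"

lemma alternating_sum_residual:
  assumes "0 < q"
  shows "(\<Sum>j\<le>E. (-1) ^ j * int (E choose j) * residual {v \<in> \<Gamma>. cw q v \<le> E} (sample_point n (d + 1) q k j))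
    = alternating_sum E E * power_sum_at q E k"
proof -
  let ?S = "{v \<in> \<Gamma>. cw q v \<le> E}"
  have "(\<Sum>j\<le>E. (-1) ^ j * int (E choose j) * residual ?S (sample_point n (d + 1) q k j))
     = (\<Sum>v\<in>?S. a v * (\<Sum>j\<le>E. (-1) ^ j * int (E choose j) * Y v (sample_point n (d + 1) q k j)))"
    unfolding residual_def sum_distrib_left by (subst sum.swap) (simp only: mult_ac)
  also have "\<dots> = (\<Sum>v\<in>?S. if cw q v = E then alternating_sum E E * (a v * int (node n n v) ^ k) else 0)"
  proof (intro sum.cong refl)
    fix v assume "v \<in> ?S"
    then show "a v * (\<Sum>j\<le>E. (-1) ^ j * int (E choose j) * Y v (sample_point n (d + 1) q k j))
      = (if cw q v = E then alternating_sum E E * (a v * int (node n n v) ^ k) else 0)"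
      by (subst alternating_sum_schubert) (use assms length_\<Gamma> in auto)
  qed
  also have "\<dots> = (\<Sum>v\<in>level q E. alternating_sum E E * (a v * int (node n n v) ^ k))"
    using finite_\<Gamma> by (intro sum.mono_neutral_cong_right) (auto simp: level_def)
  finally show ?thesis by (simp add: power_sum_at_def sum_distrib_left)
qed

lemma finite_level: "finite (level q E)" and card_level: "card (level q E) \<le> m"
  using finite_\<Gamma> card_\<Gamma> card_mono[of \<Gamma> "level q E"] by (auto simp: level_def)

lemma inj_on_node_level: "inj_on (\<lambda>v. int (node n n v)) (level q E)"
proof (rule inj_onI)
  fix v w assume "v \<in> level q E" "w \<in> level q E" "int (node n n v) = int (node n n w)"
  then show "v = w"
    using node_inj[of n n v w] length_\<Gamma> by (intro nth_equalityI) (auto simp: level_def)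
qed

lemma level_empty:
  assumes "\<And>k. k \<le> m \<Longrightarrow> power_sum_at q E k = 0"
  shows "level q E = {}"
proof (rule ccontr)
  assume "level q E \<noteq> {}"
  then obtain v where v: "v \<in> level q E" by blast
  have "a v = 0"
    by (rule power_sums_zero_int[OF finite_level inj_on_node_level card_level _ v])
       (use assms in \<open>simp add: power_sum_at_def\<close>)
  then show False using a_nonzero v by (simp add: level_def)
qed

lemma level_singleton:
  assumes "power_sum_at q E 0 \<noteq> 0"
    and "\<And>k. k < m \<Longrightarrow> power_sum_at q E (Suc k) * power_sum_at q E 0 = power_sum_at q E k * power_sum_at q E 1"
  shows "\<exists>v. level q E = {v}"
  by (rule geometric_power_sums[OF finite_level inj_on_node_level card_level])
     (use assms a_nonzero in \<open>auto simp: level_def power_sum_at_def\<close>)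

lemma ex_good_modulus: "\<exists>q. 1 \<le> q \<and> q \<le> d * n * m * m + 2 \<and> inj_on (cw q) \<Gamma>"
  by (rule ex_separating_modulus) (use finite_\<Gamma> card_\<Gamma> length_\<Gamma> nth_le_d in auto)

end

section \<open>Cost of programs\<close>

lemma val_size_pos: "1 \<le> val_size v"
  by (cases v) simp_all

lemma floorlog_le: "x < 2 ^ k \<Longrightarrow> floorlog 2 x \<le> k"
  by (rule floorlog_leI) simp_all

lemma less_power_floorlog: "x < 2 ^ floorlog 2 x"
  using floorlog_bounds[of x 2] by (cases "x = 0") auto

lemma floorlog_int_mult:
  "floorlog 2 (nat \<bar>x * y\<bar>) \<le> floorlog 2 (nat \<bar>x\<bar>) + floorlog 2 (nat \<bar>y\<bar>)"
  unfolding abs_mult nat_mult_distrib[OF abs_ge_zero]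
  by (intro floorlog_le) (simp add: power_add mult_strict_mono less_power_floorlog)

lemma floorlog_int_add:
  assumes "\<bar>z\<bar> \<le> \<bar>x\<bar> + \<bar>y\<bar>"
  shows "floorlog 2 (nat \<bar>z\<bar>) \<le> floorlog 2 (nat \<bar>x\<bar>) + floorlog 2 (nat \<bar>y\<bar>) + 1"
proof (rule floorlog_le)
  let ?k = "floorlog 2 (nat \<bar>x\<bar>)" and ?l = "floorlog 2 (nat \<bar>y\<bar>)"
  have "nat \<bar>z\<bar> \<le> nat \<bar>x\<bar> + nat \<bar>y\<bar>" using assms by linarith
  also have "\<dots> < 2 ^ ?k + 2 ^ ?l" by (intro add_strict_mono less_power_floorlog)
  also have "\<dots> \<le> 2 ^ (?k + ?l) + 2 ^ (?k + ?l)" by (intro add_mono power_increasing) auto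
  finally show "nat \<bar>z\<bar> < 2 ^ (?k + ?l + 1)" by simp
qed

lemma floorlog_int_mono: "\<bar>x\<bar> \<le> \<bar>y\<bar> \<Longrightarrow> floorlog 2 (nat \<bar>x\<bar>) \<le> floorlog 2 (nat \<bar>y\<bar>)"
  by (intro floorlog_mono) simp

lemma floorlog_as_int: "Suc (floorlog 2 (nat \<bar>as_int v\<bar>)) \<le> val_size v"
  by (cases v) (simp_all add: floorlog_def)

lemma sum_list_as_list: "Suc (sum_list (map val_size (as_list v))) \<le> val_size v"
  by (cases v) (simp_all)

text \<open>Sizes and costs relative to a common bound on the sizes of all registers.\<close>

fun size_factor :: "expr \<Rightarrow> nat" where
  "size_factor (Const v) = val_size v"
| "size_factor (Reg x) = 1"
| "size_factor (Add a b) = size_factor a + size_factor b"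
| "size_factor (Sub a b) = size_factor a + size_factor b"
| "size_factor (Mul a b) = size_factor a + size_factor b"
| "size_factor (Div a b) = size_factor a + size_factor b"
| "size_factor (Mod a b) = size_factor a + size_factor b"
| "size_factor (Less a b) = size_factor a + size_factor b"
| "size_factor (Equal a b) = size_factor a + size_factor b"
| "size_factor (Prepend a b) = size_factor a + size_factor b"
| "size_factor (Head a) = size_factor a"
| "size_factor (Tail a) = size_factor a"

fun cost_factor :: "expr \<Rightarrow> nat" where
  "cost_factor (Const v) = 1 + val_size v"
| "cost_factor (Reg x) = 2"
| "cost_factor (Add a b) = 1 + size_factor (Add a b) + cost_factor a + cost_factor b"
| "cost_factor (Sub a b) = 1 + size_factor (Sub a b) + cost_factor a + cost_factor b"
| "cost_factor (Mul a b) = 1 + size_factor (Mul a b) + cost_factor a + cost_factor b"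
| "cost_factor (Div a b) = 1 + size_factor (Div a b) + cost_factor a + cost_factor b"
| "cost_factor (Mod a b) = 1 + size_factor (Mod a b) + cost_factor a + cost_factor b"
| "cost_factor (Less a b) = 1 + size_factor (Less a b) + cost_factor a + cost_factor b"
| "cost_factor (Equal a b) = 1 + size_factor (Equal a b) + cost_factor a + cost_factor b"
| "cost_factor (Prepend a b) = 1 + size_factor (Prepend a b) + cost_factor a + cost_factor b"
| "cost_factor (Head a) = 1 + size_factor (Head a) + cost_factor a"
| "cost_factor (Tail a) = 1 + size_factor (Tail a) + cost_factor a"

text \<open>Rounding down may enlarge the absolute value of a negative quotient, but not beyond that
  of \<open>x\<close>. Division by zero gives 0.\<close>

lemma abs_div_le: "\<bar>x div y\<bar> \<le> \<bar>x :: int\<bar>"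
proof -
  have pos: "\<bar>x div y\<bar> \<le> \<bar>x\<bar>" if "0 < y" for x y :: int
  proof (cases "0 \<le> x")
    case True
    then have "0 \<le> x div y" "x div y \<le> x div 1"
      using that zdiv_mono2[of x 1 y] by (auto simp: pos_imp_zdiv_nonneg_iff)
    then show ?thesis by simp
  next
    case False
    then have "x div 1 \<le> x div y" "x div y < 0"
      using that zdiv_mono2_neg[of x 1 y] by (auto simp: pos_imp_zdiv_neg_iff)
    then show ?thesis by simp
  qed
  consider "y = 0" | "0 < y" | "0 < - y" by linarith
  then show ?thesis
  proof cases
    case 3
    then show ?thesis using pos[of "- y" "- x"] by simp
  qed (use pos in simp_all)
qed

lemma abs_mod_le: "\<bar>x mod y\<bar> \<le> \<bar>x\<bar> + \<bar>y :: int\<bar>"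
proof -
  consider "y = 0" | "0 < y" | "y < 0" by linarith
  then show ?thesis
  proof cases
    case 2
    then show ?thesis using pos_mod_bound[of y x] pos_mod_sign[of y x] by linarith
  next
    case 3
    then show ?thesis using neg_mod_bound[of y x] neg_mod_sign[of y x] by linarith
  qed simp
qed

text \<open>Sizes are subadditive: a carry bit, a truth value or a list header is paid for by the
  unit that every operand size contains.\<close>

lemma val_size_eval_binary:
  "val_size (eval (Add a b) s) \<le> val_size (eval a s) + val_size (eval b s)"
  "val_size (eval (Sub a b) s) \<le> val_size (eval a s) + val_size (eval b s)"
  "val_size (eval (Mul a b) s) \<le> val_size (eval a s) + val_size (eval b s)"
  "val_size (eval (Div a b) s) \<le> val_size (eval a s) + val_size (eval b s)"
  "val_size (eval (Mod a b) s) \<le> val_size (eval a s) + val_size (eval b s)"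
  "val_size (eval (Less a b) s) \<le> val_size (eval a s) + val_size (eval b s)"
  "val_size (eval (Equal a b) s) \<le> val_size (eval a s) + val_size (eval b s)"
  "val_size (eval (Prepend a b) s) \<le> val_size (eval a s) + val_size (eval b s)"
proof -
  note A = floorlog_as_int[of "eval a s"] and B = floorlog_as_int[of "eval b s"]
  let ?x = "as_int (eval a s)" and ?y = "as_int (eval b s)"
  show "val_size (eval (Add a b) s) \<le> val_size (eval a s) + val_size (eval b s)"
    using A B floorlog_int_add[OF abs_triangle_ineq[of ?x ?y]] by simp
  show "val_size (eval (Sub a b) s) \<le> val_size (eval a s) + val_size (eval b s)"
    using A B floorlog_int_add[OF abs_triangle_ineq4[of ?x ?y]] by simp
  show "val_size (eval (Mul a b) s) \<le> val_size (eval a s) + val_size (eval b s)"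
    using A B floorlog_int_mult[of ?x ?y] by simp
  show "val_size (eval (Div a b) s) \<le> val_size (eval a s) + val_size (eval b s)"
    using A B floorlog_int_mono[OF abs_div_le[of ?x ?y]] by simp
  show "val_size (eval (Mod a b) s) \<le> val_size (eval a s) + val_size (eval b s)"
    using A B floorlog_int_add[OF abs_mod_le[of ?x ?y]] by simp
  have bool: "val_size (val_of_bool c) \<le> 2" for c
    by (simp add: val_of_bool_def floorlog_def)
  show "val_size (eval (Less a b) s) \<le> val_size (eval a s) + val_size (eval b s)"
    "val_size (eval (Equal a b) s) \<le> val_size (eval a s) + val_size (eval b s)"
    using val_size_pos[of "eval a s"] val_size_pos[of "eval b s"]
    by (auto intro: order_trans[OF bool])
  show "val_size (eval (Prepend a b) s) \<le> val_size (eval a s) + val_size (eval b s)"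
    using sum_list_as_list[of "eval b s"] by simp
qed

lemma val_size_eval_unary:
  "val_size (eval (Head a) s) \<le> val_size (eval a s)"
  "val_size (eval (Tail a) s) \<le> val_size (eval a s)"
proof -
  have "val_size (eval (Head a) s) \<le> val_size (eval a s) \<and> val_size (eval (Tail a) s) \<le> val_size (eval a s)"
    using val_size_pos[of "eval a s"]
    by (cases "eval a s"; cases "as_list (eval a s)") (auto simp: floorlog_def)
  then show "val_size (eval (Head a) s) \<le> val_size (eval a s)"
    "val_size (eval (Tail a) s) \<le> val_size (eval a s)" by auto
qed

lemma val_size_eval:
  assumes "\<And>x. val_size (s x) \<le> S" "1 \<le> S"
  shows "val_size (eval e s) \<le> size_factor e * S"
proof (induction e)
  case (Const v)
  then show ?case using assms(2) by simp
next
  case (Reg x)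
  then show ?case using assms(1) by simp
qed ((rule order_trans, rule val_size_eval_binary val_size_eval_unary,
      simp only: size_factor.simps add_mult_distrib add_mono)+)

lemma cost_le:
  assumes "\<And>x. val_size (s x) \<le> S" "1 \<le> S"
  shows "cost e s \<le> cost_factor e * S"
proof (induction e)
  case (Const v)
  have "(1 + val_size v) * 1 \<le> (1 + val_size v) * S" by (rule mult_left_mono) (use assms(2) in auto)
  then show ?case by simp
next
  case (Reg x)
  then show ?case using assms(1)[of x] assms(2) by simp
qed (simp only: cost.simps cost_factor.simps add_mult_distrib mult_1 assms(2)
       val_size_eval[of s S, OF assms] add_mono)+

section \<open>Total correctness with a time budget\<close>

locale bounded_run =
  fixes n :: nat and F :: "int list \<Rightarrow> int" and Y :: "nat list \<Rightarrow> nat list \<Rightarrow> int" and S :: nat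
  assumes S_pos: "1 \<le> S"
begin

text \<open>The interpolation program only evaluates expressions of cost factor at most 100.\<close>

definition unit_cost :: nat where "unit_cost = 1 + 100 * S"

definition bounded :: "state \<Rightarrow> bool" where
  "bounded s \<longleftrightarrow> (\<forall>x. val_size (s x) \<le> S)"

lemma bounded_upd: "bounded s \<Longrightarrow> val_size v \<le> S \<Longrightarrow> bounded (s(x := v))"
  by (simp add: bounded_def)

text \<open>A predicate transformer for total correctness that also counts time in units and keeps
  all registers below \<open>S\<close>. Nesting it as a postcondition expresses sequential
  composition.\<close>

definition terminates :: "com \<Rightarrow> nat \<Rightarrow> (state \<Rightarrow> bool) \<Rightarrow> state \<Rightarrow> bool" where
  "terminates c N Q s \<longleftrightarrow> (\<exists>t s'. exec n F Y c s t s' \<and> t \<le> N * unit_cost \<and> bounded s' \<and> Q s')"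

lemma cost_bound: "bounded s \<Longrightarrow> cost_factor e \<le> K \<Longrightarrow> cost e s \<le> K * S"
proof -
  assume "bounded s" and K: "cost_factor e \<le> K"
  then have "cost e s \<le> cost_factor e * S" by (intro cost_le) (use S_pos in \<open>simp_all add: bounded_def\<close>)
  also have "\<dots> \<le> K * S" using K by (rule mult_le_mono1)
  finally show ?thesis .
qed

lemma cost_unit: "bounded s \<Longrightarrow> cost_factor e \<le> 100 \<Longrightarrow> 1 + cost e s \<le> unit_cost"
  unfolding unit_cost_def using cost_bound by fastforce

lemma terminates_mono:
  "terminates c N Q s \<Longrightarrow> (\<And>s'. bounded s' \<Longrightarrow> Q s' \<Longrightarrow> Q' s') \<Longrightarrow> N \<le> N' \<Longrightarrow> terminates c N' Q' s"
  unfolding terminates_def by (meson le_trans mult_le_mono1)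

lemma terminates_Skip: "bounded s \<Longrightarrow> Q s \<Longrightarrow> terminates Skip 1 Q s"
  unfolding terminates_def using exec.Skip[of n F Y s] by (fastforce simp: unit_cost_def)

lemma terminates_Assign:
  assumes "bounded s" "val_size (eval e s) \<le> S" "cost_factor e \<le> 100" "Q (s(x := eval e s))"
  shows "terminates (Assign x e) 1 Q s"
  unfolding terminates_def
  using exec.Assign[of n F Y x e s] cost_unit[OF assms(1,3)] bounded_upd[OF assms(1,2)] assms(4)
  by fastforce

lemma terminates_QueryPoly:
  assumes "bounded s" "eval e s = val_of_ints xs" "length xs = n" "val_size (Num (F xs)) \<le> S"
    "cost_factor e \<le> 100" "Q (s(x := Num (F xs)))"
  shows "terminates (QueryPoly x e) 1 Q s"
  unfolding terminates_def
  using exec.QueryPoly[OF assms(2,3), of F Y x] cost_unit[OF assms(1,5)] bounded_upd[OF assms(1,4)] assms(6)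
  by fastforce

text \<open>The two arguments share one unit of time, so each gets half of the cost factor.\<close>

lemma terminates_QuerySchubert:
  assumes "bounded s" "eval e1 s = val_of_nats v" "length v = n" "eval e2 s = val_of_nats xs" "length xs = n"
    "val_size (Num (Y v xs)) \<le> S" "cost_factor e1 \<le> 50" "cost_factor e2 \<le> 50" "Q (s(x := Num (Y v xs)))"
  shows "terminates (QuerySchubert x e1 e2) 1 Q s"
proof -
  have "1 + cost e1 s + cost e2 s \<le> 1 * unit_cost"
    using cost_bound[OF assms(1,7)] cost_bound[OF assms(1,8)] by (simp add: unit_cost_def)
  then show ?thesis
    unfolding terminates_def
    using exec.QuerySchubert[OF assms(2-5), of F Y x] bounded_upd[OF assms(1,6)] assms(9) by blast
qed

lemma terminates_Comp:
  assumes "terminates c1 N1 (terminates c2 N2 Q) s"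
  shows "terminates (Comp c1 c2) (N1 + N2 + 1) Q s"
proof -
  obtain t1 s1 t2 s2 where 1: "exec n F Y c1 s t1 s1" "t1 \<le> N1 * unit_cost"
    and 2: "exec n F Y c2 s1 t2 s2" "t2 \<le> N2 * unit_cost" "bounded s2" "Q s2"
    using assms unfolding terminates_def by blast
  have "1 \<le> unit_cost" by (simp add: unit_cost_def)
  then have "1 + t1 + t2 \<le> (N1 + N2 + 1) * unit_cost"
    unfolding add_mult_distrib using 1(2) 2(2) by linarith
  then show ?thesis unfolding terminates_def using exec.Comp[OF 1(1) 2(1)] 2 by blast
qed

lemma terminates_Cond:
  assumes "bounded s" "cost_factor b \<le> 100"
    and "eval b s \<noteq> Num 0 \<Longrightarrow> terminates c1 N1 Q s" "eval b s = Num 0 \<Longrightarrow> terminates c2 N2 Q s"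
  shows "terminates (Cond b c1 c2) (N1 + N2 + 1) Q s"
proof (cases "eval b s = Num 0")
  case True
  then obtain t s' where 2: "exec n F Y c2 s t s'" "t \<le> N2 * unit_cost" "bounded s'" "Q s'"
    using assms(4) unfolding terminates_def by blast
  have "1 + cost b s + t \<le> (N1 + N2 + 1) * unit_cost"
    unfolding add_mult_distrib using 2(2) cost_unit[OF assms(1,2)] by linarith
  then show ?thesis unfolding terminates_def using exec.CondFalse[OF True 2(1)] 2 by blast
next
  case False
  then obtain t s' where 1: "exec n F Y c1 s t s'" "t \<le> N1 * unit_cost" "bounded s'" "Q s'"
    using assms(3) unfolding terminates_def by blast
  have "1 + cost b s + t \<le> (N1 + N2 + 1) * unit_cost"
    unfolding add_mult_distrib using 1(2) cost_unit[OF assms(1,2)] by linarith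
  then show ?thesis unfolding terminates_def using exec.CondTrue[OF False 1(1)] 1 by blast
qed

text \<open>The invariant is indexed by the number of rounds, and the obligation
  \<open>i < k\<close> in the body forces termination. The budget pays for \<open>k\<close> bodies
  and \<open>k + 1\<close> evaluations of the guard.\<close>

lemma terminates_While:
  assumes "cost_factor b \<le> 100" "bounded s" "I 0 s"
    and body: "\<And>i s. i \<le> k \<Longrightarrow> bounded s \<Longrightarrow> I i s \<Longrightarrow> eval b s \<noteq> Num 0 \<Longrightarrow> i < k \<and> terminates c N (I (Suc i)) s"
    and exit: "\<And>i s. i \<le> k \<Longrightarrow> bounded s \<Longrightarrow> I i s \<Longrightarrow> eval b s = Num 0 \<Longrightarrow> Q s"
  shows "terminates (While b c) (k * (N + 1) + 1) Q s"
proof -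
  have "terminates (While b c) ((k - i) * (N + 1) + 1) Q s" if "i \<le> k" "bounded s" "I i s" for i s
    using that
  proof (induction "k - i" arbitrary: i s rule: less_induct)
    case less
    have cb: "1 + cost b s \<le> unit_cost" by (rule cost_unit[OF less.prems(2) assms(1)])
    show ?case
    proof (cases "eval b s = Num 0")
      case True
      have "1 + cost b s \<le> ((k - i) * (N + 1) + 1) * unit_cost"
        unfolding add_mult_distrib using cb by linarith
      then show ?thesis
        unfolding terminates_def using exec.WhileFalse[OF True] exit[OF less.prems True] less.prems by blast
    next
      case False
      have i: "i < k" "terminates c N (I (Suc i)) s" using body[OF less.prems False] by auto
      then obtain t1 s1 where 1: "exec n F Y c s t1 s1" "t1 \<le> N * unit_cost" "bounded s1" "I (Suc i) s1"
        unfolding terminates_def by blast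
      have "terminates (While b c) ((k - Suc i) * (N + 1) + 1) Q s1"
        by (rule less.hyps) (use i 1 in auto)
      then obtain t2 s2 where 2: "exec n F Y (While b c) s1 t2 s2"
        "t2 \<le> ((k - Suc i) * (N + 1) + 1) * unit_cost" "bounded s2" "Q s2"
        unfolding terminates_def by blast
      have eq: "(k - i) * (N + 1) + 1 = (N + 1) + ((k - Suc i) * (N + 1) + 1)"
        using i(1) by (metis Suc_diff_Suc add.assoc mult_Suc)
      have "1 + cost b s + t1 + t2 \<le> ((k - i) * (N + 1) + 1) * unit_cost"
        unfolding eq add_mult_distrib[of "N + 1"] add_mult_distrib[of N 1] using 1(2) 2(2) cb by linarith
      then show ?thesis unfolding terminates_def using exec.WhileTrue[OF False 1(1) 2(1)] 2 by blast
    qed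
  qed
  from this[of 0 s] assms show ?thesis by simp
qed

end

section \<open>The interpolation program\<close>

abbreviation Seq :: "com \<Rightarrow> com \<Rightarrow> com" (infixr ";;" 60) where "c1 ;; c2 \<equiv> Comp c1 c2"
abbreviation Lit :: "int \<Rightarrow> expr" where "Lit i \<equiv> Const (Num i)"
abbreviation Nil_expr :: expr where "Nil_expr \<equiv> Const (Lst [])"
abbreviation Nonempty :: "expr \<Rightarrow> expr" where "Nonempty e \<equiv> Less (Equal e Nil_expr) (Lit 1)"

text \<open>
  Registers: \<open>p\<close> and \<open>c\<close> hold the bases and the weights in reverse order, so that building the point
  \<open>P\<close> by prepending restores the order of the variables. \<open>R\<close> is the value at \<open>P\<close> of the part of the
  polynomial not yet in \<open>out\<close>; \<open>A\<close> and \<open>W\<close> are the alternating sums of \<open>R\<close> and of \<open>j ^ E\<close>, with the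
  signed binomial coefficient in \<open>C\<close>. For the sequence of the \<open>A\<close> in \<open>k\<close>, the registers \<open>x\<close>, \<open>y\<close>, \<open>z\<close>
  hold its first, second and latest member, \<open>h\<close> is set once some member is nonzero, and \<open>l\<close> is cleared
  once the sequence fails to be geometric. \<open>o\<close> is cleared if the modulus \<open>q\<close> does not separate the codes.
\<close>

definition pow_body :: com where
  "pow_body = Assign ''r'' (Mul (Reg ''r'') (Reg ''b'')) ;; Assign ''e'' (Sub (Reg ''e'') (Lit 1))"

definition pow_com :: com where
  "pow_com = Assign ''r'' (Lit 1) ;; While (Less (Lit 0) (Reg ''e'')) pow_body"

definition factorial_body :: com where
  "factorial_body = Assign ''g'' (Mul (Reg ''g'') (Reg ''i'')) ;; Assign ''i'' (Sub (Reg ''i'') (Lit 1))"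

definition bases_body :: com where
  "bases_body = Assign ''i'' (Add (Reg ''i'') (Lit 1)) ;;
     Assign ''p'' (Prepend (Add (Lit 1) (Mul (Reg ''i'') (Reg ''g''))) (Reg ''p''))"

definition bases_com :: com where
  "bases_com = Assign ''g'' (Lit 1) ;; Assign ''i'' (Reg ''n'') ;;
     While (Less (Lit 0) (Reg ''i'')) factorial_body ;;
     Assign ''p'' Nil_expr ;; Assign ''i'' (Lit 0) ;; While (Less (Reg ''i'') (Reg ''n'')) bases_body"

definition weights_body :: com where
  "weights_body =
     Assign ''c'' (Prepend (Add (Mul (Reg ''i'') (Reg ''q'')) (Mod (Reg ''u'') (Reg ''q''))) (Reg ''c'')) ;;
     Assign ''u'' (Mul (Reg ''u'') (Add (Reg ''d'') (Lit 1))) ;; Assign ''i'' (Add (Reg ''i'') (Lit 1))"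

definition weights_com :: com where
  "weights_com = Assign ''c'' Nil_expr ;; Assign ''i'' (Lit 0) ;; Assign ''u'' (Lit 1) ;;
     While (Less (Reg ''i'') (Reg ''n'')) weights_body"

definition point_body2 :: com where
  "point_body2 =
     Assign ''P'' (Prepend (Mul (Reg ''D'') (Reg ''r'')) (Reg ''P'')) ;;
     Assign ''X'' (Tail (Reg ''X'')) ;; Assign ''Z'' (Tail (Reg ''Z''))"

definition point_body1 :: com where
  "point_body1 =
     Assign ''D'' (Reg ''r'') ;; Assign ''b'' (Reg ''j'') ;; Assign ''e'' (Head (Reg ''Z'')) ;; pow_com ;; point_body2"

definition point_body :: com where
  "point_body = Assign ''b'' (Head (Reg ''X'')) ;; Assign ''e'' (Reg ''k'') ;; pow_com ;; point_body1"

definition point_com :: com where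
  "point_com = Assign ''P'' Nil_expr ;; Assign ''X'' (Reg ''p'') ;; Assign ''Z'' (Reg ''c'') ;;
     While (Nonempty (Reg ''X'')) point_body"

definition residual_body :: com where
  "residual_body =
     QuerySchubert ''V'' (Head (Head (Reg ''L''))) (Reg ''P'') ;;
     Assign ''R'' (Sub (Reg ''R'') (Mul (Head (Tail (Head (Reg ''L'')))) (Reg ''V''))) ;;
     Assign ''L'' (Tail (Reg ''L''))"

definition residual_com :: com where
  "residual_com = QueryPoly ''R'' (Reg ''P'') ;; Assign ''L'' (Reg ''out'') ;;
     While (Nonempty (Reg ''L'')) residual_body"

definition sample_body3 :: com where
  "sample_body3 =
     Assign ''W'' (Add (Reg ''W'') (Mul (Reg ''C'') (Reg ''r''))) ;;
     Assign ''C'' (Div (Mul (Sub (Lit 0) (Reg ''C'')) (Sub (Reg ''E'') (Reg ''j''))) (Add (Reg ''j'') (Lit 1))) ;;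
     Assign ''j'' (Add (Reg ''j'') (Lit 1))"

definition sample_body2 :: com where
  "sample_body2 =
     Assign ''A'' (Add (Reg ''A'') (Mul (Reg ''C'') (Reg ''R''))) ;;
     Assign ''b'' (Reg ''j'') ;; Assign ''e'' (Reg ''E'') ;; pow_com ;; sample_body3"

definition sample_body1 :: com where
  "sample_body1 = residual_com ;; sample_body2"

definition sample_body :: com where
  "sample_body = point_com ;; sample_body1"

definition sample_com :: com where
  "sample_com = Assign ''A'' (Lit 0) ;; Assign ''W'' (Lit 0) ;; Assign ''C'' (Lit 1) ;; Assign ''j'' (Lit 0) ;;
     While (Less (Reg ''j'') (Add (Reg ''E'') (Lit 1))) sample_body"

definition collect_body4 :: com where
  "collect_body4 = Cond (Reg ''A'') (Assign ''h'' (Lit 1)) Skip ;;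
     Assign ''z'' (Reg ''A'') ;; Assign ''k'' (Add (Reg ''k'') (Lit 1))"

text \<open>The factor \<open>k\<close> disables the test in the round \<open>k = 0\<close>, when
  \<open>z\<close> and \<open>y\<close> have not yet been set for this level.\<close>

definition collect_body3 :: com where
  "collect_body3 = Cond (Mul (Reg ''k'') (Sub (Mul (Reg ''A'') (Reg ''x'')) (Mul (Reg ''z'') (Reg ''y''))))
     (Assign ''l'' (Lit 0)) Skip ;; collect_body4"

definition collect_body2 :: com where
  "collect_body2 = Cond (Equal (Reg ''k'') (Lit 1)) (Assign ''y'' (Reg ''A'')) Skip ;; collect_body3"

definition collect_body1 :: com where
  "collect_body1 = Cond (Equal (Reg ''k'') (Lit 0)) (Assign ''x'' (Reg ''A'')) Skip ;; collect_body2"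

definition collect_body :: com where
  "collect_body = sample_com ;; collect_body1"

definition collect_com :: com where
  "collect_com = Assign ''h'' (Lit 0) ;; Assign ''l'' (Lit 1) ;; Assign ''k'' (Lit 0) ;;
     While (Less (Reg ''k'') (Add (Reg ''m'') (Lit 1))) collect_body"

definition divide_body :: com where
  "divide_body = Assign ''B'' (Div (Reg ''B'') (Reg ''g'')) ;; Assign ''i'' (Add (Reg ''i'') (Lit 1))"

definition divide_com :: com where
  "divide_com = While (Equal (Mod (Reg ''B'') (Reg ''g'')) (Lit 0)) divide_body"

definition decode_body1 :: com where
  "decode_body1 = Assign ''v'' (Prepend (Reg ''i'') (Reg ''v'')) ;; Assign ''X'' (Tail (Reg ''X''))"

definition decode_body :: com where
  "decode_body = Assign ''g'' (Head (Reg ''X'')) ;; Assign ''i'' (Lit 0) ;; divide_com ;; decode_body1"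

definition digits_com :: com where
  "digits_com = While (Nonempty (Reg ''X'')) decode_body"

definition output_com :: com where
  "output_com = Assign ''out'' (Prepend (Prepend (Reg ''v'') (Prepend (Reg ''a'') Nil_expr)) (Reg ''out''))"

text \<open>For a level with one code, \<open>x = W * a\<close> and \<open>y = W * a * b\<close>, so
  \<open>x / W\<close> is the coefficient and \<open>y / x\<close> is the node.\<close>

definition decode_com :: com where
  "decode_com = Assign ''a'' (Div (Reg ''x'') (Reg ''W'')) ;; Assign ''B'' (Div (Reg ''y'') (Reg ''x'')) ;;
     Assign ''v'' Nil_expr ;; Assign ''X'' (Reg ''p'') ;; digits_com ;; output_com"

text \<open>The product of \<open>l\<close> and \<open>x\<close> demands both a geometric sequence
  and a nonzero first member, since the first member of a level with one code is a nonzero multiple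
  of its coefficient.\<close>

definition level_com1 :: com where
  "level_com1 = Cond (Reg ''h'') (Cond (Mul (Reg ''l'') (Reg ''x'')) decode_com (Assign ''o'' (Lit 0))) Skip"

definition level_com :: com where
  "level_com = collect_com ;; level_com1"

definition attempt_body1 :: com where
  "attempt_body1 = Assign ''E'' (Sub (Reg ''E'') (Lit 1))"

text \<open>After a collision the loop merely counts \<open>E\<close> down, which takes the place of
  an early exit.\<close>

definition attempt_body :: com where
  "attempt_body = Cond (Reg ''o'') level_com Skip ;; attempt_body1"

text \<open>No code can weigh more than the initial \<open>E\<close>. Level 0 is visited as well,
  since the zero code lies there.\<close>

definition attempt_com1 :: com where
  "attempt_com1 =
     Assign ''out'' Nil_expr ;; Assign ''o'' (Lit 1) ;; Assign ''E'' (Mul (Mul (Reg ''d'') (Reg ''n'')) (Reg ''q'')) ;;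
     While (Less (Lit (-1)) (Reg ''E'')) attempt_body"

definition attempt_com :: com where
  "attempt_com = Assign ''q'' (Add (Reg ''q'') (Lit 1)) ;; weights_com ;; attempt_com1"

text \<open>Registers other than the inputs start at 0, so the loop is entered and the first modulus
  tried is 1.\<close>

definition interpolation_com :: com where
  "interpolation_com = bases_com ;; While (Equal (Reg ''o'') (Lit 0)) attempt_com"

section \<open>Bounds on the values of the registers\<close>

context sparse_schubert
begin

definition q_max :: nat where "q_max = d * n * m * m + 2"
definition E_max :: nat where "E_max = d * n * q_max"
definition p_max :: nat where "p_max = base n n"
definition point_max :: nat where "point_max = p_max ^ m * E_max ^ (n * q_max)"
text \<open>The \<open>+ 1\<close> keeps the bound positive for empty \<open>\<Gamma>\<close> and
  makes it cover the value of a single Schubert polynomial.\<close>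

definition value_max :: nat where
  "value_max = (coeff_sum + 1) * (schubert_norm_bound n d * point_max ^ d)"
text \<open>One product above every integer that occurs in a register: counters, signed binomial
  coefficients and alternating sums, nodes, and powers of \<open>d + 1\<close>. Its factors are all
  at least 1, so it dominates each partial product.\<close>

definition int_max :: nat where
  "int_max = (E_max + 3) * 2 ^ E_max * value_max * E_max ^ E_max * p_max ^ d * (d + 1) ^ n"

end

section \<open>Register sizes during a run\<close>

locale algorithm_run = sparse_schubert +
  fixes \<beta> :: nat
  assumes int_max_less: "int_max < 2 ^ \<beta>"
begin

text \<open>The largest register is \<open>out\<close>, with up to \<open>m\<close> terms of
  \<open>n + 1\<close> integers, each of size at most \<open>\<beta> + 1\<close>. The added 2s pay
  for the list overhead.\<close>

definition S :: nat where "S = (n + 2) * (m + 2) * (\<beta> + 2)"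

sublocale bounded_run n F Y S
  by unfold_locales (simp add: S_def)

lemma q_max_ge: "2 \<le> q_max" by (simp add: q_max_def)

lemma counters_le_E_max: "q_max \<le> E_max" "n * q_max \<le> E_max" "d * q_max \<le> E_max" "m \<le> E_max" "n \<le> E_max" "d \<le> E_max" "1 \<le> E_max"
proof -
  have "1 * (n * q_max) \<le> d * (n * q_max)" using d_pos by (intro mult_le_mono1) simp
  then show n: "n * q_max \<le> E_max" by (simp add: E_max_def mult.assoc)
  have "1 * (d * q_max) \<le> n * (d * q_max)" using n_pos by (intro mult_le_mono1) simp
  then show d: "d * q_max \<le> E_max" by (simp add: E_max_def mult_ac)
  have "q_max \<le> n * q_max" using n_pos by (cases n) auto
  with n show q: "q_max \<le> E_max" by (rule le_trans[rotated])
  show "n \<le> E_max" by (rule le_trans[OF _ n]) (use q_max_ge in simp)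
  show "d \<le> E_max" by (rule le_trans[OF _ d]) (use q_max_ge in simp)
  have "1 * m \<le> (d * n * m) * m" using d_pos n_pos m_pos by (intro mult_le_mono1) simp
  then have "m \<le> q_max" unfolding q_max_def by linarith
  with q show "m \<le> E_max" by simp
  show "1 \<le> E_max" using q q_max_ge by simp
qed

lemma factors_pos: "0 < p_max" "0 < point_max" "0 < value_max" "0 < E_max ^ E_max" "0 < schubert_norm_bound n d"
proof -
  show p: "0 < p_max" using base_ge_2[of n n] by (simp add: p_max_def)
  have E: "0 < E_max" using counters_le_E_max by simp
  then show "0 < E_max ^ E_max" by simp
  show pt: "0 < point_max" using p E by (simp add: point_max_def)
  show nb: "0 < schubert_norm_bound n d" using n_pos by (simp add: schubert_norm_bound_def)
  show "0 < value_max" using pt nb by (simp add: value_max_def)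
qed

lemma int_max_ge:
  shows counter_le_int_max: "E_max + 3 \<le> int_max"
    and alternating_le_int_max: "(E_max + 1) * (2 ^ E_max * value_max) \<le> int_max"
      "(E_max + 1) * (2 ^ E_max * E_max ^ E_max) \<le> int_max"
    and node_le_int_max: "p_max ^ d \<le> int_max"
    and digit_le_int_max: "(d + 1) ^ n \<le> int_max"
proof -
  have le: "x * a1 * a2 * a3 * a4 * a5 \<le> (E_max + 3) * 2 ^ E_max * value_max * E_max ^ E_max * p_max ^ d * (d + 1) ^ n"
    if "x \<le> E_max + 3" "a1 \<le> 2 ^ E_max" "a2 \<le> value_max" "a3 \<le> E_max ^ E_max" "a4 \<le> p_max ^ d" "a5 \<le> (d + 1) ^ n"
    for x a1 a2 a3 a4 a5
    using that by (intro mult_le_mono)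
  have one: "1 \<le> (2::nat) ^ E_max" "1 \<le> value_max" "1 \<le> E_max ^ E_max" "1 \<le> p_max ^ d" "1 \<le> (d + 1) ^ n"
    using factors_pos by (simp_all add: Suc_le_eq)
  show "E_max + 3 \<le> int_max"
    using le[of "E_max + 3" 1 1 1 1 1] one unfolding int_max_def by simp
  have "(E_max + 1) * 2 ^ E_max * value_max * 1 * 1 * 1 \<le> int_max"
    unfolding int_max_def by (rule le) (use one in auto)
  then show "(E_max + 1) * (2 ^ E_max * value_max) \<le> int_max" by (simp only: mult_1_right mult.assoc)
  have "(E_max + 1) * 2 ^ E_max * 1 * E_max ^ E_max * 1 * 1 \<le> int_max"
    unfolding int_max_def by (rule le) (use one in auto)
  then show "(E_max + 1) * (2 ^ E_max * E_max ^ E_max) \<le> int_max" by (simp only: mult_1_right mult.assoc)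
  show "p_max ^ d \<le> int_max"
    using le[of 1 1 1 1 "p_max ^ d" 1] one unfolding int_max_def by simp
  show "(d + 1) ^ n \<le> int_max"
    using le[of 1 1 1 1 1 "(d + 1) ^ n"] one unfolding int_max_def by simp
qed

lemma value_le_int_max: "value_max \<le> int_max"
proof -
  have "1 * (1 * value_max) \<le> (E_max + 1) * (2 ^ E_max * value_max)" by (intro mult_le_mono) auto
  then show ?thesis using int_max_ge(2) by simp
qed

lemma power_E_le_int_max: "E_max ^ E_max \<le> int_max"
proof -
  have "1 * (1 * E_max ^ E_max) \<le> (E_max + 1) * (2 ^ E_max * E_max ^ E_max)" by (intro mult_le_mono) auto
  then show ?thesis using int_max_ge(3) by simp
qed

lemma two_power_le_int_max: "2 ^ E_max \<le> int_max"
proof -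
  have "1 * (2 ^ E_max * 1) \<le> (E_max + 1) * (2 ^ E_max * value_max)"
    using factors_pos by (intro mult_le_mono) auto
  then show ?thesis using int_max_ge(2) by simp
qed

lemma point_le_int_max: "point_max \<le> int_max"
proof -
  have "point_max \<le> point_max ^ d" using factors_pos d_pos by (simp add: self_le_power Suc_le_eq)
  also have "1 * (1 * point_max ^ d) \<le> value_max"
    unfolding value_max_def using factors_pos by (intro mult_le_mono) auto
  finally show ?thesis using value_le_int_max by simp
qed

lemma power_bounds:
  shows "k \<le> m \<Longrightarrow> p_max ^ k \<le> point_max" "w \<le> n * q_max \<Longrightarrow> j \<le> E_max \<Longrightarrow> j ^ w \<le> point_max"
    "k \<le> m \<Longrightarrow> w \<le> n * q_max \<Longrightarrow> j \<le> E_max \<Longrightarrow> p_max ^ k * j ^ w \<le> point_max"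
proof -
  have E: "1 \<le> E_max" using counters_le_E_max by simp
  have p: "p_max ^ k \<le> p_max ^ m" if "k \<le> m" for k using that factors_pos by (intro power_increasing) auto
  have j: "j ^ w \<le> E_max ^ (n * q_max)" if "w \<le> n * q_max" "j \<le> E_max" for j w
    using that E power_mono[of j E_max w] power_increasing[of w "n * q_max" E_max] by simp
  have one: "1 \<le> p_max ^ m" "1 \<le> E_max ^ (n * q_max)" using factors_pos E by (simp_all add: Suc_le_eq)
  show "k \<le> m \<Longrightarrow> p_max ^ k \<le> point_max" using mult_le_mono[OF p one(2)] by (simp add: point_max_def)
  show "w \<le> n * q_max \<Longrightarrow> j \<le> E_max \<Longrightarrow> j ^ w \<le> point_max"
    using mult_le_mono[OF one(1) j] by (simp add: point_max_def)
  show "k \<le> m \<Longrightarrow> w \<le> n * q_max \<Longrightarrow> j \<le> E_max \<Longrightarrow> p_max ^ k * j ^ w \<le> point_max"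
    using mult_le_mono[OF p j] by (simp add: point_max_def)
qed

lemma S_ge [simp]: "1 \<le> S" "Suc 0 \<le> S" "2 \<le> S"
proof -
  have "2 * 2 * 2 \<le> S" unfolding S_def by (intro mult_le_mono) auto
  then show "1 \<le> S" "Suc 0 \<le> S" "2 \<le> S" by auto
qed

lemma val_size_Num_le: "\<bar>x\<bar> \<le> int int_max \<Longrightarrow> val_size (Num x) \<le> \<beta> + 1"
proof -
  assume "\<bar>x\<bar> \<le> int int_max"
  then have "nat \<bar>x\<bar> < 2 ^ \<beta>" using int_max_less by linarith
  then show ?thesis using floorlog_le by simp
qed

lemma Num_ok: "\<bar>x\<bar> \<le> int int_max \<Longrightarrow> val_size (Num x) \<le> S"
proof -
  assume "\<bar>x\<bar> \<le> int int_max"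
  then have "val_size (Num x) \<le> 1 * 1 * (\<beta> + 2)" using val_size_Num_le by fastforce
  also have "\<dots> \<le> S" unfolding S_def by (intro mult_le_mono) auto
  finally show ?thesis .
qed

lemma nat_ok: "k \<le> int_max \<Longrightarrow> val_size (Num (int k)) \<le> S"
  by (intro Num_ok) simp

lemma counter_ok: "k \<le> E_max + 3 \<Longrightarrow> val_size (Num (int k)) \<le> S"
  using counter_le_int_max by (intro nat_ok) simp

lemma val_size_ints_le:
  assumes "length xs \<le> n" "\<And>x. x \<in> set xs \<Longrightarrow> \<bar>x\<bar> \<le> int int_max"
  shows "val_size (val_of_ints xs) \<le> 1 + n * (\<beta> + 1)"
proof -
  have "sum_list (map (val_size \<circ> Num) xs) \<le> sum_list (map (\<lambda>_. \<beta> + 1) xs)"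
    by (intro sum_list_mono) (use val_size_Num_le assms(2) in auto)
  also have "\<dots> = length xs * (\<beta> + 1)" by (simp only: sum_list_triv of_nat_id)
  also have "\<dots> \<le> n * (\<beta> + 1)" using assms(1) by (rule mult_le_mono1)
  finally show ?thesis by (simp add: val_of_ints_def)
qed

lemma ints_ok:
  assumes "length xs \<le> n" "\<And>x. x \<in> set xs \<Longrightarrow> \<bar>x\<bar> \<le> int int_max"
  shows "val_size (val_of_ints xs) \<le> S"
proof -
  have "val_size (val_of_ints xs) \<le> 1 + n * (\<beta> + 1)" using assms by (rule val_size_ints_le)
  also have "\<dots> \<le> (n + 2) * 1 * (\<beta> + 2)" by (simp add: algebra_simps)
  also have "\<dots> \<le> S" unfolding S_def by (intro mult_le_mono) auto
  finally show ?thesis .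
qed

lemma nats_ok:
  assumes "length xs \<le> n" "\<And>x. x \<in> set xs \<Longrightarrow> x \<le> int_max"
  shows "val_size (val_of_nats xs) \<le> S"
  unfolding val_of_nats_def using assms by (intro ints_ok) auto

lemma expansion_ok:
  assumes "length ps \<le> m" "\<And>v c. (v, c) \<in> set ps \<Longrightarrow> length v = n \<and> (\<forall>x\<in>set v. x \<le> int_max) \<and> \<bar>c\<bar> \<le> int int_max"
  shows "val_size (val_of_expansion ps) \<le> S"
proof -
  let ?g = "\<lambda>(v, c). Lst [val_of_nats v, Num c]"
  have "val_size (?g vc) \<le> 1 + (1 + n * (\<beta> + 1)) + (\<beta> + 1)" if "vc \<in> set ps" for vc
  proof -
    obtain v c where vc: "vc = (v, c)" by (cases vc)
    then have a: "length v \<le> n" "\<forall>x\<in>set v. x \<le> int_max" "\<bar>c\<bar> \<le> int int_max"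
      using assms(2)[of v c] that by auto
    have "val_size (val_of_nats v) \<le> 1 + n * (\<beta> + 1)"
      unfolding val_of_nats_def using a by (intro val_size_ints_le) auto
    moreover have "val_size (Num c) \<le> \<beta> + 1" by (rule val_size_Num_le[OF a(3)])
    ultimately have "val_size (val_of_nats v) \<le> 1 + n * (\<beta> + 1)" "val_size (Num c) \<le> \<beta> + 1" .
    then show ?thesis unfolding vc by (simp del: val_size.simps(1))
  qed
  then have "sum_list (map (val_size \<circ> ?g) ps) \<le> sum_list (map (\<lambda>_. 1 + (1 + n * (\<beta> + 1)) + (\<beta> + 1)) ps)"
    by (intro sum_list_mono) auto
  also have "\<dots> = length ps * (1 + (1 + n * (\<beta> + 1)) + (\<beta> + 1))" by (simp only: sum_list_triv of_nat_id)
  also have "\<dots> \<le> m * (1 + (1 + n * (\<beta> + 1)) + (\<beta> + 1))" using assms(1) by (rule mult_le_mono1)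
  finally have "val_size (val_of_expansion ps) \<le> 1 + m * (1 + (1 + n * (\<beta> + 1)) + (\<beta> + 1))"
    by (simp add: val_of_expansion_def)
  also have "\<dots> \<le> S" unfolding S_def by (simp add: algebra_simps)
  finally show ?thesis .
qed

lemma val_size_literal [simp]:
  "val_size (Num 0) = 1" "val_size (Num 1) = 2" "val_size (Num (-1)) = 2" "val_size (Lst []) = 1"
  by (simp_all add: floorlog_def)

declare val_size.simps [simp del]

lemma val_of_bool_eq_iff [simp]: "val_of_bool b = Num 0 \<longleftrightarrow> \<not> b"
  by (simp add: val_of_bool_def)

definition frame :: "string set \<Rightarrow> state \<Rightarrow> state \<Rightarrow> bool" where
  "frame W s s' \<longleftrightarrow> (\<forall>x. x \<notin> W \<longrightarrow> s' x = s x)"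

lemma frame_refl: "frame W s s" by (simp add: frame_def)

lemma frame_upd: "frame W s s' \<Longrightarrow> x \<in> W \<Longrightarrow> frame W s (s'(x := v))"
  by (auto simp: frame_def)

lemma terminates_le: "terminates c N Q s \<Longrightarrow> N \<le> N' \<Longrightarrow> terminates c N' Q s"
  by (erule terminates_mono)

section \<open>Correctness of the program\<close>

lemma pow_com_ok:
  assumes "bounded s" "s ''b'' = Num (int b)" "s ''e'' = Num (int e)" "b ^ e \<le> int_max" "e \<le> M" "e \<le> E_max"
  shows "terminates pow_com (4 * M + 3) (\<lambda>s'. frame {''r'', ''e''} s s' \<and> s' ''r'' = Num (int (b ^ e))) s"
proof -
  have pw: "b ^ i \<le> int_max" if "i \<le> e" for i
  \<comment> \<open>For \<open>b = 0\<close> powers are not increasing, since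
    \<open>0 ^ 0 = 1\<close>. The case arises for the sample \<open>j = 0\<close>.\<close>
  proof (cases "b = 0")
    case True
    then show ?thesis using counter_le_int_max by (cases i) auto
  next
    case False
    then have "b ^ i \<le> b ^ e" using that by (intro power_increasing) auto
    then show ?thesis using assms(4) by simp
  qed
  let ?I = "\<lambda>i s'. i \<le> e \<and> frame {''r'', ''e''} s s' \<and> s' ''r'' = Num (int (b ^ i)) \<and> s' ''e'' = Num (int (e - i))"
  have "terminates pow_com (1 + (e * ((1 + 1 + 1) + 1) + 1) + 1)
     (\<lambda>s'. frame {''r'', ''e''} s s' \<and> s' ''r'' = Num (int (b ^ e))) s"
    unfolding pow_com_def
  proof (intro terminates_Comp terminates_Assign terminates_While[where I = ?I])
    fix i s' assume i: "i \<le> e" "bounded s'" and I: "?I i s'"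
      and cond: "eval (Less (Lit 0) (Reg ''e'')) s' \<noteq> Num 0"
    have lt: "i < e" using cond I by auto
    have b: "s' ''b'' = Num (int b)" using I assms(2) by (simp add: frame_def)
    have ok: "val_size (Num (int b * int b ^ i)) \<le> S" "val_size (Num (int (e - Suc i))) \<le> S"
      using nat_ok[OF pw[of "Suc i"]] counter_ok[of "e - Suc i"] lt assms(6) by simp_all
    have e: "int e - int i - 1 = int (e - Suc i)" using lt by simp
    have "terminates pow_body (1 + 1 + 1) (?I (Suc i)) s'"
      unfolding pow_body_def
      by (intro terminates_Comp terminates_Assign bounded_upd)
         (use i(2) I lt b ok e in \<open>simp_all add: frame_upd mult.commute\<close>)
    then show "i < e \<and> terminates pow_body (1 + 1 + 1) (?I (Suc i)) s'" using lt by blast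
  next
    fix i s' assume I: "i \<le> e" "?I i s'" and "eval (Less (Lit 0) (Reg ''e'')) s' = Num 0"
    then have "i = e" by auto
    then show "frame {''r'', ''e''} s s' \<and> s' ''r'' = Num (int (b ^ e))" using I by simp
  qed (use assms in \<open>auto simp: frame_refl intro!: bounded_upd frame_upd\<close>)
  then show ?thesis by (rule terminates_le) (use assms(5) in simp)
qed

lemma terminates_Seq:
  assumes "terminates c1 N1 Q1 s" "\<And>s1. bounded s1 \<Longrightarrow> Q1 s1 \<Longrightarrow> terminates c2 N2 Q s1"
  shows "terminates (c1 ;; c2) (N1 + N2 + 1) Q s"
  by (rule terminates_Comp[OF terminates_mono[OF assms(1)]]) (use assms(2) in auto)

lemma as_list_val_of_nats [simp]: "as_list (val_of_nats xs) = map (\<lambda>x. Num (int x)) xs"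
  by (simp add: val_of_nats_def val_of_ints_def)

lemma Lst_Cons_val_of_nats [simp]:
  "Lst (Num (int x) # map (\<lambda>x. Num (int x)) xs) = val_of_nats (x # xs)"
  by (simp add: val_of_nats_def val_of_ints_def)

lemma Lst_val_of_nats [simp]: "Lst (map (\<lambda>x. Num (int x)) xs) = val_of_nats xs"
  by (simp add: val_of_nats_def val_of_ints_def)

lemma val_of_nats_Nil_iff: "val_of_nats xs = Lst [] \<longleftrightarrow> xs = []" "Lst [] = val_of_nats xs \<longleftrightarrow> xs = []"
  by (auto simp: val_of_nats_def val_of_ints_def)

lemma base_le_p_max: "i < n \<Longrightarrow> base n i \<le> p_max"
  unfolding base_def p_max_def by (intro add_mono mult_le_mono) auto

lemma p_max_le_int_max: "p_max \<le> int_max"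
  using power_bounds(1)[of 1] m_pos point_le_int_max by simp

lemma base_le_int_max: "i < n \<Longrightarrow> base n i \<le> int_max"
  using base_le_p_max p_max_le_int_max le_trans by blast

lemma fact_le_int_max: "fact n \<le> int_max"
proof -
  have "1 * fact n \<le> (n + 1) * fact n" by (intro mult_le_mono1) simp
  then have "fact n \<le> p_max" unfolding p_max_def base_def by linarith
  then show ?thesis using p_max_le_int_max by simp
qed

lemma bases_com_ok:
  assumes "bounded s" "s ''n'' = Num (int n)"
  shows "terminates bases_com (8 * n + 20)
     (\<lambda>s'. frame {''g'', ''i'', ''p''} s s' \<and> s' ''p'' = val_of_nats (rev (map (base n) [0..<n]))) s"
proof -
  let ?W = "{''g'', ''i'', ''p''}"
  let ?J = "\<lambda>i s'. i \<le> n \<and> frame ?W s s' \<and> s' ''i'' = Num (int (n - i)) \<and>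
     (\<exists>g. s' ''g'' = Num (int g) \<and> g * fact (n - i) = fact n)"
  let ?I = "\<lambda>i s'. i \<le> n \<and> frame ?W s s' \<and> s' ''i'' = Num (int i) \<and> s' ''g'' = Num (int (fact n)) \<and>
     s' ''p'' = val_of_nats (rev (map (base n) [0..<i]))"
  have nE: "n \<le> E_max" by (rule counters_le_E_max)
  have 1: "terminates (While (Less (Lit 0) (Reg ''i'')) factorial_body) (n * ((1 + 1 + 1) + 1) + 1)
     (\<lambda>s'. frame ?W s s' \<and> s' ''g'' = Num (int (fact n))) s'" if "bounded s'" "?J 0 s'" for s'
  proof (rule terminates_While[where I = ?J, OF _ that])
    fix i s' assume b: "bounded s'" and I: "?J i s'" and "eval (Less (Lit 0) (Reg ''i'')) s' \<noteq> Num 0"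
    then have lt: "i < n" by auto
    obtain g where g: "s' ''g'' = Num (int g)" "g * fact (n - i) = fact n" using I by blast
    define l where "l = n - Suc i"
    have l: "n - i = Suc l" "n - Suc i = l" using lt by (simp_all add: l_def)
    have si: "s' ''i'' = Num (1 + int l)" and fr: "frame ?W s s'" using I l by auto
    have g': "(g * Suc l) * fact l = fact n" using g(2) by (simp only: l fact_Suc mult.assoc of_nat_id)
    have "0 < (fact l :: nat)" by simp
    then have "g * Suc l \<le> fact n" using g' by (metis Suc_leI mult.right_neutral mult_le_mono2 One_nat_def)
    then have "val_size (Num (int (g * Suc l))) \<le> S" using fact_le_int_max by (intro nat_ok) simp
    moreover have eq: "int (g * Suc l) = int g * (1 + int l)" by (simp add: algebra_simps)
    ultimately have ok: "val_size (Num (int g * (1 + int l))) \<le> S" "val_size (Num (int l)) \<le> S"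
      using counter_ok[of l] nE by (simp_all only: eq) (simp add: l_def)
    have "terminates factorial_body (1 + 1 + 1) (?J (Suc i)) s'"
      unfolding factorial_body_def l(2)
      by (intro terminates_Comp terminates_Assign bounded_upd)
         (use b lt g g' ok si fr eq in \<open>auto simp: frame_upd simp del: mult_Suc_right of_nat_mult intro!: exI[of _ "g * Suc l"]\<close>)
    then show "i < n \<and> terminates factorial_body (1 + 1 + 1) (?J (Suc i)) s'" using lt by blast
  next
    fix i s' assume I: "?J i s'" and "eval (Less (Lit 0) (Reg ''i'')) s' = Num 0"
    then have "n - i = 0" by auto
    then show "frame ?W s s' \<and> s' ''g'' = Num (int (fact n))" using I by auto
  qed simp
  have 2: "terminates (While (Less (Reg ''i'') (Reg ''n'')) bases_body) (n * ((1 + 1 + 1) + 1) + 1)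
     (\<lambda>s'. frame ?W s s' \<and> s' ''p'' = val_of_nats (rev (map (base n) [0..<n]))) s'" if "bounded s'" "?I 0 s'" for s'
  proof (rule terminates_While[where I = ?I, OF _ that])
    fix i s' assume b: "bounded s'" and I: "?I i s'" and cond: "eval (Less (Reg ''i'') (Reg ''n'')) s' \<noteq> Num 0"
    have n: "s' ''n'' = Num (int n)" using I assms(2) by (simp add: frame_def)
    then have lt: "i < n" using I cond by auto
    have eq: "1 + (1 + int i) * fact n = int (base n i)" by (simp add: base_def algebra_simps)
    have "val_size (val_of_nats (rev (map (base n) [0..<Suc i]))) \<le> S"
      using lt base_le_int_max by (intro nats_ok) auto
    then have ok: "val_size (val_of_nats (base n i # rev (map (base n) [0..<i]))) \<le> S"
      "val_size (Num (int i + 1)) \<le> S" using counter_ok[of "Suc i"] lt nE by (simp_all add: add.commute)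
    have "terminates bases_body (1 + 1 + 1) (?I (Suc i)) s'"
      unfolding bases_body_def
      by (intro terminates_Comp terminates_Assign bounded_upd)
         (use b I lt ok in \<open>simp_all add: frame_upd eq add.commute\<close>)
    then show "i < n \<and> terminates bases_body (1 + 1 + 1) (?I (Suc i)) s'" using lt by blast
  next
    fix i s' assume I: "?I i s'" and cond: "eval (Less (Reg ''i'') (Reg ''n'')) s' = Num 0"
    have n: "s' ''n'' = Num (int n)" using I assms(2) by (simp add: frame_def)
    then have "i = n" using I cond by auto
    then show "frame ?W s s' \<and> s' ''p'' = val_of_nats (rev (map (base n) [0..<n]))" using I by auto
  qed simp
  have "terminates bases_com (1 + (1 + ((n * ((1 + 1 + 1) + 1) + 1) + (1 + (1 + (n * ((1 + 1 + 1) + 1) + 1) + 1) + 1) + 1) + 1) + 1)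
     (\<lambda>s'. frame {''g'', ''i'', ''p''} s s' \<and> s' ''p'' = val_of_nats (rev (map (base n) [0..<n]))) s"
    unfolding bases_com_def
  proof (intro terminates_Comp terminates_Assign bounded_upd)
    show "terminates (While (Less (Lit 0) (Reg ''i'')) factorial_body) (n * ((1 + 1 + 1) + 1) + 1)
      (terminates (Assign ''p'' Nil_expr ;; Assign ''i'' (Lit 0) ;; While (Less (Reg ''i'') (Reg ''n'')) bases_body)
        (1 + (1 + (n * ((1 + 1 + 1) + 1) + 1) + 1) + 1)
        (\<lambda>s'. frame {''g'', ''i'', ''p''} s s' \<and> s' ''p'' = val_of_nats (rev (map (base n) [0..<n]))))
      (s(''g'' := eval (Lit 1) s, ''i'' := eval (Reg ''n'') (s(''g'' := eval (Lit 1) s))))" (is "terminates _ _ _ ?s1")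
    proof (rule terminates_mono[OF 1])
      show "bounded ?s1" using assms counter_ok[of n] nE by (intro bounded_upd) simp_all
      show "?J 0 ?s1" using assms by (auto simp: frame_refl frame_upd intro!: exI[of _ 1])
      fix s' assume s': "bounded s'" "frame ?W s s' \<and> s' ''g'' = Num (int (fact n))"
      show "terminates (Assign ''p'' Nil_expr ;; Assign ''i'' (Lit 0) ;; While (Less (Reg ''i'') (Reg ''n'')) bases_body)
        (1 + (1 + (n * ((1 + 1 + 1) + 1) + 1) + 1) + 1)
        (\<lambda>s'. frame {''g'', ''i'', ''p''} s s' \<and> s' ''p'' = val_of_nats (rev (map (base n) [0..<n]))) s'"
        by (intro terminates_Comp terminates_Assign bounded_upd 2)
           (use s' in \<open>auto simp: frame_upd val_of_nats_Nil_iff\<close>)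
    qed simp
  qed (use assms counter_ok[of n] nE in simp_all)
  then show ?thesis by (rule terminates_le) simp
qed

lemma weights_com_ok:
  assumes "bounded s" "s ''n'' = Num (int n)" "s ''d'' = Num (int d)" "s ''q'' = Num (int q)" "0 < q" "q \<le> q_max"
  shows "terminates weights_com (6 * n + 20)
     (\<lambda>s'. frame {''c'', ''i'', ''u''} s s' \<and> s' ''c'' = val_of_nats (rev (map (weight (d + 1) q) [0..<n]))) s"
proof -
  let ?W = "{''c'', ''i'', ''u''}" and ?w = "weight (d + 1) q"
  let ?I = "\<lambda>i s'. i \<le> n \<and> frame ?W s s' \<and> s' ''i'' = Num (int i) \<and> s' ''u'' = Num (int ((d + 1) ^ i)) \<and>
     s' ''c'' = val_of_nats (rev (map ?w [0..<i]))"
  have nE: "n \<le> E_max" by (rule counters_le_E_max)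
  have w: "?w i \<le> int_max" if "i < n" for i
  proof -
    have "?w i \<le> n * q" using weight_less[OF assms(5) that] by (rule less_imp_le)
    also have "\<dots> \<le> n * q_max" using assms(6) by simp
    finally show ?thesis using counters_le_E_max(2) counter_le_int_max by linarith
  qed
  have 2: "terminates (While (Less (Reg ''i'') (Reg ''n'')) weights_body) (n * ((1 + (1 + 1 + 1) + 1) + 1) + 1)
     (\<lambda>s'. frame ?W s s' \<and> s' ''c'' = val_of_nats (rev (map ?w [0..<n]))) s'" if "bounded s'" "?I 0 s'" for s'
  proof (rule terminates_While[where I = ?I, OF _ that])
    fix i s' assume b: "bounded s'" and I: "?I i s'" and cond: "eval (Less (Reg ''i'') (Reg ''n'')) s' \<noteq> Num 0"
    have regs: "s' ''n'' = Num (int n)" "s' ''d'' = Num (int d)" "s' ''q'' = Num (int q)"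
      using I assms by (simp_all add: frame_def)
    then have lt: "i < n" using I cond by auto
    have eq: "int i * int q + (1 + int d) ^ i mod int q = int (?w i)"
      by (simp add: weight_def zmod_int add.commute)
    have "(d + 1) ^ Suc i \<le> (d + 1) ^ n" using lt by (intro power_increasing) auto
    then have "val_size (Num (int ((d + 1) ^ Suc i))) \<le> S" using digit_le_int_max by (intro nat_ok) simp
    moreover have "int ((d + 1) ^ Suc i) = (1 + int d) * (1 + int d) ^ i" by (simp add: algebra_simps)
    ultimately have ok0: "val_size (Num ((1 + int d) * (1 + int d) ^ i)) \<le> S" by (simp only:)
    have "val_size (val_of_nats (rev (map ?w [0..<Suc i]))) \<le> S"
      using lt w by (intro nats_ok) auto
    then have ok: "val_size (val_of_nats (?w i # rev (map ?w [0..<i]))) \<le> S"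
      "val_size (Num (1 + int i)) \<le> S" using counter_ok[of "Suc i"] lt nE by (simp_all add: add.commute)
    have pd: "(1 + int d) ^ i + int d * (1 + int d) ^ i = (1 + int d) * (1 + int d) ^ i"
      by (simp add: algebra_simps)
    have "terminates weights_body (1 + (1 + 1 + 1) + 1) (?I (Suc i)) s'"
      unfolding weights_body_def
      by (intro terminates_Comp terminates_Assign bounded_upd)
         (use b I lt ok ok0 regs eq pd in \<open>simp_all add: frame_upd add.commute mult.commute\<close>)
    then show "i < n \<and> terminates weights_body (1 + (1 + 1 + 1) + 1) (?I (Suc i)) s'" using lt by blast
  next
    fix i s' assume I: "?I i s'" and cond: "eval (Less (Reg ''i'') (Reg ''n'')) s' = Num 0"
    have n: "s' ''n'' = Num (int n)" using I assms(2) by (simp add: frame_def)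
    then have "i = n" using I cond by auto
    then show "frame ?W s s' \<and> s' ''c'' = val_of_nats (rev (map ?w [0..<n]))" using I by auto
  qed simp
  have "terminates weights_com (1 + (1 + (1 + (n * ((1 + (1 + 1 + 1) + 1) + 1) + 1) + 1) + 1) + 1)
     (\<lambda>s'. frame ?W s s' \<and> s' ''c'' = val_of_nats (rev (map ?w [0..<n]))) s"
    unfolding weights_com_def
    by (intro terminates_Comp terminates_Assign bounded_upd 2)
       (use assms in \<open>auto simp: frame_upd frame_refl val_of_nats_Nil_iff\<close>)
  then show ?thesis by (rule terminates_le) simp
qed


abbreviation (input) w :: "nat \<Rightarrow> nat \<Rightarrow> nat" where "w q i \<equiv> weight (d + 1) q i"

lemma weight_le: "0 < q \<Longrightarrow> q \<le> q_max \<Longrightarrow> i < n \<Longrightarrow> w q i \<le> n * q_max"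
  using weight_less[of q i n "d + 1"] mult_le_mono2[of q q_max n] by linarith

lemma as_int_val_of_bool [simp]: "as_int (val_of_bool b) < 1 \<longleftrightarrow> \<not> b"
  by (simp add: val_of_bool_def)

lemma base_power_le: "i < n \<Longrightarrow> k \<le> m \<Longrightarrow> base n i ^ k \<le> point_max"
  using base_le_p_max[of i] power_mono[of "base n i" p_max k] power_bounds(1)[of k] by simp

lemma sample_point_le:
  assumes "i < n" "k \<le> m" "0 < q" "q \<le> q_max" "j \<le> E_max"
  shows "base n i ^ k * j ^ w q i \<le> point_max"
proof -
  have "base n i ^ k * j ^ w q i \<le> p_max ^ k * j ^ w q i"
    using base_le_p_max[OF assms(1)] by (intro mult_le_mono1 power_mono) auto
  also have "\<dots> \<le> point_max" using assms weight_le by (intro power_bounds(3)) auto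
  finally show ?thesis .
qed

section \<open>Sample points\<close>

definition N_point :: nat where "N_point = n * (8 * E_max + 30) + 10"

lemma point_com_ok:
  assumes "bounded s" "s ''p'' = val_of_nats (rev (map (base n) [0..<n]))"
    "s ''c'' = val_of_nats (rev (map (w q) [0..<n]))" "s ''k'' = Num (int k)" "s ''j'' = Num (int j)"
    and q: "0 < q" "q \<le> q_max" and k: "k \<le> m" and j: "j \<le> E_max"
  shows "terminates point_com N_point (\<lambda>s'. frame {''P'', ''X'', ''Z'', ''b'', ''e'', ''r'', ''D''} s s' \<and>
     s' ''P'' = val_of_nats (sample_point n (d + 1) q k j)) s"
proof -
  let ?W = "{''P'', ''X'', ''Z'', ''b'', ''e'', ''r'', ''D''}"
  define f where "f i = base n i ^ k * j ^ w q i" for i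
  let ?J = "\<lambda>i s'. i \<le> n \<and> frame ?W s s' \<and> s' ''X'' = val_of_nats (rev (map (base n) [0..<n - i])) \<and>
    s' ''Z'' = val_of_nats (rev (map (w q) [0..<n - i])) \<and> s' ''P'' = val_of_nats (map f [n - i..<n])"
  let ?N = "1 + (1 + ((4 * E_max + 3) + (1 + (1 + (1 + ((4 * E_max + 3) + (1 + (1 + 1 + 1) + 1) + 1) + 1) + 1) + 1) + 1) + 1) + 1"
  have okp: "val_size (val_of_nats (rev (map (base n) [0..<l]))) \<le> S" if "l \<le> n" for l
    using that base_le_int_max by (intro nats_ok) auto
  have w_le: "w q i \<le> E_max" if "i < n" for i
    using weight_le[OF q that] counters_le_E_max(2) by simp
  have E_le: "x \<le> E_max \<Longrightarrow> x \<le> int_max" for x using counter_le_int_max by simp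
  have okc: "val_size (val_of_nats (rev (map (w q) [0..<l]))) \<le> S" if "l \<le> n" for l
    using that w_le E_le by (intro nats_ok) auto
  have f_le: "f i \<le> int_max" if "i < n" for i
    unfolding f_def using sample_point_le[OF that k q j] point_le_int_max by simp
  have okf: "val_size (val_of_nats (map f [l..<n])) \<le> S" for l
    using f_le by (intro nats_ok) auto
  have loop: "terminates (While (Nonempty (Reg ''X'')) point_body) (n * (?N + 1) + 1)
    (\<lambda>s'. frame ?W s s' \<and> s' ''P'' = val_of_nats (map f [0..<n])) s'" if "bounded s'" "?J 0 s'" for s'
  proof (rule terminates_While[where I = ?J, OF _ that])
    fix i s' assume b: "bounded s'" and I: "?J i s'" and "eval (Nonempty (Reg ''X'')) s' \<noteq> Num 0"
    then have lt: "i < n" by (auto simp: val_of_nats_Nil_iff)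
    define l where "l = n - Suc i"
    have l: "n - i = Suc l" "n - Suc i = l" "l < n" using lt by (simp_all add: l_def)
    define ys where "ys = map f [Suc l..<n]"
    have fr: "frame ?W s s'" and X: "s' ''X'' = val_of_nats (base n l # rev (map (base n) [0..<l]))"
      and Z: "s' ''Z'' = val_of_nats (w q l # rev (map (w q) [0..<l]))"
      and P: "s' ''P'' = val_of_nats ys" using I l by (auto simp: ys_def)
    have kj: "s' ''k'' = Num (int k)" "s' ''j'' = Num (int j)" using fr assms by (simp_all add: frame_def)
    have fl: "map f [l..<n] = f l # ys" using l by (simp add: upt_conv_Cons ys_def)
    have ok1: "val_size (Num (int (base n l))) \<le> S" by (rule nat_ok[OF base_le_int_max[OF l(3)]])
    have ok2: "val_size (Num (int k)) \<le> S" "val_size (Num (int j)) \<le> S" "val_size (Num (int (w q l))) \<le> S"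
      using k j counters_le_E_max(4) w_le[OF l(3)] by (intro counter_ok; linarith)+
    have "base n l ^ k \<le> int_max" using base_power_le[OF l(3) k] point_le_int_max by (rule le_trans)
    then have ok3: "val_size (Num (int (base n l ^ k))) \<le> S" by (rule nat_ok)
    have ok4: "val_size (val_of_nats (f l # ys)) \<le> S" using okf[of l] by (simp only: fl)
    have ok5: "val_size (val_of_nats (rev (map (base n) [0..<l]))) \<le> S" "val_size (val_of_nats (rev (map (w q) [0..<l]))) \<le> S"
      using okp[of l] okc[of l] l(3) by simp_all
    note ok = ok1 ok2 ok3 ok4 ok5
    have pw: "base n l ^ k \<le> int_max" "j ^ w q l \<le> int_max" "k \<le> E_max" "w q l \<le> E_max"
      using base_power_le[OF l(3) k] power_bounds(2)[OF weight_le[OF q l(3)] j] point_le_int_max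
        k counters_le_E_max w_le[OF l(3)] by simp_all
    have body2: "terminates point_body2 (1 + (1 + 1 + 1) + 1) (?J (Suc i)) s2"
      if "bounded s2" "frame ?W s s2" "s2 ''X'' = s' ''X''" "s2 ''Z'' = s' ''Z''" "s2 ''P'' = s' ''P''"
        "s2 ''D'' = Num (int (base n l ^ k))" "s2 ''r'' = Num (int (j ^ w q l))" for s2
      unfolding point_body2_def l(2)
      by (intro terminates_Comp terminates_Assign bounded_upd)
         (use that X Z P ok lt fl in \<open>simp_all add: frame_upd f_def flip: of_nat_mult of_nat_power\<close>)
    have body1: "terminates point_body1 (1 + (1 + (1 + ((4 * E_max + 3) + (1 + (1 + 1 + 1) + 1) + 1) + 1) + 1) + 1) (?J (Suc i)) s2"
      if "bounded s2" "frame ?W s s2" "s2 ''X'' = s' ''X''" "s2 ''Z'' = s' ''Z''" "s2 ''P'' = s' ''P''"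
        "s2 ''r'' = Num (int (base n l ^ k))" "s2 ''j'' = Num (int j)" for s2
      unfolding point_body1_def
      by (intro terminates_Comp terminates_Assign bounded_upd order_refl
            terminates_mono[OF pow_com_ok[where b = j and e = "w q l" and M = E_max]] body2)
         (use that X Z P ok lt pw in \<open>simp_all add: frame_def flip: of_nat_mult of_nat_power\<close>)
    have "terminates point_body ?N (?J (Suc i)) s'"
      unfolding point_body_def
      by (intro terminates_Comp terminates_Assign bounded_upd order_refl
            terminates_mono[OF pow_com_ok[where b = "base n l" and e = k and M = E_max]] body1)
         (use b fr kj X Z P ok lt pw in \<open>simp_all add: frame_def flip: of_nat_mult of_nat_power\<close>)
    then show "i < n \<and> terminates point_body ?N (?J (Suc i)) s'" using lt by blast
  next
    fix i s' assume I: "?J i s'" and "eval (Nonempty (Reg ''X'')) s' = Num 0"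
    then have "n - i = 0" by (auto simp: val_of_nats_Nil_iff)
    then show "frame ?W s s' \<and> s' ''P'' = val_of_nats (map f [0..<n])" using I by simp
  qed simp
  have "terminates point_com (1 + (1 + (1 + (n * (?N + 1) + 1) + 1) + 1) + 1)
    (\<lambda>s'. frame ?W s s' \<and> s' ''P'' = val_of_nats (map f [0..<n])) s"
    unfolding point_com_def
    by (intro terminates_Comp terminates_Assign bounded_upd loop)
       (use assms okp[of n] okc[of n] in \<open>auto simp: frame_upd frame_refl val_of_nats_Nil_iff\<close>)
  moreover have "map f [0..<n] = sample_point n (d + 1) q k j"
    by (simp add: sample_point_def f_def)
  ultimately show ?thesis
    by (auto intro: terminates_le simp: N_point_def algebra_simps)
qed

section \<open>Values of the residual polynomial\<close>

definition expansion_val :: "nat list list \<Rightarrow> val" where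
  "expansion_val vs = Lst (map (\<lambda>v. Lst [val_of_nats v, Num (a v)]) vs)"

lemma expansion_val_eq: "expansion_val vs = val_of_expansion (map (\<lambda>v. (v, a v)) vs)"
  by (simp add: expansion_val_def val_of_expansion_def)

lemma as_list_expansion_val [simp]:
  "as_list (expansion_val vs) = map (\<lambda>v. Lst [val_of_nats v, Num (a v)]) vs"
  by (simp add: expansion_val_def)

lemma Lst_expansion_val [simp]: "Lst (map (\<lambda>v. Lst [val_of_nats v, Num (a v)]) vs) = expansion_val vs"
  by (simp add: expansion_val_def)

lemma expansion_val_Nil_iff: "expansion_val vs = Lst [] \<longleftrightarrow> vs = []" "Lst [] = expansion_val vs \<longleftrightarrow> vs = []"
  by (auto simp: expansion_val_def simp del: Lst_expansion_val)

lemma length_le_m: "distinct vs \<Longrightarrow> set vs \<subseteq> \<Gamma> \<Longrightarrow> length vs \<le> m"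
  using card_mono[OF finite_\<Gamma>, of "set vs"] card_\<Gamma> by (simp add: distinct_card)

lemma expansion_val_ok:
  assumes "distinct vs" "set vs \<subseteq> \<Gamma>"
  shows "val_size (expansion_val vs) \<le> S"
  unfolding expansion_val_eq
proof (rule expansion_ok)
  fix v c assume "(v, c) \<in> set (map (\<lambda>v. (v, a v)) vs)"
  then have v: "v \<in> \<Gamma>" "c = a v" using assms(2) by auto
  have "coeff_sum * 1 \<le> (coeff_sum + 1) * (schubert_norm_bound n d * point_max ^ d)"
    using factors_pos by (intro mult_le_mono) (auto simp: Suc_le_eq)
  then have "\<bar>c\<bar> \<le> int int_max"
    using abs_a_le[OF v(1)] v(2) value_le_int_max unfolding value_max_def by linarith
  moreover have "x \<le> int_max" if "x \<in> set v" for x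
  proof -
    obtain i where "i < n" "x = v ! i" using \<open>x \<in> set v\<close> length_\<Gamma>[OF v(1)] by (auto simp: in_set_conv_nth)
    then have "x \<le> d" using nth_le_d[OF v(1)] by simp
    then show ?thesis using counters_le_E_max(6) counter_le_int_max by linarith
  qed
  ultimately show "length v = n \<and> (\<forall>x\<in>set v. x \<le> int_max) \<and> \<bar>c\<bar> \<le> int int_max"
    using length_\<Gamma>[OF v(1)] by blast
qed (use assms length_le_m in simp)

lemma residual_ok:
  assumes "T \<subseteq> \<Gamma>" "length x = n" "\<And>i. i < n \<Longrightarrow> x ! i \<le> point_max"
  shows "\<bar>residual T x\<bar> \<le> int value_max"
proof -
  have "\<bar>residual T x\<bar> \<le> int (coeff_sum * (schubert_norm_bound n d * point_max ^ d))"
    using assms factors_pos by (intro residual_bound) auto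
  also have "\<dots> \<le> int value_max"
    unfolding value_max_def of_nat_le_iff by (intro mult_le_mono) auto
  finally show ?thesis .
qed

lemma Y_ok:
  assumes "v \<in> \<Gamma>" "length x = n" "\<And>i. i < n \<Longrightarrow> x ! i \<le> point_max"
  shows "\<bar>Y v x\<bar> \<le> int value_max"
proof -
  have "\<bar>Y v x\<bar> \<le> int (schubert_norm_bound n d * point_max ^ d)"
    using assms factors_pos length_\<Gamma> sum_list_le_d by (intro schubert_value_bound) auto
  also have "1 * (schubert_norm_bound n d * point_max ^ d) \<le> value_max"
    unfolding value_max_def by (intro mult_le_mono) auto
  then have "int (schubert_norm_bound n d * point_max ^ d) \<le> int value_max" by linarith
  finally show ?thesis .
qed

lemma value_Num_ok: "\<bar>x\<bar> \<le> int value_max \<Longrightarrow> val_size (Num x) \<le> S"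
  using value_le_int_max by (intro Num_ok) linarith

definition N_residual :: nat where "N_residual = m * 6 + 5"

text \<open>Every intermediate value of \<open>R\<close> is itself the residual of a subset of
  \<open>\<Gamma>\<close>, so one bound covers the whole subtraction.\<close>

lemma residual_com_ok:
  assumes "bounded s" "s ''P'' = val_of_nats x" and x: "length x = n" "\<And>i. i < n \<Longrightarrow> x ! i \<le> point_max"
    and out: "s ''out'' = expansion_val vs" "distinct vs" "set vs \<subseteq> \<Gamma>"
  shows "terminates residual_com N_residual (\<lambda>s'. frame {''R'', ''L'', ''V''} s s' \<and>
     s' ''R'' = Num (residual (\<Gamma> - set vs) x)) s"
proof -
  let ?W = "{''R'', ''L'', ''V''}"
  let ?I = "\<lambda>i s'. i \<le> length vs \<and> frame ?W s s' \<and> s' ''L'' = expansion_val (drop i vs) \<and>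
    s' ''R'' = Num (residual (\<Gamma> - set (take i vs)) x)"
  let ?N = "1 + (1 + 1 + 1) + 1"
  have loop: "terminates (While (Nonempty (Reg ''L'')) residual_body) (length vs * (?N + 1) + 1)
    (\<lambda>s'. frame ?W s s' \<and> s' ''R'' = Num (residual (\<Gamma> - set vs) x)) s'" if "bounded s'" "?I 0 s'" for s'
  proof (rule terminates_While[where I = ?I, OF _ that])
    fix i s' assume b: "bounded s'" and I: "?I i s'" and "eval (Nonempty (Reg ''L'')) s' \<noteq> Num 0"
    then have lt: "i < length vs" by (auto simp: expansion_val_Nil_iff)
    define v where "v = vs ! i"
    have v: "v \<in> \<Gamma>" using lt out(3) by (auto simp: v_def)
    have drop: "drop i vs = v # drop (Suc i) vs" using lt by (simp add: Cons_nth_drop_Suc v_def)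
    have fresh: "v \<notin> set (take i vs)"
      using lt out(2) by (auto simp: v_def in_set_conv_nth nth_eq_iff_index_eq)
    have fr: "frame ?W s s'" and L: "s' ''L'' = expansion_val (v # drop (Suc i) vs)"
      and R: "s' ''R'' = Num (residual (\<Gamma> - set (take i vs)) x)" using I drop by auto
    have P: "s' ''P'' = val_of_nats x" using fr assms(2) by (simp add: frame_def)
    have step: "residual (\<Gamma> - set (take i vs)) x - a v * Y v x = residual (\<Gamma> - set (take (Suc i) vs)) x"
    proof -
      have "\<Gamma> - set (take i vs) = insert v (\<Gamma> - set (take (Suc i) vs))"
        using v fresh lt by (auto simp: take_Suc_conv_app_nth v_def)
      moreover have "v \<notin> \<Gamma> - set (take (Suc i) vs)" using lt by (auto simp: take_Suc_conv_app_nth v_def)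
      ultimately show ?thesis using finite_\<Gamma> by (simp add: residual_def)
    qed
    have ok: "val_size (Num (Y v x)) \<le> S" "val_size (Num (residual (\<Gamma> - set (take (Suc i) vs)) x)) \<le> S"
      "val_size (expansion_val (drop (Suc i) vs)) \<le> S"
      using Y_ok[OF v x] residual_ok[OF _ x] out(2,3)
      by (auto intro!: value_Num_ok expansion_val_ok dest: in_set_dropD)
    have "terminates residual_body ?N (?I (Suc i)) s'"
      unfolding residual_body_def
      by (intro terminates_Comp terminates_Assign terminates_QuerySchubert[where v = v and xs = x] bounded_upd)
         (use b L R P ok lt step fr v x(1) length_\<Gamma> in \<open>simp_all add: frame_upd\<close>)
    then show "i < length vs \<and> terminates residual_body ?N (?I (Suc i)) s'" using lt by blast
  next
    fix i s' assume I: "?I i s'" and "eval (Nonempty (Reg ''L'')) s' = Num 0"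
    then have "length vs \<le> i" by (auto simp: expansion_val_Nil_iff)
    then show "frame ?W s s' \<and> s' ''R'' = Num (residual (\<Gamma> - set vs) x)" using I by simp
  qed simp
  have r0: "val_size (Num (residual \<Gamma> x)) \<le> S"
    by (rule value_Num_ok[OF residual_ok[OF subset_refl x]])
  have "terminates residual_com (1 + (1 + (length vs * (?N + 1) + 1) + 1) + 1)
    (\<lambda>s'. frame ?W s s' \<and> s' ''R'' = Num (residual (\<Gamma> - set vs) x)) s"
    unfolding residual_com_def
    by (intro terminates_Comp terminates_Assign terminates_QueryPoly[where xs = "map int x"] bounded_upd loop)
       (use assms r0 expansion_val_ok[OF out(2,3)] in
         \<open>simp_all add: frame_upd frame_refl F_residual val_of_nats_def\<close>)
  then show ?thesis
    using length_le_m[OF out(2,3)] by (auto intro: terminates_le simp: N_residual_def)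
qed


section \<open>Alternating sums of residuals\<close>

definition sign_binomial :: "nat \<Rightarrow> nat \<Rightarrow> int" where
  "sign_binomial E j = (-1) ^ j * int (E choose j)"

text \<open>The ratio of consecutive binomial coefficients is \<open>(E - j) / (j + 1)\<close>, so
  the integer division is exact. At \<open>j = E\<close> the result is 0.\<close>

lemma sign_binomial_Suc:
  assumes "j \<le> E"
  shows "(- sign_binomial E j * (int E - int j)) div (1 + int j) = sign_binomial E (Suc j)"
proof -
  have "Suc j * (E choose Suc j) = (E - j) * (E choose j)"
    unfolding binomial_absorb_comp by (rule binomial_absorption)
  then have "int (Suc j) * int (E choose Suc j) = (int E - int j) * int (E choose j)"
    using assms by (metis of_nat_diff of_nat_mult)
  moreover have "- sign_binomial E j * (int E - int j) = - ((-1) ^ j * ((int E - int j) * int (E choose j)))"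
    by (simp add: sign_binomial_def)
  moreover have "sign_binomial E (Suc j) * (1 + int j) = - ((-1) ^ j * (int (Suc j) * int (E choose Suc j)))"
    by (simp add: sign_binomial_def del: binomial_Suc_Suc)
  ultimately have "- sign_binomial E j * (int E - int j) = sign_binomial E (Suc j) * (1 + int j)" by simp
  then show ?thesis by simp
qed

lemma abs_sign_binomial_le: "E \<le> E_max \<Longrightarrow> \<bar>sign_binomial E j\<bar> \<le> int (2 ^ E_max)"
proof -
  assume "E \<le> E_max"
  have "(E choose j) \<le> 2 ^ E" by (rule binomial_le_pow2)
  also have "\<dots> \<le> 2 ^ E_max" using \<open>E \<le> E_max\<close> by (intro power_increasing) auto
  finally have "int (E choose j) \<le> int (2 ^ E_max)" by (rule of_nat_mono)
  then show ?thesis by (simp add: sign_binomial_def abs_mult power_abs)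
qed

lemma abs_partial_sum_le:
  assumes "E \<le> E_max" "i \<le> E + 1" "\<And>j. j \<le> E \<Longrightarrow> \<bar>g j\<bar> \<le> int B"
  shows "\<bar>\<Sum>j<i. sign_binomial E j * g j\<bar> \<le> int ((E_max + 1) * (2 ^ E_max * B))"
proof -
  have "\<bar>\<Sum>j<i. sign_binomial E j * g j\<bar> \<le> (\<Sum>j<i. int (2 ^ E_max * B))"
  proof (rule order_trans[OF sum_abs], rule sum_mono)
    fix j assume "j \<in> {..<i}"
    then have "\<bar>sign_binomial E j\<bar> * \<bar>g j\<bar> \<le> int (2 ^ E_max) * int B"
      using assms abs_sign_binomial_le[OF assms(1)] by (intro mult_mono) auto
    then show "\<bar>sign_binomial E j * g j\<bar> \<le> int (2 ^ E_max * B)" by (simp add: abs_mult)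
  qed
  also have "\<dots> = int (i * (2 ^ E_max * B))" by simp
  also have "\<dots> \<le> int ((E_max + 1) * (2 ^ E_max * B))"
    using assms(1,2) by (intro of_nat_mono mult_le_mono1) simp
  finally show ?thesis .
qed

definition N_sample :: nat where
  "N_sample = (E_max + 1) * (N_point + N_residual + 4 * E_max + 30) + 10"

abbreviation (input) sample_regs :: "string set" where
  "sample_regs \<equiv> {''P'', ''X'', ''Z'', ''b'', ''e'', ''r'', ''D'', ''R'', ''L'', ''V'', ''A'', ''W'', ''C'', ''j''}"

text \<open>As \<open>out\<close> holds exactly the terms of weight above \<open>E\<close>, the
  residual has weight at most \<open>E\<close>. This is the condition under which the finite
  difference isolates level \<open>E\<close>.\<close>

lemma sample_com_ok:
  assumes b: "bounded s" and p: "s ''p'' = val_of_nats (rev (map (base n) [0..<n]))"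
    and c: "s ''c'' = val_of_nats (rev (map (w q) [0..<n]))" and k: "s ''k'' = Num (int k)" and E: "s ''E'' = Num (int E)"
    and out: "s ''out'' = expansion_val vs" "distinct vs" "set vs = {v \<in> \<Gamma>. E < code_weight (d + 1) q n v}"
    and q: "0 < q" "q \<le> q_max" and km: "k \<le> m" and EE: "E \<le> E_max"
  shows "terminates sample_com N_sample (\<lambda>s'. frame sample_regs s s' \<and>
     s' ''A'' = Num (alternating_sum E E * power_sum_at q E k) \<and> s' ''W'' = Num (alternating_sum E E)) s"
proof -
  let ?W = "sample_regs"
  define pt where "pt j = sample_point n (d + 1) q k j" for j
  define r where "r j = residual (\<Gamma> - set vs) (pt j)" for j
  define A where "A i = (\<Sum>j<i. sign_binomial E j * r j)" for i
  define W where "W i = (\<Sum>j<i. sign_binomial E j * int j ^ E)" for i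
  let ?I = "\<lambda>i s'. i \<le> E + 1 \<and> frame ?W s s' \<and> s' ''A'' = Num (A i) \<and> s' ''W'' = Num (W i) \<and>
    s' ''C'' = Num (sign_binomial E i) \<and> s' ''j'' = Num (int i)"
  let ?N3 = "1 + (1 + 1 + 1) + 1"
  let ?N2 = "1 + (1 + (1 + ((4 * E_max + 3) + ?N3 + 1) + 1) + 1) + 1"
  let ?N1 = "N_residual + ?N2 + 1"
  let ?N = "N_point + ?N1 + 1"
  have sub: "set vs \<subseteq> \<Gamma>" using out(3) by auto
  have pt: "length (pt j) = n" "i < n \<Longrightarrow> pt j ! i \<le> point_max" if "j \<le> E" for j i
    using sample_point_le[of i k q j] km q that EE by (simp_all add: pt_def sample_point_def)
  have r_le: "\<bar>r j\<bar> \<le> int value_max" if "j \<le> E" for j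
    unfolding r_def using pt[OF that] by (intro residual_ok) auto
  have p_le: "j ^ E \<le> E_max ^ E_max" if "j \<le> E" for j
  proof -
    have "j ^ E \<le> E_max ^ E" using that EE by (intro power_mono) auto
    also have "\<dots> \<le> E_max ^ E_max" using counters_le_E_max EE by (intro power_increasing) auto
    finally show ?thesis .
  qed
  have okA: "val_size (Num (A i)) \<le> S" if "i \<le> E + 1" for i
  proof (rule Num_ok)
    have "\<bar>A i\<bar> \<le> int ((E_max + 1) * (2 ^ E_max * value_max))"
      unfolding A_def by (rule abs_partial_sum_le[OF EE that r_le])
    then show "\<bar>A i\<bar> \<le> int int_max" using int_max_ge(2) by linarith
  qed
  have okW: "val_size (Num (W i)) \<le> S" if "i \<le> E + 1" for i
  proof (rule Num_ok)
    have "\<bar>int j ^ E\<bar> \<le> int (E_max ^ E_max)" if "j \<le> E" for j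
      using p_le[OF that] by (simp flip: of_nat_power)
    then have "\<bar>W i\<bar> \<le> int ((E_max + 1) * (2 ^ E_max * E_max ^ E_max))"
      unfolding W_def by (intro abs_partial_sum_le[OF EE that])
    then show "\<bar>W i\<bar> \<le> int int_max" using int_max_ge(3) by linarith
  qed
  have okC: "val_size (Num (sign_binomial E i)) \<le> S" for i
    using abs_sign_binomial_le[OF EE, of i] two_power_le_int_max by (intro Num_ok) linarith
  have ok_cnt: "val_size (Num (int i)) \<le> S" if "i \<le> E + 2" for i
    using that EE by (intro counter_ok) simp
  have loop: "terminates (While (Less (Reg ''j'') (Add (Reg ''E'') (Lit 1))) sample_body) ((E + 1) * (?N + 1) + 1)
    (\<lambda>s'. frame ?W s s' \<and> s' ''A'' = Num (A (E + 1)) \<and> s' ''W'' = Num (W (E + 1))) s'"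
    if "bounded s'" "?I 0 s'" for s'
  proof (rule terminates_While[where I = ?I, OF _ that])
    fix i s' assume b': "bounded s'" and I: "?I i s'"
      and cond: "eval (Less (Reg ''j'') (Add (Reg ''E'') (Lit 1))) s' \<noteq> Num 0"
    have fr: "frame ?W s s'" using I by blast
    have regs: "s' ''p'' = s ''p''" "s' ''c'' = s ''c''" "s' ''k'' = s ''k''" "s' ''E'' = s ''E''" "s' ''out'' = s ''out''"
      using fr by (simp_all add: frame_def)
    have cur: "s' ''A'' = Num (A i)" "s' ''W'' = Num (W i)" "s' ''C'' = Num (sign_binomial E i)" "s' ''j'' = Num (int i)"
      using I by blast+
    have lt: "i \<le> E" using cond cur(4) regs(4) E by auto
    have ok: "val_size (Num (A (Suc i))) \<le> S" "val_size (Num (W (Suc i))) \<le> S" "val_size (Num (1 + int i)) \<le> S"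
      "val_size (Num (int i)) \<le> S" "val_size (Num (int E)) \<le> S"
      using okA[of "Suc i"] okW[of "Suc i"] ok_cnt[of "Suc i"] ok_cnt[of i] ok_cnt[of E] lt by simp_all
    have stepA: "A i + sign_binomial E i * r i = A (Suc i)" by (simp add: A_def)
    have stepW: "W i + sign_binomial E i * int (i ^ E) = W (Suc i)" by (simp add: W_def)
    have stepC: "(- sign_binomial E i * (int E - int i)) div (1 + int i) = sign_binomial E (Suc i)"
      by (rule sign_binomial_Suc[OF lt])
    have body3: "terminates sample_body3 ?N3 (?I (Suc i)) s2"
      if "bounded s2" "frame ?W s s2" "s2 ''A'' = Num (A (Suc i))" "s2 ''W'' = Num (W i)"
        "s2 ''C'' = Num (sign_binomial E i)" "s2 ''j'' = Num (int i)" "s2 ''r'' = Num (int (i ^ E))"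
        "s2 ''E'' = Num (int E)" for s2
      unfolding sample_body3_def
      by (intro terminates_Comp terminates_Assign bounded_upd)
         (use that ok okC lt stepW stepC in \<open>simp_all add: frame_upd add.commute del: of_nat_power\<close>)
    have body2: "terminates sample_body2 ?N2 (?I (Suc i)) s2"
      if "bounded s2" "frame ?W s s2" "s2 ''A'' = Num (A i)" "s2 ''W'' = Num (W i)"
        "s2 ''C'' = Num (sign_binomial E i)" "s2 ''j'' = Num (int i)" "s2 ''R'' = Num (r i)"
        "s2 ''E'' = Num (int E)" for s2
      unfolding sample_body2_def
      by (intro terminates_Comp terminates_Assign bounded_upd order_refl
            terminates_mono[OF pow_com_ok[where b = i and e = E and M = E_max]] body3)
         (use that ok okC lt stepA EE p_le[OF lt] power_E_le_int_max in \<open>simp_all add: frame_def del: of_nat_power\<close>)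
    have body1: "terminates sample_body1 ?N1 (?I (Suc i)) s2"
      if "bounded s2" "frame ?W s s2" "s2 ''A'' = Num (A i)" "s2 ''W'' = Num (W i)"
        "s2 ''C'' = Num (sign_binomial E i)" "s2 ''j'' = Num (int i)" "s2 ''P'' = val_of_nats (pt i)"
        "s2 ''E'' = Num (int E)" "s2 ''out'' = expansion_val vs" for s2
      unfolding sample_body1_def
      by (intro terminates_Comp order_refl
            terminates_mono[OF residual_com_ok[where x = "pt i" and vs = vs]] body2)
         (use that pt[OF lt] out(2) sub in \<open>simp_all add: frame_def r_def\<close>)
    have "terminates sample_body ?N (?I (Suc i)) s'"
      unfolding sample_body_def
      by (intro terminates_Comp order_refl
            terminates_mono[OF point_com_ok[where q = q and k = k and j = i]] body1)
         (use b' fr regs cur p c k E out q km lt EE in \<open>simp_all add: frame_def pt_def\<close>)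
    then show "i < E + 1 \<and> terminates sample_body ?N (?I (Suc i)) s'" using lt by simp
  next
    fix i s' assume I: "?I i s'" and cond: "eval (Less (Reg ''j'') (Add (Reg ''E'') (Lit 1))) s' = Num 0"
    have "s' ''E'' = Num (int E)" using I E by (simp add: frame_def)
    then have "i = E + 1" using I cond by auto
    then show "frame ?W s s' \<and> s' ''A'' = Num (A (E + 1)) \<and> s' ''W'' = Num (W (E + 1))" using I by blast
  qed simp
  have "terminates sample_com (1 + (1 + (1 + (1 + ((E + 1) * (?N + 1) + 1) + 1) + 1) + 1) + 1)
    (\<lambda>s'. frame ?W s s' \<and> s' ''A'' = Num (A (E + 1)) \<and> s' ''W'' = Num (W (E + 1))) s"
    unfolding sample_com_def
    by (intro terminates_Comp terminates_Assign bounded_upd loop)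
       (use b in \<open>simp_all add: frame_upd frame_refl A_def W_def sign_binomial_def\<close>)
  moreover have "A (E + 1) = alternating_sum E E * power_sum_at q E k"
  proof -
    have "\<Gamma> - set vs = {v \<in> \<Gamma>. code_weight (d + 1) q n v \<le> E}"
      unfolding out(3) by (auto simp only: not_less mem_Collect_eq Diff_iff)
    then have "A (E + 1) = (\<Sum>j\<le>E. (-1) ^ j * int (E choose j) *
        residual {v \<in> \<Gamma>. code_weight (d + 1) q n v \<le> E} (sample_point n (d + 1) q k j))"
      unfolding A_def r_def pt_def sign_binomial_def Suc_eq_plus1[symmetric] lessThan_Suc_atMost by (simp only:)
    then show ?thesis by (simp only: alternating_sum_residual[OF q(1)])
  qed
  moreover have "W (E + 1) = alternating_sum E E"
    unfolding W_def sign_binomial_def alternating_sum_def Suc_eq_plus1[symmetric] lessThan_Suc_atMost ..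
  moreover have "1 + (1 + (1 + (1 + ((E + 1) * (?N + 1) + 1) + 1) + 1) + 1) + 1 \<le> N_sample"
  proof -
    have "(E + 1) * (?N + 1) \<le> (E_max + 1) * (N_point + N_residual + 4 * E_max + 30)"
      using EE by (intro mult_le_mono) simp_all
    then show ?thesis unfolding N_sample_def by linarith
  qed
  ultimately show ?thesis by (simp add: terminates_le)
qed

section \<open>Testing one level\<close>

lemma terminates_Cond_Assign:
  assumes "bounded s" "cost_factor b \<le> 100" "cost_factor e \<le> 100" "val_size (eval e s) \<le> S"
    and "\<And>s'. bounded s' \<Longrightarrow> s' = s(x := if eval b s \<noteq> Num 0 then eval e s else s x) \<Longrightarrow> terminates c N Q s'"
  shows "terminates (Cond b (Assign x e) Skip ;; c) ((1 + 1 + 1) + N + 1) Q s"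
proof (rule terminates_Seq)
  show "terminates (Cond b (Assign x e) Skip) (1 + 1 + 1)
    (\<lambda>s'. s' = s(x := if eval b s \<noteq> Num 0 then eval e s else s x)) s"
    by (intro terminates_Cond terminates_Assign terminates_Skip) (use assms in auto)
qed (use assms(5) in blast)

abbreviation (input) collect_regs :: "string set" where
  "collect_regs \<equiv> {''P'', ''X'', ''Z'', ''b'', ''e'', ''r'', ''D'', ''R'', ''L'', ''V'', ''A'', ''W'', ''C'', ''j'',
     ''x'', ''y'', ''z'', ''h'', ''l'', ''k''}"

text \<open>The sampled sums keep the nonzero factor \<open>alternating_sum E E\<close>. The tests
  for vanishing and for a cross-multiplied geometric sequence are homogeneous, so the factor is
  divided out only when a term is decoded.\<close>

definition level_value :: "nat \<Rightarrow> nat \<Rightarrow> nat \<Rightarrow> int" where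
  "level_value q E k = alternating_sum E E * power_sum_at q E k"

definition some_nonzero :: "nat \<Rightarrow> nat \<Rightarrow> nat \<Rightarrow> bool" where
  "some_nonzero q E k \<longleftrightarrow> (\<exists>j<k. level_value q E j \<noteq> 0)"

definition geometric :: "nat \<Rightarrow> nat \<Rightarrow> nat \<Rightarrow> bool" where
  "geometric q E k \<longleftrightarrow> (\<forall>j. Suc j < k \<longrightarrow>
     level_value q E (Suc j) * level_value q E 0 = level_value q E j * level_value q E 1)"

lemma some_nonzero_Suc: "some_nonzero q E (Suc k) \<longleftrightarrow> some_nonzero q E k \<or> level_value q E k \<noteq> 0"
  unfolding some_nonzero_def using less_Suc_eq by auto

lemma geometric_Suc:
  "geometric q E (Suc (Suc k)) \<longleftrightarrow> geometric q E (Suc k) \<and>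
     level_value q E (Suc k) * level_value q E 0 = level_value q E k * level_value q E 1"
  unfolding geometric_def using less_Suc_eq by auto

lemma geometric_1 [simp]: "geometric q E 0" "geometric q E (Suc 0)"
  by (auto simp: geometric_def)

definition N_collect :: nat where "N_collect = (m + 1) * (N_sample + 30) + 10"

lemma collect_com_ok:
  assumes b: "bounded s" and p: "s ''p'' = val_of_nats (rev (map (base n) [0..<n]))"
    and c: "s ''c'' = val_of_nats (rev (map (w q) [0..<n]))" and mm: "s ''m'' = Num (int m)" and E: "s ''E'' = Num (int E)"
    and out: "s ''out'' = expansion_val vs" "distinct vs" "set vs = {v \<in> \<Gamma>. E < code_weight (d + 1) q n v}"
    and q: "0 < q" "q \<le> q_max" and EE: "E \<le> E_max"
  shows "terminates collect_com N_collect (\<lambda>s'. frame collect_regs s s' \<and>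
     s' ''x'' = Num (level_value q E 0) \<and> s' ''y'' = Num (level_value q E 1) \<and> s' ''W'' = Num (alternating_sum E E) \<and>
     s' ''h'' = val_of_bool (some_nonzero q E (m + 1)) \<and> s' ''l'' = val_of_bool (geometric q E (m + 1))) s"
proof -
  let ?W = "collect_regs" and ?T = "level_value q E"
  \<comment> \<open>\<open>x\<close>, \<open>z\<close> and \<open>W\<close> are meaningful only
    after the first round, and \<open>y\<close> only after the second.\<close>
  let ?I = "\<lambda>k s'. k \<le> m + 1 \<and> frame ?W s s' \<and> s' ''k'' = Num (int k) \<and>
    (0 < k \<longrightarrow> s' ''x'' = Num (?T 0) \<and> s' ''z'' = Num (?T (k - 1)) \<and> s' ''W'' = Num (alternating_sum E E)) \<and>
    (1 < k \<longrightarrow> s' ''y'' = Num (?T 1)) \<and>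
    s' ''h'' = val_of_bool (some_nonzero q E k) \<and> s' ''l'' = val_of_bool (geometric q E k)"
  let ?N1 = "(1 + 1 + 1) + ((1 + 1 + 1) + ((1 + 1 + 1) + ((1 + 1 + 1) + (1 + 1 + 1) + 1) + 1) + 1) + 1"
  let ?N = "N_sample + ?N1 + 1"
  have loop: "terminates (While (Less (Reg ''k'') (Add (Reg ''m'') (Lit 1))) collect_body) ((m + 1) * (?N + 1) + 1)
    (?I (m + 1)) s'" if "bounded s'" "?I 0 s'" for s'
  proof (rule terminates_While[where I = ?I, OF _ that])
    fix k s' assume b': "bounded s'" and I: "?I k s'"
      and cond: "eval (Less (Reg ''k'') (Add (Reg ''m'') (Lit 1))) s' \<noteq> Num 0"
    have fr: "frame ?W s s'" using I by blast
    have regs: "s' ''p'' = s ''p''" "s' ''c'' = s ''c''" "s' ''m'' = s ''m''" "s' ''E'' = s ''E''" "s' ''out'' = s ''out''"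
      using fr by (simp_all add: frame_def)
    have k: "s' ''k'' = Num (int k)" using I by blast
    have km: "k \<le> m" using cond k regs(3) mm by auto
    have okk: "val_size (Num (1 + int k)) \<le> S"
      using counter_ok[of "Suc k"] km counters_le_E_max(4) by simp
    have stage4: "terminates collect_body4 ((1 + 1 + 1) + (1 + 1 + 1) + 1) (?I (Suc k)) s2"
      if s2: "bounded s2" "frame ?W s s2" "s2 ''A'' = Num (?T k)" "s2 ''W'' = Num (alternating_sum E E)"
        "s2 ''k'' = Num (int k)" "s2 ''x'' = Num (?T 0)" "0 < k \<longrightarrow> s2 ''y'' = Num (?T 1)"
        "s2 ''h'' = val_of_bool (some_nonzero q E k)" "s2 ''l'' = val_of_bool (geometric q E (Suc k))" for s2
      unfolding collect_body4_def
    proof (rule terminates_Cond_Assign)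
      fix s3 assume "bounded s3"
        and s3: "s3 = s2(''h'' := if eval (Reg ''A'') s2 \<noteq> Num 0 then eval (Lit 1) s2 else s2 ''h'')"
      have okA: "val_size (Num (?T k)) \<le> S" using s2(1,3) by (metis bounded_def)
      have h: "s3 ''h'' = val_of_bool (some_nonzero q E (Suc k))"
        unfolding s3 using s2 by (simp add: some_nonzero_Suc val_of_bool_def)
      have rest: "frame ?W s s3" "s3 ''A'' = Num (?T k)" "s3 ''W'' = Num (alternating_sum E E)"
        "s3 ''k'' = Num (int k)" "s3 ''x'' = Num (?T 0)" "0 < k \<longrightarrow> s3 ''y'' = Num (?T 1)"
        "s3 ''l'' = val_of_bool (geometric q E (Suc k))"
        unfolding s3 using s2 by (simp_all add: frame_upd)
      show "terminates (Assign ''z'' (Reg ''A'') ;; Assign ''k'' (Add (Reg ''k'') (Lit 1))) (1 + 1 + 1) (?I (Suc k)) s3"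
        by (intro terminates_Comp terminates_Assign bounded_upd)
           (use \<open>bounded s3\<close> okA okk h rest km in \<open>simp_all add: frame_upd add.commute\<close>)
    qed (use s2 in simp_all)
    have stage3: "terminates collect_body3
        ((1 + 1 + 1) + ((1 + 1 + 1) + (1 + 1 + 1) + 1) + 1) (?I (Suc k)) s2"
      if s2: "bounded s2" "frame ?W s s2" "s2 ''A'' = Num (?T k)" "s2 ''W'' = Num (alternating_sum E E)"
        "s2 ''k'' = Num (int k)" "s2 ''x'' = Num (?T 0)" "0 < k \<longrightarrow> s2 ''y'' = Num (?T 1)"
        "0 < k \<longrightarrow> s2 ''z'' = Num (?T (k - 1))"
        "s2 ''h'' = val_of_bool (some_nonzero q E k)" "s2 ''l'' = val_of_bool (geometric q E k)" for s2
      unfolding collect_body3_def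
    proof (rule terminates_Cond_Assign)
      let ?b = "Mul (Reg ''k'') (Sub (Mul (Reg ''A'') (Reg ''x'')) (Mul (Reg ''z'') (Reg ''y'')))"
      fix s3 assume "bounded s3"
        and s3: "s3 = s2(''l'' := if eval ?b s2 \<noteq> Num 0 then eval (Lit 0) s2 else s2 ''l'')"
      have l: "s3 ''l'' = val_of_bool (geometric q E (Suc k))"
      proof (cases k)
        case 0
        then show ?thesis unfolding s3 using s2 by simp
      next
        case (Suc k')
        have "eval ?b s2 = Num (int k * (?T k * ?T 0 - ?T k' * ?T 1))"
          using s2 Suc by simp
        then have "eval ?b s2 = Num 0 \<longleftrightarrow> ?T (Suc k') * ?T 0 = ?T k' * ?T 1" using Suc by simp
        then show ?thesis unfolding s3 using s2(10) by (simp add: Suc geometric_Suc val_of_bool_def)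
      qed
      have rest: "frame ?W s s3" "s3 ''A'' = Num (?T k)" "s3 ''W'' = Num (alternating_sum E E)"
        "s3 ''k'' = Num (int k)" "s3 ''x'' = Num (?T 0)" "0 < k \<longrightarrow> s3 ''y'' = Num (?T 1)"
        "s3 ''h'' = val_of_bool (some_nonzero q E k)"
        unfolding s3 using s2 by (simp_all add: frame_upd)
      show "terminates collect_body4 ((1 + 1 + 1) + (1 + 1 + 1) + 1) (?I (Suc k)) s3"
        by (rule stage4[OF \<open>bounded s3\<close> rest l])
    qed (use s2 in simp_all)
    have stage2: "terminates collect_body2
        ((1 + 1 + 1) + ((1 + 1 + 1) + ((1 + 1 + 1) + (1 + 1 + 1) + 1) + 1) + 1) (?I (Suc k)) s2"
      if s2: "bounded s2" "frame ?W s s2" "s2 ''A'' = Num (?T k)" "s2 ''W'' = Num (alternating_sum E E)"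
        "s2 ''k'' = Num (int k)" "s2 ''x'' = Num (?T 0)" "1 < k \<longrightarrow> s2 ''y'' = Num (?T 1)"
        "0 < k \<longrightarrow> s2 ''z'' = Num (?T (k - 1))"
        "s2 ''h'' = val_of_bool (some_nonzero q E k)" "s2 ''l'' = val_of_bool (geometric q E k)" for s2
      unfolding collect_body2_def
    proof (rule terminates_Cond_Assign)
      fix s3 assume "bounded s3"
        and s3: "s3 = s2(''y'' := if eval (Equal (Reg ''k'') (Lit 1)) s2 \<noteq> Num 0 then eval (Reg ''A'') s2 else s2 ''y'')"
      have "0 < k \<longrightarrow> s3 ''y'' = Num (?T 1)"
        unfolding s3 using s2 by (cases "k = 1") simp_all
      then show "terminates collect_body3
        ((1 + 1 + 1) + ((1 + 1 + 1) + (1 + 1 + 1) + 1) + 1) (?I (Suc k)) s3"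
        by (intro stage3) (use \<open>bounded s3\<close> s2 in \<open>simp_all add: s3 frame_upd\<close>)
    next
      show "val_size (eval (Reg ''A'') s2) \<le> S" using s2(1) by (simp add: bounded_def)
    qed (use s2 in simp_all)
    have body1: "terminates collect_body1 ?N1 (?I (Suc k)) s2"
      if s2: "bounded s2" "frame sample_regs s' s2" "s2 ''A'' = Num (?T k)" "s2 ''W'' = Num (alternating_sum E E)" for s2
      unfolding collect_body1_def
    proof (rule terminates_Cond_Assign)
      have r2: "s2 ''k'' = Num (int k)" "s2 ''x'' = s' ''x''" "s2 ''y'' = s' ''y''" "s2 ''z'' = s' ''z''"
        "s2 ''h'' = s' ''h''" "s2 ''l'' = s' ''l''" "frame ?W s s2"
        using s2(2) k by (simp_all add: frame_def) (use fr in \<open>simp add: frame_def\<close>)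
      fix s3 assume "bounded s3"
        and s3: "s3 = s2(''x'' := if eval (Equal (Reg ''k'') (Lit 0)) s2 \<noteq> Num 0 then eval (Reg ''A'') s2 else s2 ''x'')"
      have "s3 ''x'' = Num (?T 0)"
        unfolding s3 using s2 r2 I by (cases "k = 0") simp_all
      then show "terminates collect_body2
        ((1 + 1 + 1) + ((1 + 1 + 1) + ((1 + 1 + 1) + (1 + 1 + 1) + 1) + 1) + 1) (?I (Suc k)) s3"
        by (intro stage2) (use \<open>bounded s3\<close> s2 r2 I in \<open>simp_all add: s3 frame_upd\<close>)
    next
      show "val_size (eval (Reg ''A'') s2) \<le> S" using s2(1) by (simp add: bounded_def)
    qed (use s2 in simp_all)
    have "terminates collect_body ?N (?I (Suc k)) s'"
      unfolding collect_body_def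
      by (intro terminates_Comp order_refl
            terminates_mono[OF sample_com_ok[where q = q and k = k and E = E and vs = vs]] body1)
         (use b' regs k p c E out q km EE in \<open>simp_all add: level_value_def\<close>)
    then show "k < m + 1 \<and> terminates collect_body ?N (?I (Suc k)) s'" using km by simp
  next
    fix k s' assume I: "?I k s'" and cond: "eval (Less (Reg ''k'') (Add (Reg ''m'') (Lit 1))) s' = Num 0"
    have "s' ''m'' = Num (int m)" using I mm by (simp add: frame_def)
    then have eq: "k = m + 1" using I cond by auto
    show "?I (m + 1) s'" using I unfolding eq .
  qed simp
  have "terminates collect_com (1 + (1 + (1 + ((m + 1) * (?N + 1) + 1) + 1) + 1) + 1) (?I (m + 1)) s"
    unfolding collect_com_def
    by (intro terminates_Comp terminates_Assign bounded_upd loop)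
       (use b in \<open>simp_all add: frame_upd frame_refl val_of_bool_def some_nonzero_def\<close>)
  moreover have "1 + (1 + (1 + ((m + 1) * (?N + 1) + 1) + 1) + 1) + 1 \<le> N_collect"
  proof -
    have "(m + 1) * (?N + 1) \<le> (m + 1) * (N_sample + 30)" by (intro mult_le_mono) simp_all
    then show ?thesis unfolding N_collect_def by linarith
  qed
  \<comment> \<open>\<open>0 < m\<close> guarantees a second round, so that \<open>y\<close> has
    been set.\<close>
  ultimately show ?thesis
    using m_pos by (elim terminates_mono) auto
qed


section \<open>Decoding a single term\<close>

lemma node_le:
  assumes "v \<in> \<Gamma>" "l \<le> n"
  shows "node n l v \<le> int_max"
proof -
  have "node n l v \<le> (\<Prod>i<l. p_max ^ v ! i)"
    unfolding node_def using base_le_p_max assms(2) by (intro prod_mono) (auto intro!: power_mono)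
  also have "\<dots> = p_max ^ (\<Sum>i<l. v ! i)" by (simp add: power_sum)
  also have "(\<Sum>i<l. v ! i) \<le> (\<Sum>i<n. v ! i)" using assms(2) by (intro sum_mono2) auto
  also have "\<dots> = sum_list v" using length_\<Gamma>[OF assms(1)] by (simp add: sum_list_sum_nth lessThan_atLeast0)
  also have "\<dots> \<le> d" by (rule sum_list_le_d[OF assms(1)])
  finally have "node n l v \<le> p_max ^ d" using factors_pos by (simp add: power_increasing)
  then show ?thesis using node_le_int_max by simp
qed

text \<open>Bases are removed from the last index down. What remains after \<open>v ! l\<close>
  divisions is coprime to the base, which is at least 2, so the divisibility test fails exactly
  then.\<close>

lemma divide_com_ok:
  assumes b: "bounded s" and B: "s ''B'' = Num (int (node n (Suc l) v))" and g: "s ''g'' = Num (int (base n l))"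
    and i: "s ''i'' = Num 0" and l: "l < n" and v: "v \<in> \<Gamma>"
  shows "terminates divide_com (4 * d + 1)
    (\<lambda>s'. frame {''B'', ''i''} s s' \<and> s' ''B'' = Num (int (node n l v)) \<and> s' ''i'' = Num (int (v ! l))) s"
proof -
  let ?W = "{''B'', ''i''}" and ?b = "base n l" and ?t = "v ! l"
  define B where "B t = node n l v * ?b ^ (?t - t)" for t
  let ?I = "\<lambda>t s'. t \<le> ?t \<and> frame ?W s s' \<and> s' ''B'' = Num (int (B t)) \<and> s' ''i'' = Num (int t)"
  have td: "?t \<le> d" by (rule nth_le_d[OF v l])
  have B0: "B 0 = node n (Suc l) v" by (simp add: B_def node_Suc)
  have Bt: "B ?t = node n l v" by (simp add: B_def)
  have BSuc: "B t = B (Suc t) * ?b" if "t < ?t" for t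
  proof -
    have "?t - t = Suc (?t - Suc t)" using that by simp
    then show ?thesis by (simp only: B_def power_Suc mult_ac)
  qed
  have B_le: "B t \<le> int_max" for t
  proof -
    have "B t \<le> B 0" unfolding B_def using base_ge_2[of n l] by (intro mult_le_mono2 power_increasing) auto
    then show ?thesis unfolding B0 using node_le[OF v, of "Suc l"] l by simp
  qed
  have stop: "int (node n l v) mod int ?b \<noteq> 0"
  proof
    assume "int (node n l v) mod int ?b = 0"
    then have "?b dvd node n l v" by (simp add: dvd_eq_mod_eq_0 flip: zmod_int of_nat_eq_0_iff)
    then have "?b = 1" using coprime_base_node[OF l, of v] by (metis coprime_absorb_left nat_dvd_1_iff_1)
    then show False using base_ge_2[of n l] by simp
  qed
  have "terminates divide_com (?t * ((1 + 1 + 1) + 1) + 1)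
    (\<lambda>s'. frame ?W s s' \<and> s' ''B'' = Num (int (node n l v)) \<and> s' ''i'' = Num (int ?t)) s"
    unfolding divide_com_def
  proof (rule terminates_While[where I = ?I, OF _ b])
    show "?I 0 s" using assms by (simp add: frame_refl B0)
  next
    fix t s' assume t: "t \<le> ?t" and b': "bounded s'" and I: "?I t s'"
      and cond: "eval (Equal (Mod (Reg ''B'') (Reg ''g'')) (Lit 0)) s' \<noteq> Num 0"
    have g': "s' ''g'' = Num (int ?b)" using I g by (simp add: frame_def)
    have regs: "s' ''B'' = Num (int (B t))" "s' ''i'' = Num (int t)" "frame ?W s s'" using I by blast+
    have "t \<noteq> ?t"
    proof
      assume "t = ?t"
      then show False using cond stop regs g' Bt by simp
    qed
    then have lt: "t < ?t" using t by simp
    have dv: "int (B t) div int ?b = int (B (Suc t))"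
      using BSuc[OF lt] base_ge_2[of n l] by simp
    have ok: "val_size (Num (int (B (Suc t)))) \<le> S" "val_size (Num (1 + int t)) \<le> S"
      using nat_ok[OF B_le] counter_ok[of "Suc t"] lt td counters_le_E_max(6) by simp_all
    have "terminates divide_body (1 + 1 + 1) (?I (Suc t)) s'"
      unfolding divide_body_def
      by (intro terminates_Comp terminates_Assign bounded_upd)
         (use b' regs g' dv ok lt in \<open>simp_all add: frame_upd add.commute\<close>)
    then show "t < ?t \<and> terminates divide_body (1 + 1 + 1) (?I (Suc t)) s'" using lt by blast
  next
    fix t s' assume t: "t \<le> ?t" and I: "?I t s'"
      and cond: "eval (Equal (Mod (Reg ''B'') (Reg ''g'')) (Lit 0)) s' = Num 0"
    have g': "s' ''g'' = Num (int ?b)" using I g by (simp add: frame_def)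
    have regs: "s' ''B'' = Num (int (B t))" "s' ''i'' = Num (int t)" "frame ?W s s'" using I by blast+
    have "t = ?t"
    proof (rule ccontr)
      assume "t \<noteq> ?t"
      then have "int (B t) mod int ?b = 0" using BSuc[of t] t by simp
      then show False using cond regs g' by simp
    qed
    then show "frame ?W s s' \<and> s' ''B'' = Num (int (node n l v)) \<and> s' ''i'' = Num (int ?t)"
      using regs Bt by simp
  qed simp
  then show ?thesis by (rule terminates_le) (use td in simp)
qed

definition N_digits :: nat where "N_digits = n * (4 * d + 20) + 10"

lemma digits_com_ok:
  assumes b: "bounded s" and X: "s ''X'' = val_of_nats (rev (map (base n) [0..<n]))"
    and B: "s ''B'' = Num (int (node n n v))" and vr: "s ''v'' = Lst []" and v: "v \<in> \<Gamma>"
  shows "terminates digits_com N_digits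
    (\<lambda>s'. frame {''B'', ''i'', ''g'', ''v'', ''X''} s s' \<and> s' ''v'' = val_of_nats v) s"
proof -
  let ?W = "{''B'', ''i'', ''g'', ''v'', ''X''}"
  let ?J = "\<lambda>i s'. i \<le> n \<and> frame ?W s s' \<and> s' ''X'' = val_of_nats (rev (map (base n) [0..<n - i])) \<and>
    s' ''B'' = Num (int (node n (n - i) v)) \<and> s' ''v'' = val_of_nats (drop (n - i) v)"
  let ?N = "1 + (1 + ((4 * d + 1) + (1 + 1 + 1) + 1) + 1) + 1"
  have len: "length v = n" by (rule length_\<Gamma>[OF v])
  have "terminates digits_com (n * (?N + 1) + 1) (\<lambda>s'. frame ?W s s' \<and> s' ''v'' = val_of_nats v) s"
    unfolding digits_com_def
  proof (rule terminates_While[where I = ?J, OF _ b])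
    show "?J 0 s" using X B vr len by (simp add: frame_refl val_of_nats_Nil_iff)
  next
    fix i s' assume b': "bounded s'" and I: "?J i s'" and "eval (Nonempty (Reg ''X'')) s' \<noteq> Num 0"
    then have lt: "i < n" by (auto simp: val_of_nats_Nil_iff)
    define l where "l = n - Suc i"
    have l: "n - i = Suc l" "n - Suc i = l" "l < n" using lt by (simp_all add: l_def)
    have fr: "frame ?W s s'" and X': "s' ''X'' = val_of_nats (base n l # rev (map (base n) [0..<l]))"
      and B': "s' ''B'' = Num (int (node n (Suc l) v))"
      and v': "s' ''v'' = val_of_nats (drop (Suc l) v)" using I l by auto
    have dr: "drop l v = v ! l # drop (Suc l) v" using l(3) len by (simp add: Cons_nth_drop_Suc)
    have vd: "x \<le> int_max" if "x \<in> set v" for x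
    proof -
      obtain i where "i < n" "x = v ! i" using \<open>x \<in> set v\<close> len by (auto simp: in_set_conv_nth)
      then have "x \<le> d" using nth_le_d[OF v] by simp
      then show ?thesis using counters_le_E_max(6) counter_le_int_max by linarith
    qed
    have ok1: "val_size (Num (int (base n l))) \<le> S" by (rule nat_ok[OF base_le_int_max[OF l(3)]])
    have "val_size (val_of_nats (drop l v)) \<le> S"
      using len vd by (intro nats_ok) (auto dest: in_set_dropD)
    then have ok2: "val_size (val_of_nats (v ! l # drop (Suc l) v)) \<le> S" by (simp only: dr)
    have ok3: "val_size (val_of_nats (rev (map (base n) [0..<l]))) \<le> S"
      using l(3) base_le_int_max by (intro nats_ok) auto
    have body1: "terminates decode_body1 (1 + 1 + 1) (?J (Suc i)) s2"
      if "bounded s2" "frame ?W s s2" "s2 ''X'' = s' ''X''" "s2 ''B'' = Num (int (node n l v))"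
        "s2 ''i'' = Num (int (v ! l))" "s2 ''v'' = s' ''v''" for s2
      unfolding decode_body1_def l(2)
      by (intro terminates_Comp terminates_Assign bounded_upd)
         (use that X' v' ok1 ok2 ok3 lt dr in \<open>simp_all add: frame_upd\<close>)
    have "terminates decode_body ?N (?J (Suc i)) s'"
      unfolding decode_body_def
      by (intro terminates_Comp terminates_Assign bounded_upd order_refl
            terminates_mono[OF divide_com_ok[where l = l and v = v]] body1)
         (use b' fr X' B' v' ok1 l(3) v in \<open>simp_all add: frame_def\<close>)
    then show "i < n \<and> terminates decode_body ?N (?J (Suc i)) s'" using lt by blast
  next
    fix i s' assume I: "?J i s'" and "eval (Nonempty (Reg ''X'')) s' = Num 0"
    then have "n - i = 0" by (auto simp: val_of_nats_Nil_iff)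
    then show "frame ?W s s' \<and> s' ''v'' = val_of_nats v" using I by simp
  qed simp
  moreover have "n * (?N + 1) + 1 \<le> N_digits"
  proof -
    have "n * (?N + 1) \<le> n * (4 * d + 20)" by (intro mult_le_mono2) simp
    then show ?thesis unfolding N_digits_def by linarith
  qed
  ultimately show ?thesis by (rule terminates_le)
qed

definition N_decode :: nat where "N_decode = N_digits + 20"

lemma decode_com_ok:
  assumes b: "bounded s" and x: "s ''x'' = Num (W * a v)" and y: "s ''y'' = Num (W * (a v * int (node n n v)))"
    and W: "s ''W'' = Num W" "W \<noteq> 0" and p: "s ''p'' = val_of_nats (rev (map (base n) [0..<n]))"
    and v: "v \<in> \<Gamma>" and out: "s ''out'' = expansion_val vs" "distinct (v # vs)" "set (v # vs) \<subseteq> \<Gamma>"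
  shows "terminates decode_com N_decode (\<lambda>s'. frame {''a'', ''B'', ''i'', ''g'', ''v'', ''X'', ''out''} s s' \<and>
     s' ''out'' = expansion_val (v # vs)) s"
proof -
  let ?W = "{''a'', ''B'', ''i'', ''g'', ''v'', ''X'', ''out''}"
  have da: "W * a v div W = a v" using W by simp
  have dB: "W * (a v * int (node n n v)) div (W * a v) = int (node n n v)"
    using W a_nonzero[OF v] by (simp flip: mult.assoc)
  have "coeff_sum * 1 \<le> (coeff_sum + 1) * (schubert_norm_bound n d * point_max ^ d)"
    using factors_pos by (intro mult_le_mono) (auto simp: Suc_le_eq)
  then have "\<bar>a v\<bar> \<le> int value_max"
    using abs_a_le[OF v] unfolding value_max_def by linarith
  then have ok: "val_size (Num (a v)) \<le> S" "val_size (Num (int (node n n v))) \<le> S"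
    "val_size (val_of_nats (rev (map (base n) [0..<n]))) \<le> S" "val_size (expansion_val (v # vs)) \<le> S"
    using value_Num_ok nat_ok[OF node_le[OF v]] expansion_val_ok[OF out(2,3)] base_le_int_max
    by (auto intro!: nats_ok)
  have eq: "Lst (Lst [val_of_nats v, Num (a v)] # map (\<lambda>v. Lst [val_of_nats v, Num (a v)]) vs) = expansion_val (v # vs)"
    by (simp add: expansion_val_def del: Lst_expansion_val)
  have out2: "terminates output_com 1 (\<lambda>s'. frame ?W s s' \<and> s' ''out'' = expansion_val (v # vs)) s2"
    if "bounded s2" "frame ?W s s2" "s2 ''v'' = val_of_nats v" "s2 ''a'' = Num (a v)" "s2 ''out'' = expansion_val vs" for s2
    unfolding output_com_def
    by (intro terminates_Assign) (use that ok eq in \<open>simp_all add: frame_upd\<close>)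
  have "terminates decode_com (1 + (1 + (1 + (1 + (N_digits + 1 + 1) + 1) + 1) + 1) + 1)
    (\<lambda>s'. frame ?W s s' \<and> s' ''out'' = expansion_val (v # vs)) s"
    unfolding decode_com_def
    by (intro terminates_Comp terminates_Assign bounded_upd order_refl
          terminates_mono[OF digits_com_ok[where v = v]] out2)
       (use b x y W p v out(1) ok da dB in \<open>simp_all add: frame_def\<close>)
  then show ?thesis by (rule terminates_le) (simp add: N_decode_def)
qed

section \<open>Processing levels and moduli\<close>

abbreviation (input) level_regs :: "string set" where
  "level_regs \<equiv> {''P'', ''X'', ''Z'', ''b'', ''e'', ''r'', ''D'', ''R'', ''L'', ''V'', ''A'', ''W'', ''C'', ''j'',
     ''x'', ''y'', ''z'', ''h'', ''l'', ''k'', ''a'', ''B'', ''i'', ''g'', ''v'', ''out'', ''o''}"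

lemma alternating_sum_nonzero: "alternating_sum E E \<noteq> 0"
  by (simp add: alternating_sum_eq)

text \<open>If the weights separate the codes, a nonempty level has one code. Its values
  \<open>W * a * b^k\<close> are geometric with a nonzero first member, so a failed test proves a
  collision.\<close>

lemma not_inj_level:
  assumes "some_nonzero q E (m + 1)" "\<not> geometric q E (m + 1) \<or> level_value q E 0 = 0"
  shows "\<not> inj_on (code_weight (d + 1) q n) \<Gamma>"
proof
  assume inj: "inj_on (code_weight (d + 1) q n) \<Gamma>"
  have "level q E \<noteq> {}"
  proof
    assume "level q E = {}"
    then have "level_value q E k = 0" for k by (simp add: level_value_def power_sum_at_def)
    then show False using assms(1) by (simp add: some_nonzero_def)
  qed
  then obtain v where v: "v \<in> level q E" by blast
  then have "level q E = {v}" using inj by (auto simp: level_def inj_on_def)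
  then have T: "level_value q E k = alternating_sum E E * (a v * int (node n n v) ^ k)" for k
    by (simp add: level_value_def power_sum_at_def)
  have "level_value q E 0 \<noteq> 0"
    using alternating_sum_nonzero a_nonzero v by (simp add: T level_def)
  moreover have "geometric q E (m + 1)" by (simp add: geometric_def T)
  ultimately show False using assms(2) by blast
qed

lemma insert_level:
  "{v \<in> \<Gamma>. E \<le> code_weight (d + 1) q n v} = level q E \<union> {v \<in> \<Gamma>. E < code_weight (d + 1) q n v}"
  by (auto simp: level_def)

text \<open>The first alternative records that a collision has been proved, which later shows that a
  separating modulus is never discarded. The predicate selects the codes whose terms are already in
  \<open>out\<close>.\<close>

definition level_post :: "nat \<Rightarrow> (nat list \<Rightarrow> bool) \<Rightarrow> state \<Rightarrow> bool" where
  "level_post q P s \<longleftrightarrow> (s ''o'' = Num 0 \<and> \<not> inj_on (code_weight (d + 1) q n) \<Gamma>) \<or>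
     (s ''o'' = Num 1 \<and> (\<exists>vs. s ''out'' = expansion_val vs \<and> distinct vs \<and> set vs = {v \<in> \<Gamma>. P v}))"

definition N_level :: nat where "N_level = N_collect + N_decode + 20"

lemma level_com_ok:
  assumes b: "bounded s" and p: "s ''p'' = val_of_nats (rev (map (base n) [0..<n]))"
    and c: "s ''c'' = val_of_nats (rev (map (w q) [0..<n]))" and mm: "s ''m'' = Num (int m)" and E: "s ''E'' = Num (int E)"
    and o: "s ''o'' = Num 1"
    and out: "s ''out'' = expansion_val vs" "distinct vs" "set vs = {v \<in> \<Gamma>. E < code_weight (d + 1) q n v}"
    and q: "0 < q" "q \<le> q_max" and EE: "E \<le> E_max"
  shows "terminates level_com N_level (\<lambda>s'. frame level_regs s s' \<and>
     level_post q (\<lambda>v. E \<le> code_weight (d + 1) q n v) s') s"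
proof -
  let ?T = "level_value q E" and ?W = "alternating_sum E E"
  let ?Q = "\<lambda>s'. frame level_regs s s' \<and> level_post q (\<lambda>v. E \<le> code_weight (d + 1) q n v) s'"
  have rest: "terminates level_com1 ((N_decode + 1 + 1) + 1 + 1) ?Q s2"
    if s2: "bounded s2" "frame collect_regs s s2" "s2 ''x'' = Num (?T 0)" "s2 ''y'' = Num (?T 1)" "s2 ''W'' = Num ?W"
      "s2 ''h'' = val_of_bool (some_nonzero q E (m + 1))" "s2 ''l'' = val_of_bool (geometric q E (m + 1))" for s2
    unfolding level_com1_def
  proof (intro terminates_Cond)
    have fr: "frame level_regs s s2" using s2(2) by (simp add: frame_def)
    have keep: "s2 ''out'' = expansion_val vs" "s2 ''o'' = Num 1" "s2 ''p'' = s ''p''"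
      using s2(2) out o by (simp_all add: frame_def)
    {
      assume h: "eval (Reg ''h'') s2 = Num 0"
      then have zero: "?T k = 0" if "k \<le> m" for k using that s2(6) by (auto simp: some_nonzero_def)
      then have "level q E = {}"
        using alternating_sum_nonzero by (intro level_empty) (auto simp: level_value_def)
      then have "level_post q (\<lambda>v. E \<le> code_weight (d + 1) q n v) s2"
        unfolding level_post_def insert_level using keep out by auto
      then show "terminates Skip 1 ?Q s2" using s2(1) fr by (intro terminates_Skip) auto
    next
      assume h: "eval (Reg ''h'') s2 \<noteq> Num 0" and l: "eval (Mul (Reg ''l'') (Reg ''x'')) s2 = Num 0"
      have "\<not> inj_on (code_weight (d + 1) q n) \<Gamma>"
        using h l s2 by (intro not_inj_level[of q E]) (auto simp: val_of_bool_def split: if_splits)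
      then show "terminates (Assign ''o'' (Lit 0)) 1 ?Q s2"
        using s2(1) fr by (intro terminates_Assign) (simp_all add: frame_upd level_post_def)
    next
      assume h: "eval (Reg ''h'') s2 \<noteq> Num 0" and l: "eval (Mul (Reg ''l'') (Reg ''x'')) s2 \<noteq> Num 0"
      have geo: "geometric q E (m + 1)" and T0: "?T 0 \<noteq> 0"
        using l s2 by (auto simp: val_of_bool_def split: if_splits)
      have "\<exists>v. level q E = {v}"
      proof (rule level_singleton)
        show "power_sum_at q E 0 \<noteq> 0" using T0 by (auto simp: level_value_def)
        fix k assume "k < m"
        then have "?T (Suc k) * ?T 0 = ?T k * ?T 1" using geo by (simp add: geometric_def)
        \<comment> \<open>Both sides of the cross-multiplied relation contain the level factor
          squared, which is cancelled.\<close>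
        then have "(?W * ?W) * (power_sum_at q E (Suc k) * power_sum_at q E 0)
          = (?W * ?W) * (power_sum_at q E k * power_sum_at q E 1)"
          unfolding level_value_def by (simp only: mult_ac)
        then show "power_sum_at q E (Suc k) * power_sum_at q E 0 = power_sum_at q E k * power_sum_at q E 1"
          using alternating_sum_nonzero by (metis mult_cancel_left mult_eq_0_iff)
      qed
      then obtain v where lv: "level q E = {v}" by blast
      then have v: "v \<in> \<Gamma>" "code_weight (d + 1) q n v = E" by (auto simp: level_def)
      have T: "?T 0 = ?W * a v" "?T 1 = ?W * (a v * int (node n n v))"
        by (simp_all add: level_value_def power_sum_at_def lv)
      have vs: "distinct (v # vs)" "set (v # vs) \<subseteq> \<Gamma>" using out(2,3) v by auto
      have dec: "terminates decode_com N_decode (\<lambda>s'. frame {''a'', ''B'', ''i'', ''g'', ''v'', ''X'', ''out''} s2 s' \<and>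
         s' ''out'' = expansion_val (v # vs)) s2"
        using s2 T alternating_sum_nonzero keep p v vs by (intro decode_com_ok[where W = ?W]) simp_all
      show "terminates decode_com N_decode ?Q s2"
      proof (rule terminates_mono[OF dec])
        fix s' assume s': "frame {''a'', ''B'', ''i'', ''g'', ''v'', ''X'', ''out''} s2 s' \<and>
         s' ''out'' = expansion_val (v # vs)"
        have "frame level_regs s s'" using s' fr by (simp add: frame_def)
        moreover have "s' ''o'' = Num 1" using s' keep(2) by (simp add: frame_def)
        moreover have "set (v # vs) = {u \<in> \<Gamma>. E \<le> code_weight (d + 1) q n u}"
          unfolding insert_level lv using out(3) by simp
        ultimately show "?Q s'" using s' vs(1) unfolding level_post_def by blast
      qed simp
    }
  qed (use s2 in simp_all)
  have "terminates level_com (N_collect + ((N_decode + 1 + 1) + 1 + 1) + 1) ?Q s"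
    unfolding level_com_def
    by (intro terminates_Comp order_refl
          terminates_mono[OF collect_com_ok[where q = q and E = E and vs = vs]] rest)
       (use b p c mm E out q EE in simp_all)
  then show ?thesis by (rule terminates_le) (simp add: N_level_def)
qed

definition N_attempt :: nat where "N_attempt = (E_max + 1) * (N_level + 10) + 6 * n + 50"

lemma attempt_com_ok:
  assumes b: "bounded s" and p: "s ''p'' = val_of_nats (rev (map (base n) [0..<n]))"
    and nn: "s ''n'' = Num (int n)" and dd: "s ''d'' = Num (int d)" and mm: "s ''m'' = Num (int m)"
    and qq: "s ''q'' = Num (int q)" and qm: "Suc q \<le> q_max"
  shows "terminates attempt_com N_attempt (\<lambda>s'. s' ''p'' = s ''p'' \<and> s' ''n'' = s ''n'' \<and> s' ''d'' = s ''d'' \<and>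
     s' ''m'' = s ''m'' \<and> s' ''q'' = Num (int (Suc q)) \<and> level_post (Suc q) (\<lambda>v. True) s') s"
proof -
  define D where "D = d * n * Suc q"
  let ?q = "Suc q" and ?cw = "code_weight (d + 1) (Suc q) n"
  let ?keep = "\<lambda>s'. s' ''p'' = s ''p'' \<and> s' ''n'' = s ''n'' \<and> s' ''d'' = s ''d'' \<and>
     s' ''m'' = s ''m'' \<and> s' ''q'' = Num (int ?q)"
  \<comment> \<open>Weights are compared as integers because \<open>E\<close> ends at -1.\<close>
  let ?J = "\<lambda>i s'. i \<le> D + 1 \<and> ?keep s' \<and> s' ''c'' = val_of_nats (rev (map (w ?q) [0..<n])) \<and>
    s' ''E'' = Num (int D - int i) \<and> level_post ?q (\<lambda>v. int D - int i < int (?cw v)) s'"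
  let ?Q = "\<lambda>s'. ?keep s' \<and> level_post ?q (\<lambda>v. True) s'"
  let ?N = "(N_level + 1 + 1) + 1 + 1"
  have DE: "D \<le> E_max" unfolding D_def E_max_def using qm by (intro mult_le_mono2)
  have loop: "terminates (While (Less (Lit (-1)) (Reg ''E'')) attempt_body) ((D + 1) * (?N + 1) + 1) ?Q s'"
    if "bounded s'" "?J 0 s'" for s'
  proof (rule terminates_While[where I = ?J, OF _ that])
    fix i s' assume b': "bounded s'" and I: "?J i s'" and cond: "eval (Less (Lit (-1)) (Reg ''E'')) s' \<noteq> Num 0"
    have regs: "?keep s'" "s' ''c'' = val_of_nats (rev (map (w ?q) [0..<n]))" "s' ''E'' = Num (int D - int i)"
      "level_post ?q (\<lambda>v. int D - int i < int (?cw v)) s'" using I by blast+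
    have lt: "i \<le> D" using cond regs(3) by auto
    define E where "E = D - i"
    have E: "int D - int i = int E" "int D - int (Suc i) = int E - 1" using lt by (simp_all add: E_def)
    have EE: "E \<le> E_max" using DE by (simp add: E_def)
    have okE: "val_size (Num (int E - 1)) \<le> S"
      using EE counter_le_int_max by (intro Num_ok) linarith
    have body1: "terminates attempt_body1 1 (?J (Suc i)) s2"
      if "bounded s2" "?keep s2" "s2 ''c'' = s' ''c''" "s2 ''E'' = s' ''E''"
        "level_post ?q (\<lambda>v. E \<le> ?cw v) s2" for s2
      unfolding attempt_body1_def
    proof (intro terminates_Assign)
      have "(\<lambda>v. int D - int (Suc i) < int (?cw v)) = (\<lambda>v. E \<le> ?cw v)"
        unfolding E by (rule ext) linarith
      moreover have "level_post ?q (\<lambda>v. E \<le> ?cw v) (s2(''E'' := eval (Sub (Reg ''E'') (Lit 1)) s2))"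
        using that(5) by (simp add: level_post_def)
      ultimately show "?J (Suc i) (s2(''E'' := eval (Sub (Reg ''E'') (Lit 1)) s2))"
        using that regs lt by (simp only:) simp
    qed (use that okE regs E in simp_all)
    have "terminates attempt_body ?N (?J (Suc i)) s'"
      unfolding attempt_body_def
    proof (intro terminates_Comp terminates_Cond)
      assume "eval (Reg ''o'') s' \<noteq> Num 0"
      then obtain vs where vs: "s' ''o'' = Num 1" "s' ''out'' = expansion_val vs" "distinct vs"
        "set vs = {v \<in> \<Gamma>. E < ?cw v}"
        using regs(4) by (auto simp: level_post_def E)
      have lev: "terminates level_com N_level (\<lambda>s2. frame level_regs s' s2 \<and> level_post ?q (\<lambda>v. E \<le> ?cw v) s2) s'"
        by (rule level_com_ok) (use b' p regs mm vs qm EE E in simp_all)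
      show "terminates level_com N_level (terminates attempt_body1 1 (?J (Suc i))) s'"
      proof (rule terminates_mono[OF lev])
        fix s2 assume s2: "bounded s2" "frame level_regs s' s2 \<and> level_post ?q (\<lambda>v. E \<le> ?cw v) s2"
        then have "s2 ''p'' = s' ''p''" "s2 ''n'' = s' ''n''" "s2 ''d'' = s' ''d''" "s2 ''m'' = s' ''m''"
          "s2 ''q'' = s' ''q''" "s2 ''c'' = s' ''c''" "s2 ''E'' = s' ''E''"
          by (simp_all add: frame_def)
        then show "terminates attempt_body1 1 (?J (Suc i)) s2"
          using s2 regs(1) by (intro body1) auto
      qed simp
    next
      assume o: "eval (Reg ''o'') s' = Num 0"
      then have "level_post ?q (\<lambda>v. E \<le> ?cw v) s'" using regs(4) by (auto simp: level_post_def)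
      then have "terminates attempt_body1 1 (?J (Suc i)) s'" using b' regs(1) by (intro body1) auto
      then show "terminates Skip 1 (terminates attempt_body1 1 (?J (Suc i))) s'"
        using b' by (intro terminates_Skip)
    qed (use b' in simp_all)
    then show "i < D + 1 \<and> terminates attempt_body ?N (?J (Suc i)) s'" using lt by simp
  next
    fix i s' assume I: "?J i s'" and cond: "eval (Less (Lit (-1)) (Reg ''E'')) s' = Num 0"
    then have neg: "int D - int i \<le> -1" by auto
    have "int D - int i < int (?cw v)" for v using neg by linarith
    then have "(\<lambda>v. int D - int i < int (?cw v)) = (\<lambda>v. True)" by blast
    then show "?Q s'" using I by simp
  qed simp
  have rest: "terminates attempt_com1 (1 + (1 + (1 + ((D + 1) * (?N + 1) + 1) + 1) + 1) + 1) ?Q s2"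
    if s2: "bounded s2" "?keep s2" "s2 ''c'' = val_of_nats (rev (map (w ?q) [0..<n]))" for s2
    unfolding attempt_com1_def
  proof (intro terminates_Comp terminates_Assign bounded_upd loop)
    let ?s = "s2(''out'' := Lst [], ''o'' := Num 1, ''E'' := Num (int D))"
    have eqD: "int d * int n * int ?q = int D" unfolding D_def by (simp only: of_nat_mult)
    have okD: "val_size (Num (int D)) \<le> S" using DE by (intro counter_ok) simp
    have st: "s2(''out'' := eval Nil_expr s2, ''o'' := eval (Lit 1) (s2(''out'' := eval Nil_expr s2)),
       ''E'' := eval (Mul (Mul (Reg ''d'') (Reg ''n'')) (Reg ''q''))
         (s2(''out'' := eval Nil_expr s2, ''o'' := eval (Lit 1) (s2(''out'' := eval Nil_expr s2))))) = ?s"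
      using s2(2) nn dd eqD by simp
    have "?cw v \<le> D" if "v \<in> \<Gamma>" for v unfolding D_def by (rule cw_less[OF that]) simp
    then have "{v \<in> \<Gamma>. int D - int 0 < int (?cw v)} = {}" by (auto simp: not_less)
    then have "level_post ?q (\<lambda>v. int D - int 0 < int (?cw v)) ?s"
      unfolding level_post_def by (intro disjI2 conjI exI[of _ "[]"]) (simp_all add: expansion_val_def)
    then show "?J 0 (s2(''out'' := eval Nil_expr s2, ''o'' := eval (Lit 1) (s2(''out'' := eval Nil_expr s2)),
       ''E'' := eval (Mul (Mul (Reg ''d'') (Reg ''n'')) (Reg ''q''))
         (s2(''out'' := eval Nil_expr s2, ''o'' := eval (Lit 1) (s2(''out'' := eval Nil_expr s2))))))"
      unfolding st using s2 by simp
    show "val_size (eval (Mul (Mul (Reg ''d'') (Reg ''n'')) (Reg ''q''))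
         (s2(''out'' := eval Nil_expr s2, ''o'' := eval (Lit 1) (s2(''out'' := eval Nil_expr s2))))) \<le> S"
      using s2(2) nn dd eqD okD by simp
    then show "val_size (eval (Mul (Mul (Reg ''d'') (Reg ''n'')) (Reg ''q''))
         (s2(''out'' := eval Nil_expr s2, ''o'' := eval (Lit 1) (s2(''out'' := eval Nil_expr s2))))) \<le> S" .
  qed (use s2 in simp_all)
  have okq: "val_size (Num (1 + int q)) \<le> S"
    using counter_ok[of "Suc q"] qm counters_le_E_max(1) by simp
  have "terminates attempt_com (1 + ((6 * n + 20) + (1 + (1 + (1 + ((D + 1) * (?N + 1) + 1) + 1) + 1) + 1) + 1) + 1) ?Q s"
    unfolding attempt_com_def
    by (intro terminates_Comp terminates_Assign bounded_upd order_refl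
          terminates_mono[OF weights_com_ok[where q = ?q]] rest)
       (use b p nn dd mm qq qm okq in \<open>simp_all add: frame_def add.commute\<close>)
  moreover have "1 + ((6 * n + 20) + (1 + (1 + (1 + ((D + 1) * (?N + 1) + 1) + 1) + 1) + 1) + 1) + 1 \<le> N_attempt"
  proof -
    have "(D + 1) * (?N + 1) \<le> (E_max + 1) * (N_level + 10)" using DE by (intro mult_le_mono) simp_all
    then show ?thesis unfolding N_attempt_def by linarith
  qed
  ultimately show ?thesis by (elim terminates_mono) auto
qed

definition N_total :: nat where "N_total = q_max * (N_attempt + 1) + 8 * n + 30"

lemma bounded_input_state: "bounded (input_state n d m)"
  unfolding bounded_def input_state_def
  using counter_ok[of n] counter_ok[of d] counter_ok[of m] counters_le_E_max by simp

text \<open>Some \<open>q0 \<le> q_max\<close> separates the codes and cannot be discarded, so at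
  most \<open>q0\<close> attempts are made. Acceptance of a smaller modulus gives the expansion just
  as well.\<close>

lemma interpolation_com_ok:
  "terminates interpolation_com N_total (\<lambda>s. outputs_expansion s \<Gamma> a) (input_state n d m)"
proof -
  let ?s = "input_state n d m"
  obtain q0 where q0: "1 \<le> q0" "q0 \<le> q_max" "inj_on (code_weight (d + 1) q0 n) \<Gamma>"
    using ex_good_modulus unfolding q_max_def by blast
  let ?p = "val_of_nats (rev (map (base n) [0..<n]))"
  let ?out = "\<lambda>s. \<exists>vs. s ''out'' = expansion_val vs \<and> distinct vs \<and> set vs = \<Gamma>"
  let ?I = "\<lambda>i s. s ''p'' = ?p \<and> s ''n'' = Num (int n) \<and> s ''d'' = Num (int d) \<and> s ''m'' = Num (int m) \<and>
    s ''q'' = Num (int i) \<and> ((s ''o'' = Num 0 \<and> i < q0) \<or> (s ''o'' = Num 1 \<and> ?out s))"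
  have loop: "terminates (While (Equal (Reg ''o'') (Lit 0)) attempt_com) (q0 * (N_attempt + 1) + 1) ?out s"
    if "bounded s" "?I 0 s" for s
  proof (rule terminates_While[where I = ?I, OF _ that])
    fix i s assume b: "bounded s" and I: "?I i s" and cond: "eval (Equal (Reg ''o'') (Lit 0)) s \<noteq> Num 0"
    have lt: "i < q0" using I cond by auto
    have att: "terminates attempt_com N_attempt (\<lambda>s'. s' ''p'' = s ''p'' \<and> s' ''n'' = s ''n'' \<and> s' ''d'' = s ''d'' \<and>
       s' ''m'' = s ''m'' \<and> s' ''q'' = Num (int (Suc i)) \<and> level_post (Suc i) (\<lambda>v. True) s') s"
      by (rule attempt_com_ok) (use b I lt q0(2) in simp_all)
    have "terminates attempt_com N_attempt (?I (Suc i)) s"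
    proof (rule terminates_mono[OF att])
      fix s' assume s': "s' ''p'' = s ''p'' \<and> s' ''n'' = s ''n'' \<and> s' ''d'' = s ''d'' \<and>
       s' ''m'' = s ''m'' \<and> s' ''q'' = Num (int (Suc i)) \<and> level_post (Suc i) (\<lambda>v. True) s'"
      then have "s' ''o'' = Num 0 \<and> \<not> inj_on (code_weight (d + 1) (Suc i) n) \<Gamma> \<or> s' ''o'' = Num 1 \<and> ?out s'"
        by (simp add: level_post_def)
      moreover have "Suc i < q0" if "\<not> inj_on (code_weight (d + 1) (Suc i) n) \<Gamma>"
        using that q0(3) lt by (metis Suc_lessI)
      ultimately have "s' ''o'' = Num 0 \<and> Suc i < q0 \<or> s' ''o'' = Num 1 \<and> ?out s'" by blast
      then show "?I (Suc i) s'" using s' I by simp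
    qed simp
    then show "i < q0 \<and> terminates attempt_com N_attempt (?I (Suc i)) s" using lt by blast
  next
    fix i s assume I: "?I i s" and cond: "eval (Equal (Reg ''o'') (Lit 0)) s = Num 0"
    then show "?out s" by auto
  qed simp
  have "terminates interpolation_com ((8 * n + 20) + (q0 * (N_attempt + 1) + 1) + 1) ?out ?s"
    unfolding interpolation_com_def
    by (intro terminates_Comp order_refl terminates_mono[OF bases_com_ok] loop)
       (use bounded_input_state q0(1) in \<open>simp_all add: frame_def input_state_def\<close>)
  then show ?thesis
  proof (rule terminates_mono)
    have "q0 * (N_attempt + 1) \<le> q_max * (N_attempt + 1)" using q0(2) by (rule mult_le_mono1)
    then show "(8 * n + 20) + (q0 * (N_attempt + 1) + 1) + 1 \<le> N_total" unfolding N_total_def by linarith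
    fix s assume "?out s"
    then obtain vs where vs: "s ''out'' = expansion_val vs" "distinct vs" "set vs = \<Gamma>" by blast
    then show "outputs_expansion s \<Gamma> a"
      unfolding outputs_expansion_def expansion_val_eq
      by (intro exI[of _ "map (\<lambda>v. (v, a v)) vs"]) (auto simp: distinct_map inj_on_def)
  qed
qed

end

section \<open>Polynomial running time\<close>

text \<open>A constant factor up to \<open>3 ^ j\<close> costs \<open>j\<close> further powers of
  the size. All later exponents come from this bookkeeping.\<close>

lemma absorb_factor:
  fixes X :: nat
  assumes "3 \<le> X" "c \<le> 3 ^ j" "a + j \<le> b"
  shows "c * X ^ a \<le> X ^ b"
proof -
  have "c * X ^ a \<le> X ^ j * X ^ a"
    using assms(2) power_mono[OF assms(1), of j] by (intro mult_le_mono1) linarith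
  also have "\<dots> = X ^ (a + j)" by (simp add: power_add mult.commute)
  also have "\<dots> \<le> X ^ b" using assms by (intro power_increasing) auto
  finally show ?thesis .
qed

lemma power_two_le: "x \<le> 2 ^ a \<Longrightarrow> a * k \<le> b \<Longrightarrow> x ^ k \<le> (2::nat) ^ b"
proof -
  assume x: "x \<le> 2 ^ a" and "a * k \<le> b"
  have "x ^ k \<le> (2 ^ a) ^ k" using x by (rule power_mono) simp
  also have "\<dots> = 2 ^ (a * k)" by (simp add: power_mult)
  also have "\<dots> \<le> 2 ^ b" using \<open>a * k \<le> b\<close> by (intro power_increasing) auto
  finally show ?thesis .
qed

lemma mult_two_le: "x \<le> 2 ^ a \<Longrightarrow> y \<le> 2 ^ b \<Longrightarrow> x * y \<le> (2::nat) ^ (a + b)"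
  unfolding power_add by (rule mult_le_mono)

lemma le_two_power: "x \<le> a \<Longrightarrow> x \<le> (2::nat) ^ a"
  using less_exp[of a] by linarith

lemma two_power_mono: "x \<le> 2 ^ a \<Longrightarrow> a \<le> b \<Longrightarrow> x \<le> (2::nat) ^ b"
  by (rule order_trans[OF _ power_increasing]) auto

section \<open>Magnitudes in terms of the input size\<close>

context sparse_schubert
begin

text \<open>An integer substitute for the size measure of the theorem. It is at least 3 because
  \<open>n\<close>, \<open>d\<close> and \<open>m\<close> are positive, which is what absorbing
  constants requires.\<close>

definition input_size :: nat where "input_size = n + d + m + floorlog 2 coeff_sum"

lemma input_size_ge: "3 \<le> input_size" "n \<le> input_size" "d \<le> input_size" "m \<le> input_size" "n + d \<le> input_size" "floorlog 2 coeff_sum \<le> input_size"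
  using n_pos d_pos m_pos by (simp_all add: input_size_def)

lemma le_power_input_size: "x \<le> input_size ^ i \<Longrightarrow> i \<le> j \<Longrightarrow> x \<le> input_size ^ j"
  by (rule order_trans[OF _ power_increasing]) (use input_size_ge(1) in auto)

lemma const_le_input_size: "c \<le> 3 ^ b \<Longrightarrow> c \<le> input_size ^ b"
  using power_mono[OF input_size_ge(1), of b] by simp

lemma le_input_size_1: "x \<le> input_size \<Longrightarrow> x \<le> input_size ^ 1" by simp

lemmas absorb_input_size = absorb_factor[OF input_size_ge(1)]

lemma mult_le_input_size: "x \<le> input_size ^ i \<Longrightarrow> y \<le> input_size ^ j \<Longrightarrow> x * y \<le> input_size ^ (i + j)"
  unfolding power_add by (rule mult_le_mono)

lemma q_max_le: "q_max \<le> input_size ^ 5"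
proof -
  have "d * n * m * m \<le> input_size ^ (1 + 1 + 1 + 1)"
    using input_size_ge by (intro mult_le_input_size le_input_size_1)
  then have "d * n * m * m \<le> input_size ^ 4" by (simp add: eval_nat_numeral)
  moreover have "2 \<le> input_size ^ 4" by (rule const_le_input_size) simp
  ultimately have "q_max \<le> 2 * input_size ^ 4" unfolding q_max_def by simp
  also have "\<dots> \<le> input_size ^ 5" by (rule absorb_input_size[of _ 1]) auto
  finally show ?thesis .
qed

lemma E_max_le: "E_max \<le> input_size ^ 7"
proof -
  have "d * n * q_max \<le> input_size ^ (1 + 1 + 5)" using input_size_ge by (intro mult_le_input_size le_input_size_1 q_max_le)
  then show ?thesis by (simp add: E_max_def)
qed

lemma p_max_bound: "p_max \<le> 2 ^ (input_size ^ 3)"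
proof -
  have f: "fact n \<le> (2::nat) ^ (n * n)"
    using fact_le_power[of n, where 'a = nat] power_two_le[of n n n "n * n"] le_two_power[of n n] by simp
  have "(n + 1) * fact n \<le> 2 ^ (n + 1) * 2 ^ (n * n)"
    using f le_two_power[of "n + 1" "n + 1"] by (intro mult_le_mono) auto
  then have "(n + 1) * fact n \<le> 2 ^ (n + 1 + n * n)" by (simp only: power_add)
  moreover have "1 \<le> (2::nat) ^ (n + 1 + n * n)" by simp
  ultimately have "p_max \<le> 2 ^ (n + 1 + n * n) + 2 ^ (n + 1 + n * n)" unfolding p_max_def base_def by linarith
  also have "\<dots> = 2 ^ (n + 2 + n * n)" by simp
  also have "n + 2 + n * n \<le> input_size ^ 3"
  proof -
    have "n * n \<le> input_size ^ (1 + 1)" using input_size_ge by (intro mult_le_input_size le_input_size_1)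
    moreover have "n \<le> input_size ^ 2" "2 \<le> input_size ^ 2" using input_size_ge(2) le_power_input_size[OF le_input_size_1] const_le_input_size[of 2 2] by auto
    ultimately have "n + 2 + n * n \<le> 3 * input_size ^ 2" by (simp add: power2_eq_square)
    also have "\<dots> \<le> input_size ^ 3" by (rule absorb_input_size[of _ 1]) auto
    finally show ?thesis .
  qed
  then have "(2::nat) ^ (n + 2 + n * n) \<le> 2 ^ (input_size ^ 3)" by (intro power_increasing) auto
  finally show ?thesis .
qed

lemma point_max_bound: "point_max \<le> 2 ^ (input_size ^ 14)"
proof -
  have "input_size ^ 3 * m \<le> input_size ^ (3 + 1)" using input_size_ge by (intro mult_le_input_size le_input_size_1) auto
  then have "p_max ^ m \<le> 2 ^ (input_size ^ 13)"
    by (intro power_two_le[OF p_max_bound]) (rule le_power_input_size, auto)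
  moreover have "E_max ^ (n * q_max) \<le> 2 ^ (input_size ^ 13)"
  proof (rule power_two_le[OF le_two_power[OF E_max_le]])
    have "input_size ^ 7 * (n * q_max) \<le> input_size ^ (7 + (1 + 5))"
      using input_size_ge by (intro mult_le_input_size le_input_size_1 q_max_le) auto
    then show "input_size ^ 7 * (n * q_max) \<le> input_size ^ 13" by simp
  qed
  ultimately have "point_max \<le> 2 ^ (input_size ^ 13 + input_size ^ 13)" unfolding point_max_def by (rule mult_two_le)
  moreover have "input_size ^ 13 + input_size ^ 13 \<le> input_size ^ 14" using absorb_input_size[of 2 1 13 14] by simp
  ultimately show ?thesis by (rule two_power_mono)
qed

lemma value_max_bound: "value_max \<le> 2 ^ (input_size ^ 16)"
proof -
  have "coeff_sum < 2 ^ floorlog 2 coeff_sum" by (rule less_power_floorlog)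
  also have "\<dots> \<le> 2 ^ input_size" using input_size_ge(6) by (intro power_increasing) auto
  finally have c: "coeff_sum + 1 \<le> 2 ^ input_size" by simp
  have nd: "n * (n + d) \<le> input_size ^ 2" using mult_le_input_size[OF le_input_size_1 le_input_size_1, of n "n + d"] input_size_ge by (simp add: numeral_2_eq_2)
  have "schubert_norm_bound n d \<le> 2 ^ (input_size ^ 4)"
    unfolding schubert_norm_bound_def
  proof (rule power_two_le[OF le_two_power[OF nd]])
    have "input_size ^ 2 * (n * (n + d)) \<le> input_size ^ (2 + 2)" using nd by (intro mult_le_input_size) auto
    then show "input_size ^ 2 * (n * (n + d)) \<le> input_size ^ 4" by simp
  qed
  moreover have "point_max ^ d \<le> 2 ^ (input_size ^ 15)"
  proof (rule power_two_le[OF point_max_bound])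
    have "input_size ^ 14 * d \<le> input_size ^ (14 + 1)" using input_size_ge by (intro mult_le_input_size le_input_size_1) auto
    then show "input_size ^ 14 * d \<le> input_size ^ 15" by simp
  qed
  ultimately have "schubert_norm_bound n d * point_max ^ d \<le> 2 ^ (input_size ^ 4 + input_size ^ 15)" by (rule mult_two_le)
  with c have "value_max \<le> 2 ^ (input_size + (input_size ^ 4 + input_size ^ 15))" unfolding value_max_def by (rule mult_two_le)
  moreover have "input_size + (input_size ^ 4 + input_size ^ 15) \<le> input_size ^ 16"
    using absorb_input_size[of 3 1 15 16] le_power_input_size[of input_size 1 15] le_power_input_size[of "input_size ^ 4" 4 15] by simp
  ultimately show ?thesis by (rule two_power_mono)
qed

lemma int_max_bound: "int_max < 2 ^ (input_size ^ 18)"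
proof -
  have E: "E_max + 3 \<le> input_size ^ 8"
  proof -
    have "3 \<le> input_size ^ 7" by (rule const_le_input_size) simp
    then have "E_max + 3 \<le> 2 * input_size ^ 7" using E_max_le by simp
    also have "\<dots> \<le> input_size ^ 8" by (rule absorb_input_size[of _ 1]) auto
    finally show ?thesis .
  qed
  
  have 1: "E_max + 3 \<le> 2 ^ (input_size ^ 16)" using le_two_power[of "E_max + 3" "input_size ^ 16"] le_power_input_size[OF E, of 16] by simp
  have 2: "2 ^ E_max \<le> (2::nat) ^ (input_size ^ 16)"
    using le_power_input_size[OF E_max_le, of 16] by (intro power_increasing) auto
  have 3: "E_max ^ E_max \<le> 2 ^ (input_size ^ 16)"
  proof (rule power_two_le[OF le_two_power[OF E_max_le]])
    have "input_size ^ 7 * E_max \<le> input_size ^ (7 + 7)" by (intro mult_le_input_size E_max_le) auto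
    then show "input_size ^ 7 * E_max \<le> input_size ^ 16" by (rule le_power_input_size) simp
  qed
  have 4: "p_max ^ d \<le> 2 ^ (input_size ^ 16)"
  proof (rule power_two_le[OF p_max_bound])
    have "input_size ^ 3 * d \<le> input_size ^ (3 + 1)" using input_size_ge by (intro mult_le_input_size le_input_size_1) auto
    then show "input_size ^ 3 * d \<le> input_size ^ 16" by (rule le_power_input_size) simp
  qed
  have 5: "(d + 1) ^ n \<le> 2 ^ (input_size ^ 16)"
  proof (rule power_two_le)
    show "d + 1 \<le> 2 ^ d" using less_exp[of d] by linarith
    have "d * n \<le> input_size ^ (1 + 1)" using input_size_ge by (intro mult_le_input_size le_input_size_1)
    then show "d * n \<le> input_size ^ 16" by (rule le_power_input_size) simp
  qed
  have "int_max \<le> 2 ^ (input_size ^ 16 + input_size ^ 16 + input_size ^ 16 + input_size ^ 16 + input_size ^ 16 + input_size ^ 16)"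
    unfolding int_max_def by (intro mult_two_le 1 2 3 4 5 value_max_bound)
  also have "input_size ^ 16 + input_size ^ 16 + input_size ^ 16 + input_size ^ 16 + input_size ^ 16 + input_size ^ 16 < input_size ^ 18"
  proof -
    have "0 < input_size ^ 16" using input_size_ge(1) by simp
    \<comment> \<open>Six such summands are fewer than nine, and \<open>9 = 3 ^ 2\<close> costs two
      more powers.\<close>
    moreover have "9 * input_size ^ 16 \<le> input_size ^ 18" by (rule absorb_input_size[of _ 2]) auto
    ultimately show ?thesis by linarith
  qed
  then have "(2::nat) ^ (input_size ^ 16 + input_size ^ 16 + input_size ^ 16 + input_size ^ 16 + input_size ^ 16 + input_size ^ 16) < 2 ^ (input_size ^ 18)"
    by (intro power_strict_increasing) auto
  finally show ?thesis .
qed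

end

section \<open>Total running time\<close>

locale polynomial_run = algorithm_run n d m f \<Gamma> a "sparse_schubert.input_size n d m \<Gamma> a ^ 18" for n d m f \<Gamma> a
begin

lemma S_le: "S \<le> input_size ^ 23"
proof -
  have "n + 2 \<le> input_size ^ 2" "m + 2 \<le> input_size ^ 2"
    using absorb_input_size[of 3 1 1 2] input_size_ge by simp_all
  moreover have "input_size ^ 18 + 2 \<le> input_size ^ 19"
    using absorb_input_size[of 3 1 18 19] const_le_input_size[of 2 18] by simp
  ultimately have "S \<le> input_size ^ (2 + 2 + 19)" unfolding S_def by (intro mult_le_input_size)
  then show ?thesis by simp
qed

lemma unit_cost_le: "unit_cost \<le> input_size ^ 28"
proof -
  have "unit_cost \<le> 101 * input_size ^ 23" using S_le const_le_input_size[of 1 23] by (simp add: unit_cost_def)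
  also have "\<dots> \<le> input_size ^ 28" by (rule absorb_input_size[of _ 5]) auto
  finally show ?thesis .
qed

lemma N_total_le: "N_total \<le> input_size ^ 62"
proof -
  have c: "1 \<le> input_size ^ b" for b using input_size_ge(1) by simp
  have lift: "x \<le> c * input_size ^ a \<Longrightarrow> c \<le> 3 ^ j \<Longrightarrow> a + j \<le> b \<Longrightarrow> x \<le> input_size ^ b" for x c a j b
    using absorb_input_size[of c j a b] by (rule order_trans[rotated])
  have n1: "n \<le> input_size ^ b" "d \<le> input_size ^ b" "m \<le> input_size ^ b" if "1 \<le> b" for b
    using le_power_input_size[OF le_input_size_1 that] input_size_ge by auto
  have E1: "E_max + 1 \<le> input_size ^ 8"
    by (rule lift[of _ 2 7 1]) (use E_max_le c[of 7] in auto)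
  have point: "N_point \<le> input_size ^ 12"
  proof -
    have "8 * E_max + 30 \<le> 38 * input_size ^ 7" using E_max_le c[of 7] by simp
    then have "n * (8 * E_max + 30) \<le> input_size * (38 * input_size ^ 7)" using input_size_ge(2) by (intro mult_le_mono)
    also have "input_size ^ 8 = input_size * input_size ^ 7"
      using power_Suc[of input_size 7] by (simp del: power_Suc)
    then have "input_size * (38 * input_size ^ 7) = 38 * input_size ^ 8" by (simp only: mult.left_commute)
    finally have "N_point \<le> 38 * input_size ^ 8 + 10" by (simp add: N_point_def)
    then show ?thesis by (intro lift[of _ 48 8 4]) (use c[of 8] in auto)
  qed
  have residual: "N_residual \<le> input_size ^ 12"
    by (rule lift[of _ 11 1 4]) (use input_size_ge in \<open>auto simp: N_residual_def\<close>)
  have sample: "N_sample \<le> input_size ^ 27"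
  proof -
    have "N_point + N_residual + 4 * E_max + 30 \<le> 36 * input_size ^ 12"
      using point residual le_power_input_size[OF E_max_le, of 12] c[of 12] by simp
    also have "\<dots> \<le> input_size ^ 16" by (rule absorb_input_size[of _ 4]) auto
    finally have "(E_max + 1) * (N_point + N_residual + 4 * E_max + 30) \<le> input_size ^ (8 + 16)"
      using E1 by (intro mult_le_input_size)
    then have "N_sample \<le> 11 * input_size ^ 24" using c[of 24] by (simp add: N_sample_def)
    then show ?thesis by (rule lift[of _ _ _ 3]) auto
  qed
  have collect: "N_collect \<le> input_size ^ 36"
  proof -
    have "m + 1 \<le> input_size ^ 2" by (rule lift[of _ 2 1 1]) (use input_size_ge in auto)
    moreover have "N_sample + 30 \<le> input_size ^ 31" by (rule lift[of _ 31 27 4]) (use sample c[of 27] in auto)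
    ultimately have "(m + 1) * (N_sample + 30) \<le> input_size ^ (2 + 31)" by (intro mult_le_input_size)
    then have "N_collect \<le> 11 * input_size ^ 33" using c[of 33] by (simp add: N_collect_def)
    then show ?thesis by (rule lift[of _ _ _ 3]) auto
  qed
  have decode: "N_decode \<le> input_size ^ 36"
  proof -
    have "4 * d + 20 \<le> 24 * input_size" using input_size_ge by simp
    then have "n * (4 * d + 20) \<le> input_size * (24 * input_size)" using input_size_ge(2) by (intro mult_le_mono)
    then have "N_decode \<le> 24 * input_size ^ 2 + 30"
      by (simp add: N_decode_def N_digits_def power2_eq_square mult.left_commute)
    then show ?thesis by (intro lift[of _ 54 2 4]) (use c[of 2] in auto)
  qed
  have attempt: "N_attempt \<le> input_size ^ 52"
  proof -
    have "N_level + 10 \<le> input_size ^ 40"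
      by (rule lift[of _ 32 36 4]) (use collect decode c[of 36] in \<open>auto simp: N_level_def\<close>)
    then have "(E_max + 1) * (N_level + 10) \<le> input_size ^ (8 + 40)" using E1 by (intro mult_le_input_size)
    then have "N_attempt \<le> 57 * input_size ^ 48" using n1(1)[of 48] c[of 48] by (simp add: N_attempt_def)
    then show ?thesis by (rule lift[of _ _ _ 4]) auto
  qed
  have "N_attempt + 1 \<le> input_size ^ 53" by (rule lift[of _ 2 52 1]) (use attempt c[of 52] in auto)
  then have "q_max * (N_attempt + 1) \<le> input_size ^ (5 + 53)" by (intro mult_le_input_size q_max_le)
  then have "N_total \<le> 39 * input_size ^ 58" using n1(1)[of 58] c[of 58] by (simp add: N_total_def)
  then show ?thesis by (rule lift[of _ _ _ 4]) auto
qed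

end

theorem theorem1p1:
  shows "\<exists>(prog :: com) (C :: nat) (k :: nat).
    \<forall>(n :: nat) (d :: nat) (m :: nat) (f :: zpoly) (\<Gamma> :: nat list set) (a :: nat list \<Rightarrow> int).
      n > 0 \<longrightarrow> d > 0 \<longrightarrow> m > 0 \<longrightarrow>
      f \<in> zpolys n \<longrightarrow>
      finite \<Gamma> \<longrightarrow> (\<forall>v\<in>\<Gamma>. length v = n) \<longrightarrow> (\<forall>v\<in>\<Gamma>. a v \<noteq> 0) \<longrightarrow>
      f = (\<Sum>v\<in>\<Gamma>. of_int (a v) * schubert_list v) \<longrightarrow>
      total_degree f \<le> d \<longrightarrow> card \<Gamma> \<le> m \<longrightarrow>
      (\<exists>t s. exec n (eval_list f) (\<lambda>v x. eval_list (schubert_list v) (map int x))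
               prog (input_state n d m) t s \<and>
             outputs_expansion s \<Gamma> a \<and>
             real t \<le> real C * (real n + real d + real m +
                        log 2 (real_of_int (\<Sum>v\<in>\<Gamma>. \<bar>a v\<bar>))) ^ k)"
proof (rule exI[of _ interpolation_com], rule exI[of _ "2 ^ 90"], rule exI[of _ 90], intro allI impI)
  fix n d m :: nat and f :: zpoly and \<Gamma> :: "nat list set" and a :: "nat list \<Rightarrow> int"
  assume asm: "n > 0" "d > 0" "m > 0" "f \<in> zpolys n" "finite \<Gamma>" "\<forall>v\<in>\<Gamma>. length v = n" "\<forall>v\<in>\<Gamma>. a v \<noteq> 0"
    "f = (\<Sum>v\<in>\<Gamma>. of_int (a v) * schubert_list v)" "total_degree f \<le> d" "card \<Gamma> \<le> m"
  interpret sparse_schubert n d m f \<Gamma> a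
    using asm by unfold_locales auto
  interpret polynomial_run n d m f \<Gamma> a
    using int_max_bound by unfold_locales
  let ?L = "log 2 (real_of_int (\<Sum>v\<in>\<Gamma>. \<bar>a v\<bar>))"
  obtain t s where t: "exec n F Y interpolation_com (input_state n d m) t s" "t \<le> N_total * unit_cost"
    "outputs_expansion s \<Gamma> a"
    using interpolation_com_ok unfolding terminates_def by blast
  \<comment> \<open>The exponent 90 is the sum of 62 for the number of steps and 28 for the cost of
    one step.\<close>
  have "N_total * unit_cost \<le> input_size ^ (62 + 28)" by (intro mult_le_input_size N_total_le unit_cost_le)
  then have tX: "real t \<le> real input_size ^ 90" using t(2) by (simp flip: of_nat_power)
  have cs: "real_of_int (\<Sum>v\<in>\<Gamma>. \<bar>a v\<bar>) = real coeff_sum"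
    unfolding coeff_sum_def by (simp add: sum_nonneg)
  have log: "0 \<le> ?L \<and> real (floorlog 2 coeff_sum) \<le> ?L + 1"
  \<comment> \<open>For empty \<open>\<Gamma>\<close> the coefficient sum is 0, and
    \<open>log 2 0 = 0\<close> by convention.\<close>
  proof (cases "coeff_sum = 0")
    case True
    then show ?thesis unfolding cs by (simp add: floorlog_def log_def)
  next
    case False
    then have "2 ^ (floorlog 2 coeff_sum - 1) \<le> coeff_sum" using floorlog_bounds[of coeff_sum 2] by simp
    then have "real (floorlog 2 coeff_sum - 1) \<le> log 2 (real coeff_sum)" by (rule le_log2_of_power)
    moreover have "0 \<le> log 2 (real coeff_sum)" using False by simp
    ultimately show ?thesis unfolding cs by linarith
  qed
  \<comment> \<open>The bit length exceeds the logarithm by at most 1, which a second copy of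
    \<open>n\<close> covers. The factor 2 becomes the constant \<open>2 ^ 90\<close>.\<close>
  have "real input_size \<le> 2 * (real n + real d + real m + ?L)"
    using log asm(1) unfolding input_size_def by simp
  then have "real input_size ^ 90 \<le> (2 * (real n + real d + real m + ?L)) ^ 90"
    by (intro power_mono) auto
  also have "\<dots> = real (2 ^ 90) * (real n + real d + real m + ?L) ^ 90"
    by (simp only: power_mult_distrib of_nat_power of_nat_numeral)
  finally have "real input_size ^ 90 \<le> real (2 ^ 90) * (real n + real d + real m + ?L) ^ 90" .
  then have "real t \<le> real (2 ^ 90) * (real n + real d + real m + ?L) ^ 90" by (rule order_trans[OF tX])
  then show "\<exists>t s. exec n (eval_list f) (\<lambda>v x. eval_list (schubert_list v) (map int x))
               interpolation_com (input_state n d m) t s \<and> outputs_expansion s \<Gamma> a \<and>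
             real t \<le> real (2 ^ 90) * (real n + real d + real m + ?L) ^ 90"
    using t(1,3) by blast
qed

end
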